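(* Let $q>1$ be an integer, $G=(\mathbb{Z}/q\mathbb{Z})^\times$, and let $\mathcal{A}\in G^\sharp$ be a lattice-invariant class. Let $F,H\in\mathbb{R}[X]$ be two coprime polynomials satisfying $F(0)=H(0)=1$ and such that $(F(X)-H(X))/X^2\in\mathbb{R}[X]$. Let $\beta\ge 2$ be an upper bound for the maximum modulus of the inverses of the roots of $F$ and of $H$. Let $P\ge 2\beta$ be a real parameter. Then, for any integer parameters $J\ge 3$ and $r\ge 2$, we have $$\prod_{\substack{p\ge P,\\ p \bmod q\,\in\mathcal{A}}}\frac{F(1/p)}{H(1/p)}=\prod_{2\le j\le J}\zeta_P(j;q,\mathcal{A}|r)^{b_H(j)-b_F(j)}\times I$$ (the left product being over primes), where $$|\log I|\le\max(\deg F,\deg H)\biggl(\Bigl(\frac{|G^\sharp|\,d(\exp G)}{2}\Bigr)^{r-1}\frac{r\beta^2}{P^{2^{r+1}}}(1+2^{-r}P)+\frac{4\beta^{J+1}}{JP^J}\biggr).$$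
   Context: $G=(\mathbb{Z}/q\mathbb{Z})^\times$; $\exp G$ is the exponent of $G$ (maximal order of an element); $d(n)$ is the number of positive divisors of $n$; $\mu$ is the Möbius function. For a real polynomial $F$ with $F(0)=1$ and degree $\delta$, let $\alpha_1,\ldots,\alpha_\delta$ be the inverses of its (complex) roots, counted with multiplicity, $s_F(k)=\alpha_1^k+\cdots+\alpha_\delta^k$, and $b_F(k)=\frac1k\sum_{d|k}\mu(k/d)s_F(d)$ for $k\ge1$ (these are real numbers); similarly $b_H$ for $H$. $\mathscr{G}$ is the set of cyclic subgroups of $G$. A lattice-invariant class is a subset $\mathcal{A}\subset G$ which is the set of all generators of some cyclic subgroup of $G$; $G^\sharp$ is the set of lattice-invariant classes. $\mathcal{A}\mapsto\langle\mathcal{A}\rangle$ is a bijection $G^\sharp\to\mathscr{G}$, through which vectors and matrices indexed by $G^\sharp$ or by $\mathscr{G}$ are identified. For a character $\chi$ of $G$, viewed as a Dirichlet character modulo $q$ (zero at integers not coprime to $q$), and real $f>1$, $L_P(f,\chi)=\prod_{p\ge P}(1-\chi(p)p^{-f})^{-1}$ (product over primes). For a subgroup $G_0$ of $G$, $G_0^\perp$ is the group of characters of $G$ trivial on $G_0$. For real $s>1$ and a positive integer $t$, $\Gamma_s(t)=\bigl(\log\prod_{\chi\in G_0^\perp}L_P(ts,\chi)\bigr)_{G_0\in\mathscr{G}}$ (logarithms of positive reals). $M_1^{-1}$ is the square matrix with entry at $(\mathcal{A},K)\in G^\sharp\times\mathscr{G}$ equal to $\mu(|\langle\mathcal{A}\rangle/K|)/|G/K|$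 if $K\subset\langle\mathcal{A}\rangle$, and $0$ otherwise. For each divisor $d>1$ of $\exp G$, $N_d$ is the square matrix with entry at $(B_0,B_1)\in\mathscr{G}\times\mathscr{G}$ equal to $\sum_{K\subset B_0,\ |KB_1/K|=d}\mu(|B_0/K|)$, the sum being over subgroups $K$ of $B_0$. The (positive) approximations $\zeta_P(s;q,\mathcal{A}|r)$ are defined by $$(\log\zeta_P(s;q,\mathcal{A}|r))_{\mathcal{A}\in G^\sharp}=\sum_{0\le v\le r-1}(-1)^v\sum_{d_1\cdots d_v\le 2^r}\frac{N_{d_1}}{d_1}\cdots\frac{N_{d_v}}{d_v}M_1^{-1}\Gamma_s(d_1\cdots d_v),$$ where $(d_1,\ldots,d_v)$ ranges over $v$-tuples of divisors of $\exp G$ different from $1$ with $d_1\cdots d_v\le 2^r$ (for $v=0$ the inner sum is $M_1^{-1}\Gamma_s(1)$). *)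

theory Defs
  imports
    "HOL-Analysis.Analysis"
    "HOL-Algebra.Generated_Groups"
    "HOL-Number_Theory.Number_Theory"
    "HOL-Computational_Algebra.Computational_Algebra"
begin

definition moebius :: "nat \<Rightarrow> int" where
  "moebius n = (if squarefree n then (- 1) ^ card (prime_factors n) else 0)"

definition num_divisors :: "nat \<Rightarrow> nat" where
  "num_divisors n = card {d. d dvd n}"


section \<open>Power sums of inverse roots\<close>

definition inverse_roots :: "real poly \<Rightarrow> complex multiset" where
  "inverse_roots F = image_mset inverse (proots (map_poly complex_of_real F))"

definition power_sum :: "real poly \<Rightarrow> nat \<Rightarrow> complex" where
  "power_sum F k = (\<Sum>\<alpha>\<in>#inverse_roots F. \<alpha> ^ k)"

text \<open>The complex number below is real, because the non-real roots of a real polynomial come in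
  conjugate pairs; \<open>Re\<close> only changes its type.\<close>

definition b_coeff :: "real poly \<Rightarrow> nat \<Rightarrow> real" where
  "b_coeff F k =
     Re (1 / of_nat k * (\<Sum>d | d dvd k. of_int (moebius (k div d)) * power_sum F d))"


section \<open>Cyclic subgroups and lattice-invariant classes\<close>

definition group_exponent :: "('a, 'b) monoid_scheme \<Rightarrow> nat" where
  "group_exponent G = Max (group.ord G ` carrier G)"

definition cyclic_subgroups :: "('a, 'b) monoid_scheme \<Rightarrow> 'a set set" where
  "cyclic_subgroups G = {generate G {g} | g. g \<in> carrier G}"

definition generators :: "('a, 'b) monoid_scheme \<Rightarrow> 'a set \<Rightarrow> 'a set" where
  "generators G C = {g \<in> C. generate G {g} = C}"

definition lattice_classes :: "('a, 'b) monoid_scheme \<Rightarrow> 'a set set" where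
  "lattice_classes G = generators G ` cyclic_subgroups G"

definition quot_order :: "('a, 'b) monoid_scheme \<Rightarrow> 'a set \<Rightarrow> 'a set \<Rightarrow> nat" where
  "quot_order G B K = Coset.order ((G\<lparr>carrier := B\<rparr>) Mod K)"

definition M1_inv :: "('a, 'b) monoid_scheme \<Rightarrow> 'a set \<Rightarrow> 'a set \<Rightarrow> real" where
  "M1_inv G A K =
     (if K \<subseteq> generate G A
      then of_int (moebius (quot_order G (generate G A) K)) / real (quot_order G (carrier G) K)
      else 0)"

definition N_mat :: "('a, 'b) monoid_scheme \<Rightarrow> nat \<Rightarrow> 'a set \<Rightarrow> 'a set \<Rightarrow> real" where
  "N_mat G d B0 B1 =
     (\<Sum>K | subgroup K G \<and> K \<subseteq> B0 \<and> quot_order G (K <#>\<^bsub>G\<^esub> B1) K = d.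
        of_int (moebius (quot_order G B0 K)))"

definition mat_vec :: "'i set \<Rightarrow> ('j \<Rightarrow> 'i \<Rightarrow> real) \<Rightarrow> ('i \<Rightarrow> real) \<Rightarrow> ('j \<Rightarrow> real)" where
  "mat_vec I M u = (\<lambda>j. \<Sum>i\<in>I. M j i * u i)"


section \<open>Characters and partial Euler products\<close>

definition unit_group :: "nat \<Rightarrow> int monoid" where
  "unit_group q = units_of (residue_ring (int q))"

definition complex_units :: "complex monoid" where
  "complex_units = \<lparr>carrier = UNIV - {0}, mult = (*), one = 1\<rparr>"

text \<open>Characters are normalised to vanish outside the carrier. This makes equality of characters
  the equality of functions, and for \<open>G = unit_group q\<close> the map \<open>n \<mapsto> \<psi> (n mod q)\<close> is the
  associated Dirichlet character.\<close>

definition characters :: "('a, 'b) monoid_scheme \<Rightarrow> ('a \<Rightarrow> complex) set" where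
  "characters G = {\<psi> \<in> hom G complex_units. \<forall>x. x \<notin> carrier G \<longrightarrow> \<psi> x = 0}"

definition annihilator :: "('a, 'b) monoid_scheme \<Rightarrow> 'a set \<Rightarrow> ('a \<Rightarrow> complex) set" where
  "annihilator G G0 = {\<psi> \<in> characters G. \<forall>g\<in>G0. \<psi> g = 1}"

definition L_partial :: "nat \<Rightarrow> real \<Rightarrow> real \<Rightarrow> (int \<Rightarrow> complex) \<Rightarrow> complex" where
  "L_partial q P f \<psi> =
     (\<Prod>p. if prime p \<and> P \<le> real p
           then inverse (1 - \<psi> (int p mod int q) * of_real (real p powr (- f)))
           else 1)"

text \<open>The product over the annihilator is a positive real number, so \<open>Re\<close> only changes its type.\<close>

definition Gamma_vec :: "nat \<Rightarrow> real \<Rightarrow> real \<Rightarrow> nat \<Rightarrow> int set \<Rightarrow> real" where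
  "Gamma_vec q P s t G0 =
     ln (Re (\<Prod>\<psi>\<in>annihilator (unit_group q) G0. L_partial q P (real t * s) \<psi>))"


section \<open>The approximations of the zeta functions of classes\<close>

text \<open>The tuples \<open>(d\<^sub>1, \<dots>, d\<^sub>v)\<close> of the defining sum.\<close>

definition divisor_tuples :: "nat \<Rightarrow> nat \<Rightarrow> nat \<Rightarrow> nat list set" where
  "divisor_tuples q r v =
     {ds. length ds = v \<and> prod_list ds \<le> 2 ^ r \<and>
          (\<forall>d\<in>set ds. d dvd group_exponent (unit_group q) \<and> d \<noteq> 1)}"

text \<open>All vectors are indexed by lattice-invariant classes; the matrices \<open>N_mat\<close>, indexed by
  cyclic subgroups, act on them through the bijection \<open>A \<mapsto> generate G A\<close>.\<close>

definition N_action :: "nat \<Rightarrow> nat \<Rightarrow> (int set \<Rightarrow> real) \<Rightarrow> (int set \<Rightarrow> real)" where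
  "N_action q d =
     mat_vec (lattice_classes (unit_group q))
       (\<lambda>A0 A1. N_mat (unit_group q) d (generate (unit_group q) A0) (generate (unit_group q) A1)
                 / real d)"

definition log_zeta_approx :: "nat \<Rightarrow> real \<Rightarrow> real \<Rightarrow> nat \<Rightarrow> int set \<Rightarrow> real" where
  "log_zeta_approx q P s r A =
     (\<Sum>v<r. (- 1) ^ v *
        (\<Sum>ds\<in>divisor_tuples q r v.
           foldr (N_action q) ds
             (mat_vec (cyclic_subgroups (unit_group q)) (M1_inv (unit_group q))
               (Gamma_vec q P s (prod_list ds))) A))"

definition zeta_approx :: "nat \<Rightarrow> real \<Rightarrow> real \<Rightarrow> nat \<Rightarrow> int set \<Rightarrow> real" where
  "zeta_approx q P s r A = exp (log_zeta_approx q P s r A)"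

end

theory Submission
  imports Defs
begin

text \<open>
  Let \<open>Z A n\<close> be the logarithm of the Euler product of \<open>1 / (1 - p ^ -n)\<close> over the primes \<open>p \<ge> P\<close> in
  the class \<open>A\<close>. For a subgroup \<open>K\<close> and \<open>a \<in> G\<close> the values \<open>\<psi> a\<close>, with \<open>\<psi>\<close> in the annihilator of \<open>K\<close>,
  are equidistributed over the \<open>f\<close>-th roots of unity, where \<open>f\<close> is the order of \<open>a\<close> modulo \<open>K\<close>. So
  \<open>\<Gamma>\<close> at \<open>K\<close> is a combination of the values \<open>Z A (f * t * s)\<close>, and Moebius inversion over the subgroups of
  the cyclic group \<open>\<langle>A\<rangle>\<close> turns \<open>M\<^sub>1\<^sup>-\<^sup>1 \<Gamma>\<close> into \<open>Z (t * s)\<close> plus the sum of \<open>N\<^sub>d / d\<close> applied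
  to \<open>Z (d * t * s)\<close> over the divisors \<open>d > 1\<close> of the exponent. Iterating this recursion telescopes to the
  defining sum of the approximation, up to terms in which \<open>Z\<close> is taken at multiples of \<open>s\<close> by at least
  \<open>2 ^ r\<close>. These are small because the entries of \<open>N\<^sub>d\<close> lie in \<open>{-1, 0, 1}\<close>: the alternating sum
  defining an entry cancels unless \<open>B\<^sub>0 \<subseteq> B\<^sub>1\<close>, and then it has at most one term.

  The Euler product of \<open>F / H\<close> is reduced to the \<open>Z A j\<close> by
  \<open>ln (F x) = (\<Sum>j\<ge>1. b\<^sub>F j * ln (1 - x ^ j))\<close>; the term \<open>j = 1\<close> drops out because \<open>F\<close> and \<open>H\<close> agree
  modulo \<open>X\<^sup>2\<close>.
\<close>


section \<open>Moebius sums\<close>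

text \<open>The exponent \<open>r - 1\<close> in the bound needs economy: up to \<open>r\<close>
  divisors are applied, and a crude count would cost a factor \<open>|G^sharp| * d (exp G)\<close>
  for each. Both parts of this factor are saved once. Each application of \<open>N_d / d\<close>
  multiplies the l1 norm over the classes by at most \<open>|G^sharp| / d\<close>, but the outermost
  one is read at the single class \<open>A\<close> and costs only \<open>1 / d\<close>. As for the
  number of divisors, a tuple of full length \<open>r\<close> with product at most
  \<open>2 ^ r\<close> must be \<open>(2, ..., 2)\<close>; and for tuples that have just left the
  range, different last divisors give different integers above \<open>2 ^ r\<close>, so the last
  divisor is summed by a geometric series of ratio at most \<open>1 / 16\<close> rather than
  counted. The product of the divisors, at least \<open>2 ^ r\<close> in each remaining term,
  supplies the power of \<open>1 / 2\<close>. Summing over classes costs nothing more, since they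
  are disjoint and the l1 norm of \<open>Z n\<close> is at most a sum over all primes from
  \<open>P\<close> on. The slack gained from \<open>P >= 4\<close>, \<open>j >= 2\<close> and
  \<open>J >= 3\<close> absorbs the other constants.\<close>

lemma moebius_prime_mult:
  assumes "prime l" "\<not> l dvd m"
  shows "moebius (l * m) = - moebius m"
proof -
  have m: "m \<noteq> 0" using assms(2) by (metis dvd_0_right)
  have cop: "coprime l m" using assms prime_imp_coprime by blast
  have sf: "squarefree (l * m) \<longleftrightarrow> squarefree m"
    using assms(1) cop by (auto intro: squarefree_mult_coprime squarefree_prime dest: squarefree_multD)
  have "prime_factors (l * m) = insert l (prime_factors m)"
    using assms(1) m prime_gt_0_nat[OF assms(1)]
    by (subst prime_factors_product) (auto simp: prime_prime_factors)
  moreover have "l \<notin> prime_factors m" using assms by auto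
  ultimately show ?thesis unfolding moebius_def sf by simp
qed

lemma moebius_eq_0:
  assumes "prime l" "l dvd m"
  shows "moebius (l * m) = 0"
proof -
  have "l\<^sup>2 dvd l * m" using assms by (simp add: power2_eq_square mult_dvd_mono)
  then have "\<not> squarefree (l * m)"
    using assms(1) squarefreeD not_prime_unit by blast
  then show ?thesis by (simp add: moebius_def)
qed

lemma moebius_1 [simp]: "moebius 1 = 1" "moebius (Suc 0) = 1"
  by (simp_all add: moebius_def)

lemma abs_moebius_le_1: "\<bar>moebius n\<bar> \<le> 1"
  by (simp add: moebius_def power_abs)

text \<open>For a prime \<open>l\<close> dividing \<open>n div c\<close>, passing from \<open>k\<close> to \<open>l * k\<close> does not change \<open>gcd k c\<close>
  but flips the sign of \<open>moebius (n div k)\<close>.\<close>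

lemma sum_moebius_gcd_eq_0:
  fixes n c e :: nat
  assumes "n > 0" "c dvd n" "c \<noteq> n"
  shows "(\<Sum>k | k dvd n \<and> gcd k c = e. moebius (n div k)) = 0"
proof -
  have "n div c \<noteq> 1" using assms by (metis dvd_div_mult_self mult_1)
  then obtain l where l: "prime l" "l dvd n div c" using prime_factor_nat by blast
  have lc: "l * c dvd n" using l(2) assms(2)
    by (metis div_dvd_iff_mult dvd_div_mult_self dvd_mult_div_cancel mult.commute mult_dvd_mono dvd_refl)
  have l0: "l > 0" using l(1) prime_gt_0_nat by blast
  define S where "S = {k. k dvd n \<and> gcd k c = e}"
  \<comment> \<open>In \<open>S1\<close> the quotient \<open>n div k\<close> is prime to
    \<open>l\<close>, in \<open>S2\<close> it is divisible by \<open>l\<close> exactly once. On the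
    rest of \<open>S\<close> the square of \<open>l\<close> divides \<open>n div k\<close> and
    \<open>moebius\<close> is 0, so only these two parts matter, and multiplication by
    \<open>l\<close> matches them.\<close>
  define S1 where "S1 = {k \<in> S. \<not> l dvd n div k}"
  define S2 where "S2 = {k \<in> S. l * k dvd n \<and> \<not> l dvd n div (l * k)}"
  have fin: "finite S" unfolding S_def using assms(1)
    by (rule_tac finite_subset[OF _ finite_divisors_nat[of n]]) auto
  \<comment> \<open>With \<open>n = l * k * m\<close> and \<open>l * c dvd n\<close>, the gcd
    \<open>?g\<close> divides both \<open>k * m\<close> and \<open>k * l\<close>; as
    \<open>l\<close> does not divide \<open>m\<close>, these two have gcd \<open>k\<close>.\<close>
  have gcd_eq: "gcd (l * k) c = gcd k c" if k: "l * k dvd n" "\<not> l dvd n div (l * k)" for k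
  proof -
    define m where "m = n div (l * k)"
    have n: "n = l * k * m" using k(1) by (simp add: m_def)
    let ?g = "gcd (l * k) c"
    have "?g * l dvd n" using lc by (metis dvd_trans gcd_dvd2 mult.commute mult_dvd_mono dvd_refl)
    then have "l * ?g dvd l * (k * m)" by (simp add: n mult_ac)
    then have "?g dvd k * m" using l0 by (simp only: nat_mult_dvd_cancel1)
    moreover have "?g dvd k * l" by (simp add: mult.commute)
    ultimately have "?g dvd gcd (k * m) (k * l)" by (rule gcd_greatest)
    moreover have "gcd m l = 1"
      using k(2) l(1) m_def by (metis coprime_iff_gcd_eq_1 gcd.commute prime_imp_coprime)
    then have "gcd (k * m) (k * l) = k" by (simp add: gcd_mult_distrib_nat[symmetric])
    ultimately have "?g dvd k" by simp
    then show ?thesis by (intro dvd_antisym) auto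
  qed
  have inS2: "\<exists>k'. k = l * k' \<and> k' \<in> S2" if "k \<in> S1" for k
  proof -
    have k: "k dvd n" "gcd k c = e" "\<not> l dvd n div k" using that by (auto simp: S1_def S_def)
    have "l dvd n" using lc by (meson dvd_mult_left)
    then have "l dvd k * (n div k)" using k(1) by simp
    then have "l dvd k" using k(3) l(1) prime_dvd_mult_iff by blast
    then obtain k' where k': "k = l * k'" by blast
    have "k' \<in> S2" using k gcd_eq[of k'] by (auto simp: S2_def S_def k' dest: dvd_mult_right)
    then show ?thesis using k' by blast
  qed
  have bij: "bij_betw (\<lambda>k. l * k) S2 S1"
    using l0 inS2 by (auto simp: bij_betw_def inj_on_def S2_def S1_def S_def gcd_eq)
  have nk: "n div k = l * (n div (l * k))" if lk: "l * k dvd n" for k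
  proof -
    obtain m where m: "n = l * k * m" using lk by (elim dvdE)
    then have "k > 0" using assms(1) by (intro Nat.gr0I) auto
    then show ?thesis using m l0 by simp
  qed
  have "l dvd n div k" if "k \<in> S2" for k
    using nk[of k] that unfolding S2_def by simp
  then have disj: "S1 \<inter> S2 = {}" unfolding S1_def by blast
  have "(\<Sum>k\<in>S. moebius (n div k)) = (\<Sum>k\<in>S1 \<union> S2. moebius (n div k))"
  proof (rule sum.mono_neutral_right)
    show "\<forall>k\<in>S - (S1 \<union> S2). moebius (n div k) = 0"
    proof
      fix k assume k: "k \<in> S - (S1 \<union> S2)"
      then have "l dvd n div k" "k dvd n" by (auto simp: S1_def S_def)
      moreover then have lk: "l * k dvd n"
        by (metis dvd_div_mult_self mult_dvd_mono dvd_refl)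
      ultimately have "l dvd n div (l * k)" using k unfolding S2_def S1_def by blast
      moreover have "n div k = l * (n div (l * k))" using lk by (rule nk)
      ultimately show "moebius (n div k) = 0" using moebius_eq_0[OF l(1)] by simp
    qed
  qed (use fin in \<open>auto simp: S1_def S2_def\<close>)
  also have "\<dots> = (\<Sum>k\<in>S1. moebius (n div k)) + (\<Sum>k\<in>S2. moebius (n div k))"
    using fin disj by (intro sum.union_disjoint) (auto simp: S1_def S2_def)
  also have "(\<Sum>k\<in>S1. moebius (n div k)) = (\<Sum>k\<in>S2. moebius (n div (l * k)))"
    using sum.reindex_bij_betw[OF bij, of "\<lambda>k. moebius (n div k)"] by simp
  also have "\<dots> = (\<Sum>k\<in>S2. - moebius (n div k))"
  proof (rule sum.cong[OF refl])
    fix k assume "k \<in> S2"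
    then have lk: "l * k dvd n" "\<not> l dvd n div (l * k)" by (auto simp: S2_def)
    have "n div k = l * (n div (l * k))" using lk(1) by (rule nk)
    then show "moebius (n div (l * k)) = - moebius (n div k)"
      using moebius_prime_mult[OF l(1) lk(2)] by simp
  qed
  finally show ?thesis by (simp add: S_def sum_negf)
qed

lemma sum_moebius_divisors:
  fixes n :: nat
  assumes "n > 0"
  shows "(\<Sum>d | d dvd n. moebius (n div d)) = (if n = 1 then 1 else 0)"
proof (cases "n = 1")
  case True
  then show ?thesis by simp
next
  case False
  then show ?thesis using sum_moebius_gcd_eq_0[of n 1 1] assms by simp
qed

lemma moebius_inversion:
  fixes f :: "nat \<Rightarrow> 'a :: comm_ring_1"
  assumes "n > 0"
  shows "(\<Sum>j | j dvd n. \<Sum>d | d dvd j. of_int (moebius (j div d)) * f d) = f n"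
proof -
  have fin: "finite {d. d dvd n}" using assms by simp
  have "(\<Sum>j | j dvd n. \<Sum>d | d dvd j. of_int (moebius (j div d)) * f d)
      = (\<Sum>j | j dvd n. \<Sum>d | d dvd n \<and> d dvd j. of_int (moebius (j div d)) * f d)"
    by (intro sum.cong refl) (auto intro: dvd_trans)
  also have "\<dots> = (\<Sum>j | j dvd n. \<Sum>d | d dvd n. if d dvd j then of_int (moebius (j div d)) * f d else 0)"
    by (rule sum.cong[OF refl]) (simp add: sum.inter_filter[OF fin, symmetric])
  also have "\<dots> = (\<Sum>d | d dvd n. \<Sum>j | j dvd n. if d dvd j then of_int (moebius (j div d)) * f d else 0)"
    by (rule sum.swap)
  also have "\<dots> = (\<Sum>d | d dvd n. if d = n then f n else 0)"
  proof (rule sum.cong[OF refl])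
    fix d assume "d \<in> {d. d dvd n}"
    then have d: "d dvd n" "d > 0" using assms by (auto intro: Nat.gr0I)
    have nd: "n div d > 0" using d assms by (simp add: dvd_imp_le div_greater_zero_iff)
    have bij: "bij_betw (\<lambda>i. d * i) {i. i dvd n div d} {j. j dvd n \<and> d dvd j}"
      using d assms by (auto simp: bij_betw_def inj_on_def dvd_div_iff_mult mult.commute elim!: dvdE)
    \<comment> \<open>Passing to complementary divisors brings the sum into the form of
      \<open>sum_moebius_divisors\<close>.\<close>
    have bij2: "bij_betw (\<lambda>i. (n div d) div i) {i. i dvd n div d} {i. i dvd n div d}"
      using nd by (intro bij_betwI[where g = "\<lambda>i. (n div d) div i"])
        (auto simp: div_div_eq_right dvd_imp_le)
    have "(\<Sum>j | j dvd n. if d dvd j then of_int (moebius (j div d)) * f d else 0)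
        = (\<Sum>j | j dvd n \<and> d dvd j. of_int (moebius (j div d)) * f d)"
      using sum.inter_filter[OF fin, symmetric] by simp
    also have "\<dots> = (\<Sum>i | i dvd n div d. of_int (moebius i) * f d)"
      using d by (subst sum.reindex_bij_betw[OF bij, symmetric]) simp
    also have "\<dots> = (\<Sum>i | i dvd n div d. of_int (moebius ((n div d) div i)) * f d)"
      by (subst sum.reindex_bij_betw[OF bij2, symmetric]) simp
    also have "\<dots> = of_int (\<Sum>i | i dvd n div d. moebius ((n div d) div i)) * f d"
      by (simp add: sum_distrib_right)
    also have "\<dots> = (if d = n then f n else 0)"
      using sum_moebius_divisors[OF nd] d assms by (auto simp: dvd_div_eq_iff)
    finally show "(\<Sum>j | j dvd n. if d dvd j then of_int (moebius (j div d)) * f d else 0)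
        = (if d = n then f n else 0)" .
  qed
  also have "\<dots> = f n" using fin by simp
  finally show ?thesis .
qed


section \<open>Subgroups of cyclic groups and the matrices \<open>N_mat\<close>\<close>

lemma (in group) quot_order_mult_card:
  assumes "subgroup B G" "subgroup K G" "K \<subseteq> B"
  shows "quot_order G B K * card K = card B"
proof -
  interpret B: group "G\<lparr>carrier := B\<rparr>" using assms(1) subgroup_imp_group by blast
  have "subgroup K (G\<lparr>carrier := B\<rparr>)" using assms by (simp add: subgroup_incl)
  from B.lagrange[OF this] show ?thesis
    by (simp add: quot_order_def FactGroup_def order_def)
qed

text \<open>The group theory is carried out for any finite abelian group;
  \<open>unit_group q\<close> enters as an interpretation.\<close>

locale finite_comm_group = comm_group G for G (structure) +
  assumes finite_carrier: "finite (carrier G)"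
begin

lemma finite_subgroup: "subgroup K G \<Longrightarrow> finite K"
  using finite_carrier finite_subset subgroup.subset by blast

lemma card_subgroup_pos: "subgroup K G \<Longrightarrow> card K > 0"
  using finite_subgroup subgroup.one_closed card_gt_0_iff by blast

lemma finite_subgroups: "finite {K. subgroup K G \<and> P K}"
  by (rule finite_subset[of _ "Pow (carrier G)"]) (use finite_carrier subgroup.subset in auto)

text \<open>Multiplication maps \<open>K \<times> B\<close> onto \<open>K <#> B\<close>, and all its
  fibres have \<open>card (K \<inter> B)\<close> elements.\<close>

lemma card_set_mult:
  assumes K: "subgroup K G" and B: "subgroup B G"
  shows "card (K <#> B) * card (K \<inter> B) = card K * card B"
proof -
  have fin: "finite K" "finite B" using K B finite_subgroup by auto
  have sub: "K \<subseteq> carrier G" "B \<subseteq> carrier G" using K B subgroup.subset by auto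
  have fib: "card {p \<in> K \<times> B. fst p \<otimes> snd p = z} = card (K \<inter> B)" if "z \<in> K <#> B" for z
  proof -
    from that obtain k0 b0 where kb: "k0 \<in> K" "b0 \<in> B" "z = k0 \<otimes> b0"
      by (auto simp: set_mult_def)
    have c: "k0 \<in> carrier G" "b0 \<in> carrier G" using kb sub by auto
    \<comment> \<open>From one representation \<open>z = k0 \<otimes> b0\<close> all others arise by
      moving an element \<open>x\<close> of the intersection across the product.\<close>
    have "bij_betw (\<lambda>x. (k0 \<otimes> x, inv x \<otimes> b0)) (K \<inter> B) {p \<in> K \<times> B. fst p \<otimes> snd p = z}"
    proof (rule bij_betwI[where g = "\<lambda>p. inv k0 \<otimes> fst p"])
      show "(\<lambda>x. (k0 \<otimes> x, inv x \<otimes> b0)) \<in> K \<inter> B \<rightarrow> {p \<in> K \<times> B. fst p \<otimes> snd p = z}"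
      proof
        fix x assume x: "x \<in> K \<inter> B"
        then have xc: "x \<in> carrier G" using sub by auto
        have "x \<otimes> (inv x \<otimes> b0) = b0" using c xc by (simp add: m_assoc[symmetric])
        then have "k0 \<otimes> x \<otimes> (inv x \<otimes> b0) = k0 \<otimes> b0" using c xc by (simp add: m_assoc)
        then show "(k0 \<otimes> x, inv x \<otimes> b0) \<in> {p \<in> K \<times> B. fst p \<otimes> snd p = z}"
          using x kb K B by (auto intro: subgroup.m_closed subgroup.m_inv_closed)
      qed
      show "(\<lambda>p. inv k0 \<otimes> fst p) \<in> {p \<in> K \<times> B. fst p \<otimes> snd p = z} \<rightarrow> K \<inter> B"
      proof
        fix p assume "p \<in> {p \<in> K \<times> B. fst p \<otimes> snd p = z}"
        then obtain k b where p: "p = (k, b)" "k \<in> K" "b \<in> B" "k \<otimes> b = k0 \<otimes> b0"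
          using kb by auto
        have pc: "k \<in> carrier G" "b \<in> carrier G" using p sub by auto
        have "inv k0 \<otimes> k \<otimes> b = b0" using p pc c by (simp add: m_assoc inv_solve_left')
        then have "inv k0 \<otimes> k = b0 \<otimes> inv b" using pc c by (simp add: inv_solve_right)
        moreover have "inv k0 \<otimes> k \<in> K" using kb p K by (simp add: subgroup.m_closed subgroup.m_inv_closed)
        moreover have "b0 \<otimes> inv b \<in> B" using kb p B by (simp add: subgroup.m_closed subgroup.m_inv_closed)
        ultimately show "inv k0 \<otimes> fst p \<in> K \<inter> B" using p by simp
      qed
      show "inv k0 \<otimes> fst (k0 \<otimes> x, inv x \<otimes> b0) = x" if "x \<in> K \<inter> B" for x
        using that c sub by (auto simp: inv_solve_left')
      show "(k0 \<otimes> (inv k0 \<otimes> fst p), inv (inv k0 \<otimes> fst p) \<otimes> b0) = p"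
        if p: "p \<in> {p \<in> K \<times> B. fst p \<otimes> snd p = z}" for p
      proof -
        obtain k b where p: "p = (k, b)" "k \<in> K" "b \<in> B" "k \<otimes> b = k0 \<otimes> b0"
          using kb p by auto
        have pc: "k \<in> carrier G" "b \<in> carrier G" using p sub by auto
        have "k0 \<otimes> (inv k0 \<otimes> k) = k" using pc c by (simp add: m_assoc[symmetric])
        moreover have "inv (inv k0 \<otimes> k) \<otimes> b0 = b"
          using p pc c by (simp add: inv_mult_group m_assoc inv_solve_left')
        ultimately show ?thesis using p by simp
      qed
    qed
    from bij_betw_same_card[OF this] show ?thesis by simp
  qed
  have fin3: "finite (K <#> B)" unfolding set_mult_def using fin by simp
  have "card K * card B = (\<Sum>p\<in>K \<times> B. 1)" by (simp add: card_cartesian_product)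
  also have "\<dots> = (\<Sum>z\<in>K <#> B. \<Sum>p | p \<in> K \<times> B \<and> fst p \<otimes> snd p = z. 1)"
    by (rule sum.group[symmetric]) (use fin fin3 in \<open>force simp: set_mult_def\<close>)+
  also have "\<dots> = (\<Sum>z\<in>K <#> B. card (K \<inter> B))" using fib by simp
  finally show ?thesis by simp
qed

text \<open>The second isomorphism theorem in counting form. It makes the quotient condition in
  \<open>N_mat\<close> a condition on \<open>card (K \<inter> B)\<close>.\<close>

lemma quot_order_set_mult:
  assumes "subgroup K G" "subgroup B G"
  shows "quot_order G (K <#> B) K * card (K \<inter> B) = card B"
proof -
  have sg: "subgroup (K <#> B) G" using assms by (rule mult_subgroups)
  have "K \<subseteq> K <#> B"
  proof
    fix k assume k: "k \<in> K"
    then have "k = k \<otimes> \<one>" using assms(1) subgroup.subset by fastforce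
    then show "k \<in> K <#> B" using k subgroup.one_closed[OF assms(2)] by (auto simp: set_mult_def)
  qed
  from quot_order_mult_card[OF sg assms(1) this] card_set_mult[OF assms]
  have "(quot_order G (K <#> B) K * card (K \<inter> B)) * card K = card B * card K"
    by (metis mult.commute mult.left_commute)
  then show ?thesis using card_subgroup_pos[OF assms(1)] by simp
qed

section \<open>Cyclic subgroups, their subgroups and the orders of these\<close>

lemma cyclic_subgroup_subgroup: "B \<in> cyclic_subgroups G \<Longrightarrow> subgroup B G"
  by (auto simp: cyclic_subgroups_def intro!: generate_is_subgroup)

lemma finite_cyclic_subgroups: "finite (cyclic_subgroups G)"
  by (rule finite_subset[OF _ finite_subgroups[of "\<lambda>_. True"]])
     (auto dest: cyclic_subgroup_subgroup)

lemma pow_card_subgroup_eq_one: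
  assumes "subgroup K G" "y \<in> K"
  shows "y [^] card K = \<one>"
proof -
  interpret K: group "G\<lparr>carrier := K\<rparr>" using assms(1) subgroup_imp_group by blast
  show ?thesis using K.pow_order_eq_1[of y] assms(2)
    by (simp add: order_def nat_pow_consistent[symmetric])
qed

text \<open>By Lagrange \<open>K\<close> consists of solutions of
  \<open>y [^] card K = \<one>\<close>, and a cyclic group has at most \<open>card K\<close> of
  them. A subgroup of \<open>C\<close> is thereby determined by its order.\<close>

lemma subgroup_of_cyclic_eq:
  assumes C: "C \<in> cyclic_subgroups G" and K: "subgroup K G" "K \<subseteq> C"
  shows "K = {y \<in> C. y [^] card K = \<one>}"
proof -
  obtain x where x: "x \<in> carrier G" "C = generate G {x}"
    using C by (auto simp: cyclic_subgroups_def)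
  define n k where "n = card C" "k = card K"
  have n: "n = ord x" using x generate_pow_card n_k_def by simp
  have k: "k > 0" using card_subgroup_pos K n_k_def by simp
  have "k dvd n" using quot_order_mult_card[OF cyclic_subgroup_subgroup[OF C] K] n_k_def
    by (metis dvd_triv_right)
  then obtain m where m: "n = k * m" by (elim dvdE)
  have n0: "n > 0" using n ord_ge_1[OF finite_carrier x(1)] by simp
  then have m0: "m > 0" using m by (intro Nat.gr0I) auto
  let ?R = "{y \<in> C. y [^] k = \<one>}"
  \<comment> \<open>A solution is \<open>x [^] i\<close> with \<open>n dvd i * k\<close>, so
    \<open>i\<close> is a multiple of \<open>m\<close>, which leaves \<open>k\<close> exponents
    below \<open>n\<close>.\<close>
  have "?R \<subseteq> (\<lambda>j. x [^] (m * j)) ` {..<k}"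
  proof
    fix y assume y: "y \<in> ?R"
    then obtain i where i: "y = x [^] (i::nat)" "i < n"
      using generate_pow_nat[OF x(1)] ord_elems_inf_carrier[OF x(1)] n n0 x(2) by fastforce
    have "x [^] (i * k) = \<one>" using y i x by (simp add: nat_pow_pow)
    then have "n dvd i * k" using x n pow_eq_id by simp
    then have "m dvd i" using k m by (simp add: mult.commute)
    then obtain j where j: "i = m * j" by (elim dvdE)
    then have "j < k" using i m m0 by (simp add: mult.commute)
    then show "y \<in> (\<lambda>j. x [^] (m * j)) ` {..<k}" using i j by auto
  qed
  then have "card ?R \<le> k" by (metis card_lessThan finite_lessThan surj_card_le)
  moreover have "K \<subseteq> ?R" using pow_card_subgroup_eq_one K n_k_def by auto
  moreover have "finite ?R" using finite_subgroup[OF cyclic_subgroup_subgroup[OF C]] by simp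
  ultimately show ?thesis using card_seteq n_k_def by blast
qed

lemma cyclic_subgroup_of_card:
  assumes C: "C \<in> cyclic_subgroups G" and k: "k dvd card C"
  obtains K where "K \<in> cyclic_subgroups G" "K \<subseteq> C" "card K = k"
proof -
  obtain x where x: "x \<in> carrier G" "C = generate G {x}"
    using C by (auto simp: cyclic_subgroups_def)
  have n: "card C = ord x" using x generate_pow_card by simp
  have n0: "ord x > 0" using ord_ge_1[OF finite_carrier x(1)] by simp
  obtain m where m: "ord x = k * m" using k n by (metis dvdE)
  have m0: "m > 0" "k > 0" using m n0 by (auto intro!: Nat.gr0I)
  define y where "y = x [^] m"
  have y: "y \<in> carrier G" using x y_def by simp
  have "ord y = k" unfolding y_def using ord_pow_gen[OF x(1), of m] m m0 by simp
  then have "card (generate G {y}) = k" using generate_pow_card[OF y] by simp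
  moreover have "generate G {y} \<in> cyclic_subgroups G" using y by (auto simp: cyclic_subgroups_def)
  moreover have "generate G {y} \<subseteq> C"
  proof (rule generate_subgroup_incl)
    show "subgroup C G" using C cyclic_subgroup_subgroup by blast
    then show "{y} \<subseteq> C" unfolding y_def x(2)
      using generate_pow_nat[OF x(1)] n0 by auto
  qed
  ultimately show ?thesis using that by blast
qed

lemma subgroup_of_cyclic_inj:
  assumes "C \<in> cyclic_subgroups G" "subgroup K G" "K \<subseteq> C" "subgroup L G" "L \<subseteq> C" "card K = card L"
  shows "K = L"
  using subgroup_of_cyclic_eq[OF assms(1-3)] subgroup_of_cyclic_eq[OF assms(1,4,5)] assms(6) by simp

text \<open>\<open>N_mat\<close> sums over all subgroups of a cyclic group, while
  \<open>M1_inv\<close> is indexed by cyclic subgroups; this reconciles the two. It follows from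
  orders alone: each divisor of \<open>card C\<close> is the order of some cyclic subgroup and of
  only one subgroup.\<close>

lemma subgroup_of_cyclic_iff:
  assumes C: "C \<in> cyclic_subgroups G"
  shows "subgroup K G \<and> K \<subseteq> C \<longleftrightarrow> K \<in> cyclic_subgroups G \<and> K \<subseteq> C"
proof
  assume K: "subgroup K G \<and> K \<subseteq> C"
  then have "card K dvd card C"
    using quot_order_mult_card[OF cyclic_subgroup_subgroup[OF C]] by (metis dvd_triv_right)
  then obtain L where "L \<in> cyclic_subgroups G" "L \<subseteq> C" "card L = card K"
    using cyclic_subgroup_of_card[OF C] by metis
  then show "K \<in> cyclic_subgroups G \<and> K \<subseteq> C"
    using subgroup_of_cyclic_inj[OF C] K cyclic_subgroup_subgroup by metis
qed (auto dest: cyclic_subgroup_subgroup)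

text \<open>Turns the subgroup sum in \<open>N_mat\<close> into a divisor sum, to which the Moebius
  identities for numbers apply.\<close>

lemma bij_betw_card_subgroups:
  assumes C: "C \<in> cyclic_subgroups G"
  shows "bij_betw card {K. subgroup K G \<and> K \<subseteq> C} {k. k dvd card C}"
proof -
  have "card ` {K. subgroup K G \<and> K \<subseteq> C} = {k. k dvd card C}"
  proof (intro equalityI subsetI)
    fix k assume "k \<in> card ` {K. subgroup K G \<and> K \<subseteq> C}"
    then show "k \<in> {k. k dvd card C}"
      using quot_order_mult_card[OF cyclic_subgroup_subgroup[OF C]] by (auto intro: dvdI[OF sym] simp: mult.commute)
  next
    fix k assume "k \<in> {k. k dvd card C}"
    then obtain K where "K \<in> cyclic_subgroups G" "K \<subseteq> C" "card K = k"
      using cyclic_subgroup_of_card[OF C] by blast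
    then show "k \<in> card ` {K. subgroup K G \<and> K \<subseteq> C}" using cyclic_subgroup_subgroup by auto
  qed
  then show ?thesis using subgroup_of_cyclic_inj[OF C] by (auto simp: bij_betw_def inj_on_def)
qed

text \<open>Inside \<open>C\<close> each subgroup is the solution set of one power equation, and two
  such equations amount to a single one with the gcd of the exponents.\<close>

lemma card_Int_of_cyclic:
  assumes C: "C \<in> cyclic_subgroups G" and K: "subgroup K G" "K \<subseteq> C" and L: "subgroup L G" "L \<subseteq> C"
  shows "card (K \<inter> L) = gcd (card K) (card L)"
proof -
  have "card K dvd card C"
    using quot_order_mult_card[OF cyclic_subgroup_subgroup[OF C] K] by (metis dvd_triv_right)
  then have "gcd (card K) (card L) dvd card C" by (meson dvd_trans gcd_dvd1)
  then obtain M where M: "M \<in> cyclic_subgroups G" "M \<subseteq> C" "card M = gcd (card K) (card L)"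
    using cyclic_subgroup_of_card[OF C] by blast
  have sub: "C \<subseteq> carrier G" using C cyclic_subgroup_subgroup subgroup.subset by blast
  have "K \<inter> L = {y \<in> C. y [^] card K = \<one> \<and> y [^] card L = \<one>}"
    using subgroup_of_cyclic_eq[OF C K] subgroup_of_cyclic_eq[OF C L] by blast
  also have "\<dots> = {y \<in> C. y [^] card M = \<one>}"
    using sub M(3) by (auto simp: pow_eq_id subset_iff)
  also have "\<dots> = M" using subgroup_of_cyclic_eq[OF C cyclic_subgroup_subgroup[OF M(1)] M(2)] by simp
  finally show ?thesis using M by simp
qed

text \<open>\<open>K \<inter> B\<close> equals \<open>K \<inter> (C \<inter> B)\<close>, an
  intersection of two subgroups of the cyclic group \<open>C\<close>. Its order is therefore a gcd,
  and the condition on \<open>K\<close> depends on \<open>card K\<close> only.\<close>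

lemma N_mat_eq:
  assumes C: "C \<in> cyclic_subgroups G" and B: "subgroup B G"
  shows "N_mat G d C B =
    of_int (\<Sum>k | k dvd card C \<and> d * gcd k (card (C \<inter> B)) = card B. moebius (card C div k))"
proof -
  let ?S = "{K. subgroup K G \<and> K \<subseteq> C}"
  have Csub: "subgroup C G" using C cyclic_subgroup_subgroup by blast
  have CB: "subgroup (C \<inter> B) G" using Csub B by (rule subgroups_Inter_pair)
  have qo: "quot_order G (K <#> B) K = d \<longleftrightarrow> d * gcd (card K) (card (C \<inter> B)) = card B"
    and mo: "quot_order G C K = card C div card K" if "K \<in> ?S" for K
  proof -
    have "K \<inter> B = K \<inter> (C \<inter> B)" using that by blast
    then have g: "card (K \<inter> B) = gcd (card K) (card (C \<inter> B))"
      using card_Int_of_cyclic[OF C _ _ CB] that by simp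
    have pos: "card (K \<inter> B) > 0"
      using that B card_subgroup_pos subgroups_Inter_pair by blast
    have "quot_order G (K <#> B) K * card (K \<inter> B) = card B"
      using quot_order_set_mult that B by blast
    moreover have "quot_order G (K <#> B) K = d
        \<longleftrightarrow> quot_order G (K <#> B) K * card (K \<inter> B) = d * card (K \<inter> B)"
      using pos by simp
    ultimately show "quot_order G (K <#> B) K = d \<longleftrightarrow> d * gcd (card K) (card (C \<inter> B)) = card B"
      unfolding g by metis
    have "card C = quot_order G C K * card K" "card K > 0"
      using quot_order_mult_card[OF Csub, of K] card_subgroup_pos[of K] that by auto
    then show "quot_order G C K = card C div card K" by simp
  qed
  have "bij_betw card {K \<in> ?S. quot_order G (K <#> B) K = d}
          {k. k dvd card C \<and> d * gcd k (card (C \<inter> B)) = card B}"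
  proof (rule bij_betw_subset[OF bij_betw_card_subgroups[OF C]])
    show "{K \<in> ?S. quot_order G (K <#> B) K = d} \<subseteq> ?S" by blast
    show "card ` {K \<in> ?S. quot_order G (K <#> B) K = d}
        = {k. k dvd card C \<and> d * gcd k (card (C \<inter> B)) = card B}"
      (is "_ = ?R")
    proof -
      have "?R = {k \<in> card ` ?S. d * gcd k (card (C \<inter> B)) = card B}"
        unfolding bij_betw_imp_surj_on[OF bij_betw_card_subgroups[OF C]] by simp
      also have "\<dots> = card ` {K \<in> ?S. d * gcd (card K) (card (C \<inter> B)) = card B}" by blast
      also have "{K \<in> ?S. d * gcd (card K) (card (C \<inter> B)) = card B}
          = {K \<in> ?S. quot_order G (K <#> B) K = d}"
        by (rule Collect_cong, rule conj_cong[OF refl], rule qo[symmetric])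
      finally show ?thesis by (rule sym)
    qed
  qed
  from sum.reindex_bij_betw[OF this, of "\<lambda>k. moebius (card C div k)"]
  have "(\<Sum>k | k dvd card C \<and> d * gcd k (card (C \<inter> B)) = card B. moebius (card C div k))
    = (\<Sum>K\<in>{K \<in> ?S. quot_order G (K <#> B) K = d}. moebius (card C div card K))" by (rule sym)
  also have "\<dots> = (\<Sum>K\<in>{K \<in> ?S. quot_order G (K <#> B) K = d}. moebius (quot_order G C K))"
    by (rule sum.cong[OF refl]) (simp add: mo)
  finally show ?thesis unfolding N_mat_def by (simp add: conj_assoc)
qed

lemma abs_N_mat_le_1:
  assumes C: "C \<in> cyclic_subgroups G" and B: "subgroup B G" and d: "d > 0"
  shows "\<bar>N_mat G d C B\<bar> \<le> 1"
proof -
  let ?n = "card C" and ?c = "card (C \<inter> B)" and ?b = "card B"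
  have Csub: "subgroup C G" using C cyclic_subgroup_subgroup by blast
  have CB: "subgroup (C \<inter> B) G" using Csub B by (rule subgroups_Inter_pair)
  have cn: "?c dvd ?n" using quot_order_mult_card[OF Csub CB] by (metis Int_lower1 dvd_triv_right)
  \<comment> \<open>For \<open>d > 0\<close> the summation condition prescribes the value of
    \<open>gcd k ?c\<close>, as \<open>sum_moebius_gcd_eq_0\<close> requires. In the case
    distinction below, \<open>?c = ?n\<close> means that \<open>C\<close> is contained in
    \<open>B\<close>.\<close>
  have "d * g = ?b \<longleftrightarrow> d dvd ?b \<and> g = ?b div d" for g
    using d by (metis dvd_triv_left dvd_mult_div_cancel nonzero_mult_div_cancel_left less_numeral_extra(3))
  then have eq: "{k. k dvd ?n \<and> d * gcd k ?c = ?b} =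
      (if d dvd ?b then {k. k dvd ?n \<and> gcd k ?c = ?b div d} else {})" by auto
  show ?thesis
  proof (cases "d dvd ?b \<and> ?c = ?n")
    case False
    then have "(\<Sum>k | k dvd ?n \<and> d * gcd k ?c = ?b. moebius (?n div k)) = 0"
      unfolding eq using sum_moebius_gcd_eq_0[OF card_subgroup_pos[OF Csub] cn] by auto
    then show ?thesis unfolding N_mat_eq[OF C B] by simp
  next
    case True
    then have "{k. k dvd ?n \<and> d * gcd k ?c = ?b} = (if ?b div d dvd ?n then {?b div d} else {})"
      unfolding eq by (auto simp: gcd_nat.absorb1)
    then show ?thesis unfolding N_mat_eq[OF C B]
      using abs_moebius_le_1[of "?n div (?b div d)"] by (auto simp flip: of_int_abs)
  qed
qed

text \<open>The identity matrix, which is why the part \<open>d = 1\<close> of the recursion is the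
  main term. If \<open>C\<close> lies in \<open>B\<close>, the condition reads
  \<open>gcd k (card C) = card B\<close> and forces \<open>C = B\<close> by size.\<close>

lemma N_mat_1:
  assumes C: "C \<in> cyclic_subgroups G" and B: "subgroup B G"
  shows "N_mat G 1 C B = (if C = B then 1 else 0)"
proof -
  let ?n = "card C" and ?c = "card (C \<inter> B)" and ?b = "card B"
  have Csub: "subgroup C G" using C cyclic_subgroup_subgroup by blast
  have CB: "subgroup (C \<inter> B) G" using Csub B by (rule subgroups_Inter_pair)
  have cn: "?c dvd ?n" using quot_order_mult_card[OF Csub CB] by (metis Int_lower1 dvd_triv_right)
  have fin: "finite C" "finite B" using Csub B finite_subgroup by auto
  show ?thesis
  proof (cases "?c = ?n")
    case False
    then show ?thesis unfolding N_mat_eq[OF C B]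
      using sum_moebius_gcd_eq_0[OF card_subgroup_pos[OF Csub] cn] by auto
  next
    case c: True
    then have "C \<inter> B = C" using fin by (intro card_subset_eq) auto
    then have CB': "C \<subseteq> B" by blast
    have "{k. k dvd ?n \<and> 1 * gcd k ?c = ?b} = (if C = B then {?n} else {})"
    proof (cases "C = B")
      case False
      then have "?n < ?b" using CB' fin psubset_card_mono by blast
      moreover have "gcd k ?n \<le> ?n" for k using card_subgroup_pos[OF Csub] by (simp add: dvd_imp_le)
      ultimately have "gcd k ?n \<noteq> ?b" for k by (metis leD)
      then show ?thesis using False c by simp
    qed (use c in \<open>auto simp: gcd_nat.absorb1\<close>)
    then show ?thesis unfolding N_mat_eq[OF C B] using card_subgroup_pos[OF Csub] by auto
  qed
qed

end


section \<open>Characters of finite abelian groups\<close>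

text \<open>\<open>y ^ n - 1\<close> splits into the distinct factors \<open>y - w\<close>; taking
  \<open>y = 1 / z\<close> and multiplying by \<open>z ^ n\<close> reverses the polynomial.\<close>

lemma prod_roots_of_unity:
  fixes z :: complex
  assumes "n > 0"
  shows "(\<Prod>w | w ^ n = 1. 1 - w * z) = 1 - z ^ n"
proof -
  define p :: "complex poly" where "p = Polynomial.monom 1 n - 1"
  have poly_p: "poly p y = y ^ n - 1" for y by (simp add: p_def Polynomial.poly_monom)
  have deg: "degree p = n" and lc: "lead_coeff p = 1"
  proof -
    have "degree (1 :: complex poly) < degree (Polynomial.monom (1 :: complex) n)"
      using assms by (simp add: Polynomial.degree_monom_eq)
    then show "degree p = n" unfolding p_def
      by (metis Polynomial.degree_monom_eq diff_conv_add_uminus degree_add_eq_left degree_minus one_neq_zero)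
    then show "lead_coeff p = 1" using assms by (simp add: p_def)
  qed
  have "rsquarefree p"
    unfolding rsquarefree_roots
    using assms by (auto simp: poly_p) (simp add: p_def pderiv_diff Polynomial.pderiv_monom Polynomial.poly_monom power_0_left)
  then have "p = (\<Prod>w | poly p w = 0. [:-w, 1:])"
    using complex_poly_decompose_rsquarefree[of p] lc by simp
  then have "poly p y = (\<Prod>w | poly p w = 0. y - w)" for y 
  proof -
    assume *: "p = (\<Prod>w | poly p w = 0. [:-w, 1:])"
    have "poly p y = poly (\<Prod>w | poly p w = 0. [:-w, 1:]) y" using * by simp
    then show "poly p y = (\<Prod>w | poly p w = 0. y - w)" by (simp add: poly_prod)
  qed
  then have fac: "y ^ n - 1 = (\<Prod>w | w ^ n = 1. y - w)" for y :: complex by (simp add: poly_p)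
  show ?thesis
  proof (cases "z = 0")
    case True
    then show ?thesis using assms by simp
  next
    case False
    have "(\<Prod>w | w ^ n = 1. 1 - w * z) = (\<Prod>w | w ^ n = 1. z * (1 / z - w))"
      using False by (intro prod.cong refl) (simp add: field_simps)
    also have "\<dots> = z ^ n * ((1 / z) ^ n - 1)"
      by (simp add: prod.distrib card_roots_unity_eq[OF assms] fac)
    also have "\<dots> = 1 - z ^ n" using False by (simp add: right_diff_distrib power_mult_distrib[symmetric])
    finally show ?thesis .
  qed
qed

context finite_comm_group
begin

text \<open>Nothing is required outside \<open>H\<close>, unlike in \<open>characters\<close>:
  restriction to a subgroup is then the same function, and the constant 1 is a character on every
  subgroup. This suits the extension arguments below.\<close>

definition char_on :: "'a set \<Rightarrow> ('a \<Rightarrow> complex) \<Rightarrow> bool" where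
  "char_on H \<psi> \<longleftrightarrow> (\<forall>h\<in>H. \<psi> h \<noteq> 0) \<and> (\<forall>h\<in>H. \<forall>k\<in>H. \<psi> (h \<otimes> k) = \<psi> h * \<psi> k)"

lemma characters_iff:
  "\<phi> \<in> characters G \<longleftrightarrow> char_on (carrier G) \<phi> \<and> (\<forall>x. x \<notin> carrier G \<longrightarrow> \<phi> x = 0)"
  by (auto simp: characters_def char_on_def hom_def complex_units_def Pi_iff)

lemma char_on_subset: "char_on H \<psi> \<Longrightarrow> K \<subseteq> H \<Longrightarrow> char_on K \<psi>"
  unfolding char_on_def by blast

lemma char_on_one:
  assumes "char_on H \<psi>" "\<one> \<in> H"
  shows "\<psi> \<one> = 1"
proof -
  have "\<psi> (\<one> \<otimes> \<one>) = \<psi> \<one> * \<psi> \<one>" "\<psi> \<one> \<noteq> 0" using assms unfolding char_on_def by blast+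
  then show ?thesis by simp
qed

lemma char_on_pow:
  assumes "char_on H \<psi>" "subgroup H G" "x \<in> H"
  shows "\<psi> (x [^] (n::nat)) = \<psi> x ^ n"
proof (induction n)
  case 0
  then show ?case using char_on_one[OF assms(1)] subgroup.one_closed[OF assms(2)] by simp
next
  case (Suc n)
  have "x [^] n \<in> H" using assms(2,3) by (induction n) (auto intro: subgroup.m_closed subgroup.one_closed)
  then have "\<psi> (x [^] n \<otimes> x) = \<psi> (x [^] n) * \<psi> x" using assms(1,3) by (auto simp: char_on_def)
  then show ?case using Suc by simp
qed

lemma cyclic_subgroupsI: "x \<in> carrier G \<Longrightarrow> generate G {x} \<in> cyclic_subgroups G"
  by (auto simp: cyclic_subgroups_def)

lemma generate_eq_pows:
  assumes "x \<in> carrier G"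
  shows "generate G {x} = {x [^] k | k. k \<in> (UNIV :: nat set)}"
  by (rule generate_pow_on_finite_carrier[OF finite_carrier assms])

text \<open>\<open>f\<close> is the order of \<open>x\<close> modulo \<open>H\<close>. The criterion
  for \<open>x [^] i \<in> H\<close> is found inside the cyclic group generated by \<open>x\<close>,
  where the part lying in \<open>H\<close> is the solution set of a power equation and has order
  \<open>ord x div f\<close>.\<close>

lemma adjoin_properties:
  assumes H: "subgroup H G" and x: "x \<in> carrier G"
  defines "H' \<equiv> H <#> generate G {x}"
  defines "f \<equiv> quot_order G H' H"
  shows "subgroup H' G" "H \<subseteq> H'" "x \<in> H'" "f * card H = card H'" "f > 0"
    "x [^] (i::nat) \<in> H \<longleftrightarrow> f dvd i"
    "H' = {h \<otimes> x [^] i | h i. h \<in> H \<and> i \<in> (UNIV :: nat set)}"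
proof -
  let ?C = "generate G {x}"
  have C: "?C \<in> cyclic_subgroups G" using x by (rule cyclic_subgroupsI)
  have Csub: "subgroup ?C G" using C by (rule cyclic_subgroup_subgroup)
  have Hc: "H \<subseteq> carrier G" using H subgroup.subset by blast
  show sg: "subgroup H' G" unfolding H'_def using H Csub by (rule mult_subgroups)
  show eq: "H' = {h \<otimes> x [^] i | h i. h \<in> H \<and> i \<in> (UNIV :: nat set)}"
    unfolding H'_def set_mult_def generate_eq_pows[OF x] by blast
  show sub: "H \<subseteq> H'"
  proof
    fix h assume "h \<in> H"
    moreover from this have "h = h \<otimes> x [^] (0::nat)" using Hc by auto
    ultimately show "h \<in> H'" unfolding eq by blast
  qed
  have "x = \<one> \<otimes> x [^] (1::nat)" using x by simp
  then show "x \<in> H'" unfolding eq using subgroup.one_closed[OF H] by blast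
  show fH: "f * card H = card H'" unfolding f_def using quot_order_mult_card[OF sg H sub] .
  then show f0: "f > 0" using card_subgroup_pos[OF sg] by (intro Nat.gr0I) auto
  let ?k = "card (H \<inter> ?C)"
  have K: "subgroup (H \<inter> ?C) G" using H Csub by (rule subgroups_Inter_pair)
  have k0: "?k > 0" using K by (rule card_subgroup_pos)
  have fk: "ord x = f * ?k"
    using quot_order_set_mult[OF H Csub] generate_pow_card[OF x] f_def H'_def by simp
  have "x [^] i \<in> H \<longleftrightarrow> x [^] i \<in> H \<inter> ?C" unfolding generate_eq_pows[OF x] by blast
  also have "\<dots> \<longleftrightarrow> (x [^] i) [^] ?k = \<one>"
    using subgroup_of_cyclic_eq[OF C K] generate_eq_pows[OF x] by blast
  also have "\<dots> \<longleftrightarrow> f * ?k dvd i * ?k" using x fk by (simp add: nat_pow_pow pow_eq_id)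
  also have "\<dots> \<longleftrightarrow> f dvd i" using k0 by simp
  finally show "x [^] i \<in> H \<longleftrightarrow> f dvd i" .
qed

text \<open>The condition on \<open>w\<close> is forced by multiplicativity; conversely every such
  \<open>w\<close> defines a character by sending \<open>h \<otimes> x [^] i\<close> to
  \<open>\<psi> h * w ^ i\<close>.\<close>

lemma char_on_adjoin:
  assumes H: "subgroup H G" and x: "x \<in> carrier G" and \<psi>: "char_on H \<psi>"
  defines "H' \<equiv> H <#> generate G {x}"
  defines "f \<equiv> quot_order G H' H"
  assumes w: "w ^ f = \<psi> (x [^] f)"
  obtains \<psi>' where "char_on H' \<psi>'" "\<And>h. h \<in> H \<Longrightarrow> \<psi>' h = \<psi> h" "\<psi>' x = w"
proof -
  note adj = adjoin_properties[OF H x, folded H'_def, folded f_def]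
  have Hc: "H \<subseteq> carrier G" using H subgroup.subset by blast
  have xf: "x [^] f \<in> H" using adj(6) by simp
  have "\<psi> (x [^] f) \<noteq> 0" using \<psi> xf by (auto simp: char_on_def)
  then have w0: "w \<noteq> 0" using w adj(5) by (metis power_0_left less_numeral_extra(3))
  \<comment> \<open>Two representations differ by a power of \<open>x\<close> that lies in
    \<open>H\<close>; its exponent is a multiple of \<open>f\<close>, and on such powers
    \<open>\<psi>\<close> agrees with the corresponding power of \<open>w\<close>.\<close>
  have wd_le: "\<psi> h * w ^ i = \<psi> h' * w ^ i'"
    if h: "h \<in> H" "h' \<in> H" and e: "h \<otimes> x [^] i = h' \<otimes> x [^] i'" and le: "i \<le> i'" for h h' and i i' :: nat
  proof -
    have c: "h \<in> carrier G" "h' \<in> carrier G" using h Hc by auto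
    have "h \<otimes> x [^] i = (h' \<otimes> x [^] (i' - i)) \<otimes> x [^] i"
      using e le c x by (simp add: m_assoc nat_pow_mult)
    then have hh: "h = h' \<otimes> x [^] (i' - i)" using c x by simp
    then have "x [^] (i' - i) = inv h' \<otimes> h" using c x by (simp add: inv_solve_left)
    then have mem: "x [^] (i' - i) \<in> H" using h H by (simp add: subgroup.m_closed subgroup.m_inv_closed)
    then have "f dvd i' - i" using adj(6) by blast
    then obtain m where m: "i' - i = f * m" by (elim dvdE)
    have "\<psi> (x [^] (i' - i)) = \<psi> ((x [^] f) [^] m)" using m x by (simp add: nat_pow_pow)
    also have "\<dots> = w ^ (i' - i)" unfolding char_on_pow[OF \<psi> H xf] w[symmetric] m by (simp add: power_mult)
    finally have "\<psi> h = \<psi> h' * w ^ (i' - i)" using hh h mem \<psi> by (auto simp: char_on_def)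
    then show ?thesis using le by (simp add: power_add[symmetric])
  qed
  have wd: "\<psi> h * w ^ i = \<psi> h' * w ^ i'"
    if "h \<in> H" "h' \<in> H" "h \<otimes> x [^] i = h' \<otimes> x [^] i'" for h h' and i i' :: nat
    using wd_le[OF that] wd_le[OF that(2,1) that(3)[symmetric]] by (cases "i \<le> i'") auto
  \<comment> \<open>By \<open>wd\<close> the described value does not depend on the representation
    of \<open>y\<close>.\<close>
  define \<psi>' where "\<psi>' y = (THE v. \<exists>h\<in>H. \<exists>i::nat. y = h \<otimes> x [^] i \<and> v = \<psi> h * w ^ i)" for y
  have val: "\<psi>' (h \<otimes> x [^] i) = \<psi> h * w ^ i" if "h \<in> H" for h and i :: nat
    unfolding \<psi>'_def
  proof (rule the_equality)
    show "\<exists>ha\<in>H. \<exists>ia::nat. h \<otimes> x [^] i = ha \<otimes> x [^] ia \<and> \<psi> h * w ^ i = \<psi> ha * w ^ ia"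
      using that by blast
  next
    fix v assume "\<exists>ha\<in>H. \<exists>ia::nat. h \<otimes> x [^] i = ha \<otimes> x [^] ia \<and> v = \<psi> ha * w ^ ia"
    then obtain ha and ia :: nat where *: "ha \<in> H" "h \<otimes> x [^] i = ha \<otimes> x [^] ia" "v = \<psi> ha * w ^ ia"
      by blast
    show "v = \<psi> h * w ^ i" unfolding *(3) by (rule wd[symmetric]) (use * that in auto)
  qed
  have ext: "\<psi>' h = \<psi> h" if "h \<in> H" for h
    using val[OF that, of 0] that Hc by auto
  have "\<psi>' x = w" using val[of \<one> 1] subgroup.one_closed[OF H] char_on_one[OF \<psi>] x by simp
  moreover have "char_on H' \<psi>'"
    unfolding char_on_def
  proof (intro conjI ballI)
    fix y assume "y \<in> H'"
    then obtain h and i :: nat where y: "h \<in> H" "y = h \<otimes> x [^] i" using adj(7) by blast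
    show "\<psi>' y \<noteq> 0" unfolding y(2) val[OF y(1)] using \<psi> y(1) w0 by (auto simp: char_on_def)
    fix z assume "z \<in> H'"
    then obtain k and j :: nat where z: "k \<in> H" "z = k \<otimes> x [^] j" using adj(7) by blast
    have c: "h \<in> carrier G" "k \<in> carrier G" using y z Hc by auto
    have hk: "h \<otimes> k \<in> H" using y z H by (simp add: subgroup.m_closed)
    have "y \<otimes> z = (h \<otimes> k) \<otimes> (x [^] i \<otimes> x [^] j)" unfolding y z using c x by (simp add: m_ac)
    also have "\<dots> = (h \<otimes> k) \<otimes> x [^] (i + j)" using x by (simp add: nat_pow_mult)
    finally have "\<psi>' (y \<otimes> z) = \<psi> (h \<otimes> k) * w ^ (i + j)" using val[OF hk] by simp
    also have "\<psi> (h \<otimes> k) = \<psi> h * \<psi> k" using \<psi> y z by (auto simp: char_on_def)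
    finally show "\<psi>' (y \<otimes> z) = \<psi>' y * \<psi>' z" unfolding y(2) z(2) val[OF y(1)] val[OF z(1)]
      by (simp add: power_add)
  qed
  ultimately show ?thesis using that ext by blast
qed

text \<open>Prescribing the value at \<open>x\<close> amounts to prescribing the character on the
  larger group \<open>H'\<close>. Both the count of all extensions and the distribution of the
  values at \<open>x\<close> rest on this.\<close>

lemma extensions_with_value:
  assumes H: "subgroup H G" and x: "x \<in> carrier G" and \<psi>: "char_on H \<psi>"
  defines "H' \<equiv> H <#> generate G {x}"
  defines "f \<equiv> quot_order G H' H"
  assumes w: "w ^ f = \<psi> (x [^] f)"
  obtains \<psi>' where "char_on H' \<psi>'"
    "{\<phi> \<in> characters G. (\<forall>h\<in>H. \<phi> h = \<psi> h) \<and> \<phi> x = w} = {\<phi> \<in> characters G. \<forall>h\<in>H'. \<phi> h = \<psi>' h}"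
proof -
  note adj = adjoin_properties[OF H x, folded H'_def, folded f_def]
  have Hc: "H \<subseteq> carrier G" using H subgroup.subset by blast
  obtain \<psi>' where \<psi>': "char_on H' \<psi>'" "\<And>h. h \<in> H \<Longrightarrow> \<psi>' h = \<psi> h" "\<psi>' x = w"
    using char_on_adjoin[OF H x \<psi>] w unfolding H'_def f_def by blast
  have mult: "\<phi> (h \<otimes> x [^] i) = \<phi> h * \<phi> x ^ i"
    if "char_on H' \<phi>" "h \<in> H" for \<phi> h and i :: nat
  proof -
    have "x [^] i \<in> H'" unfolding adj(7) using subgroup.one_closed[OF H] x
      by (auto intro!: exI[of _ \<one>])
    then have "\<phi> (h \<otimes> x [^] i) = \<phi> h * \<phi> (x [^] i)"
      using that adj(2) unfolding char_on_def by blast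
    then show ?thesis using char_on_pow[OF that(1) adj(1) adj(3)] by simp
  qed
  have sub': "H' \<subseteq> carrier G" using adj(1) subgroup.subset by blast
  have "(\<forall>h\<in>H. \<phi> h = \<psi> h) \<and> \<phi> x = w \<longleftrightarrow> (\<forall>h\<in>H'. \<phi> h = \<psi>' h)" if "\<phi> \<in> characters G" for \<phi>
  proof
    assume a: "(\<forall>h\<in>H. \<phi> h = \<psi> h) \<and> \<phi> x = w"
    have ch: "char_on H' \<phi>" using that sub' char_on_subset characters_iff by blast
    show "\<forall>h\<in>H'. \<phi> h = \<psi>' h"
    proof
      fix y assume "y \<in> H'"
      then obtain h and i :: nat where y: "h \<in> H" "y = h \<otimes> x [^] i" using adj(7) by blast
      show "\<phi> y = \<psi>' y" unfolding y(2) mult[OF ch y(1)] mult[OF \<psi>'(1) y(1)]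
        using a y \<psi>' by simp
    qed
  next
    assume "\<forall>h\<in>H'. \<phi> h = \<psi>' h"
    then show "(\<forall>h\<in>H. \<phi> h = \<psi> h) \<and> \<phi> x = w" using \<psi>'(2,3) adj(2,3) by (metis subsetD)
  qed
  then show ?thesis using that[OF \<psi>'(1)] by blast
qed

text \<open>Induction upwards on \<open>H\<close>: adjoin some \<open>x\<close> outside
  \<open>H\<close>. There are \<open>f\<close> admissible values at \<open>x\<close>, each leaves
  \<open>card (carrier G) div card H'\<close> extensions, and
  \<open>f * card H = card H'\<close>.\<close>

lemma card_extensions:
  assumes "subgroup H G" "char_on H \<psi>"
  shows "card {\<phi> \<in> characters G. \<forall>h\<in>H. \<phi> h = \<psi> h} * card H = card (carrier G)"
  using assms
proof (induction "card (carrier G) - card H" arbitrary: H \<psi> rule: less_induct)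
  case less
  note H = less.prems(1) and \<psi> = less.prems(2)
  have Hc: "H \<subseteq> carrier G" using H subgroup.subset by blast
  show ?case
  proof (cases "H = carrier G")
    case True
    define \<phi> where "\<phi> x = (if x \<in> carrier G then \<psi> x else 0)" for x
    have "\<phi> \<in> characters G" using \<psi> unfolding characters_iff char_on_def True \<phi>_def by simp
    then have "{\<phi> \<in> characters G. \<forall>h\<in>H. \<phi> h = \<psi> h} = {\<phi>}"
      by (auto simp: characters_iff True \<phi>_def fun_eq_iff)
    then show ?thesis using True by simp
  next
    case False
    then obtain x where x: "x \<in> carrier G" "x \<notin> H" using Hc by blast
    define H' where "H' = H <#> generate G {x}"
    define f where "f = quot_order G H' H"
    note adj = adjoin_properties[OF H x(1), folded H'_def, folded f_def]
    have sub': "H' \<subseteq> carrier G" using adj(1) subgroup.subset by blast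
    have "H \<subset> H'" using adj x by blast
    then have "card H < card H'" using adj(1) finite_subgroup psubset_card_mono by blast
    moreover have "card H' \<le> card (carrier G)" using sub' finite_carrier card_mono by blast
    ultimately have lt: "card (carrier G) - card H' < card (carrier G) - card H" by linarith
    define W where "W = {w. w ^ f = \<psi> (x [^] f)}"
    define E where "E w = {\<phi> \<in> characters G. (\<forall>h\<in>H. \<phi> h = \<psi> h) \<and> \<phi> x = w}" for w
    have "x [^] f \<in> H" using adj(6) by simp
    then have "\<psi> (x [^] f) \<noteq> 0" using \<psi> by (auto simp: char_on_def)
    then have W: "card W = f" "finite W"
      unfolding W_def using adj(5) card_nth_roots finite_nth_roots by auto
    have cE: "card (E w) * card H' = card (carrier G)" if w: "w \<in> W" for w
    proof -
      obtain \<psi>' where "char_on H' \<psi>'" "E w = {\<phi> \<in> characters G. \<forall>h\<in>H'. \<phi> h = \<psi>' h}"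
        using extensions_with_value[OF H x(1) \<psi>] w unfolding W_def E_def f_def H'_def by blast
      then show ?thesis using less.hyps[OF lt adj(1)] by simp
    qed
    have fE: "finite (E w)" "card (E w) = card (carrier G) div card H'" if w: "w \<in> W" for w
    proof -
      \<comment> \<open>Finiteness of the set of extensions is not known in advance; it is read off
        from the count, since an infinite set has \<open>card\<close> 0.\<close>
      have "card (E w) \<noteq> 0" using cE[OF w] finite_carrier by (metis card_0_eq empty_iff mult_is_0 one_closed)
      then show "finite (E w)" by (meson card.infinite)
      show "card (E w) = card (carrier G) div card H'"
        unfolding cE[OF w, symmetric] using card_subgroup_pos[OF adj(1)] by simp
    qed
    have "{\<phi> \<in> characters G. \<forall>h\<in>H. \<phi> h = \<psi> h} = (\<Union>w\<in>W. E w)"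
    proof -
      have "\<phi> x \<in> W" if "\<phi> \<in> characters G" "\<forall>h\<in>H. \<phi> h = \<psi> h" for \<phi>
      proof -
        have "\<phi> x ^ f = \<phi> (x [^] f)"
          using char_on_pow[of "carrier G" \<phi> x f] that(1) x(1) subgroup_self
          by (simp add: characters_iff)
        then show ?thesis using that(2) \<open>x [^] f \<in> H\<close> by (simp add: W_def)
      qed
      then show ?thesis unfolding E_def by blast
    qed
    moreover have "card (\<Union>w\<in>W. E w) = (\<Sum>w\<in>W. card (E w))"
      by (rule card_UN_disjoint) (use W fE in \<open>auto simp: E_def\<close>)
    ultimately have "card {\<phi> \<in> characters G. \<forall>h\<in>H. \<phi> h = \<psi> h} = f * (card (carrier G) div card H')"
      using fE W by simp
    moreover have "card (carrier G) div card H' * card H' = card (carrier G)"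
      using quot_order_mult_card[OF subgroup_self adj(1) sub'] by (metis dvd_div_mult_self dvd_triv_right)
    ultimately show ?thesis using adj(4) by (metis mult.assoc mult.commute)
  qed
qed

lemma char_on_trivial: "char_on H (\<lambda>_. 1)"
  by (simp add: char_on_def)

lemma finite_characters: "finite (characters G)"
proof -
  have "char_on {\<one>} (\<lambda>_. 1)" by (rule char_on_trivial)
  from card_extensions[OF triv_subgroup this]
  have "card {\<phi> \<in> characters G. \<forall>h\<in>{\<one>}. \<phi> h = 1} \<noteq> 0"
    using finite_carrier by (metis card_0_eq empty_iff mult_is_0 one_closed)
  moreover have "{\<phi> \<in> characters G. \<forall>h\<in>{\<one>}. \<phi> h = 1} = characters G"
    using char_on_one by (auto simp: characters_iff)
  ultimately show ?thesis by (metis card.infinite)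
qed

lemma norm_character:
  assumes "\<phi> \<in> characters G" "x \<in> carrier G"
  shows "norm (\<phi> x) = 1"
proof -
  have ch: "char_on (carrier G) \<phi>" using assms(1) characters_iff by blast
  have "\<phi> x ^ ord x = \<phi> (x [^] ord x)"
    using char_on_pow[OF ch subgroup_self assms(2)] by simp
  also have "\<dots> = 1" using assms(2) char_on_one[OF ch] by simp
  finally have "norm (\<phi> x) ^ ord x = 1" by (metis norm_one norm_power)
  then show ?thesis using ord_ge_1[OF finite_carrier assms(2)]
    by (metis norm_ge_zero power_eq_1_iff not_one_le_zero real_norm_def abs_norm_cancel)
qed

text \<open>Every \<open>f\<close>-th root of unity is the value at \<open>x\<close> of the same
  number of characters trivial on \<open>H\<close>, namely the index of \<open>H\<close> divided by
  \<open>f\<close>, by \<open>card_extensions\<close> over the enlarged group. Grouping the factors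
  by this value leaves a power of \<open>prod_roots_of_unity\<close>.\<close>

lemma annihilator_product:
  assumes H: "subgroup H G" and x: "x \<in> carrier G"
  defines "f \<equiv> quot_order G (H <#> generate G {x}) H"
  shows "(\<Prod>\<phi>\<in>annihilator G H. 1 - \<phi> x * z) = (1 - z ^ f) ^ (quot_order G (carrier G) H div f)"
    and "f > 0" "f dvd quot_order G (carrier G) H"
proof -
  define H' where "H' = H <#> generate G {x}"
  note adj = adjoin_properties[OF H x, folded H'_def, folded f_def[folded H'_def]]
  show f0: "f > 0" using adj by simp
  have sub': "H' \<subseteq> carrier G" using adj(1) subgroup.subset by blast
  have Hc: "H \<subseteq> carrier G" using H subgroup.subset by blast
  define N where "N = quot_order G (carrier G) H'"
  have N: "N * card H' = card (carrier G)" unfolding N_def by (rule quot_order_mult_card[OF subgroup_self adj(1) sub'])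
  have "quot_order G (carrier G) H * card H = card (carrier G)"
    by (rule quot_order_mult_card[OF subgroup_self H Hc])
  then have "quot_order G (carrier G) H * card H = (N * f) * card H" using N adj(4) by (metis mult.assoc)
  then have Nf: "quot_order G (carrier G) H = N * f" using card_subgroup_pos[OF H] by simp
  then show "f dvd quot_order G (carrier G) H" by simp
  define E where "E w = {\<phi> \<in> characters G. (\<forall>h\<in>H. \<phi> h = 1) \<and> \<phi> x = w}" for w
  have cE: "card (E w) = N" if w: "w ^ f = 1" for w
  proof -
    obtain \<psi>' where "char_on H' \<psi>'" "E w = {\<phi> \<in> characters G. \<forall>h\<in>H'. \<phi> h = \<psi>' h}"
      using extensions_with_value[OF H x char_on_trivial] w unfolding E_def f_def H'_def by blast
    then have "card (E w) * card H' = N * card H'" using card_extensions[OF adj(1)] N by simp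
    then show ?thesis using card_subgroup_pos[OF adj(1)] by simp
  qed
  let ?A = "annihilator G H"
  have finA: "finite ?A" using finite_characters by (simp add: annihilator_def)
  have root: "\<phi> x ^ f = 1" if "\<phi> \<in> ?A" for \<phi>
  proof -
    have "\<phi> x ^ f = \<phi> (x [^] f)"
      using char_on_pow[of "carrier G" \<phi> x f] that x subgroup_self
      by (simp add: characters_iff annihilator_def)
    moreover have "x [^] f \<in> H" using adj(6) by simp
    ultimately show ?thesis using that by (simp add: annihilator_def)
  qed
  have "(\<Prod>\<phi>\<in>?A. 1 - \<phi> x * z) = (\<Prod>w | (w :: complex) ^ f = 1. \<Prod>\<phi> | \<phi> \<in> ?A \<and> \<phi> x = w. 1 - \<phi> x * z)"
    by (rule prod.group[symmetric]) (use finA root finite_nth_roots[OF f0] in auto)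
  also have "\<dots> = (\<Prod>w | (w :: complex) ^ f = 1. (1 - w * z) ^ N)"
  proof (rule prod.cong[OF refl])
    fix w :: complex assume w: "w \<in> {w. w ^ f = 1}"
    have "{\<phi> \<in> ?A. \<phi> x = w} = E w" by (auto simp: E_def annihilator_def)
    then show "(\<Prod>\<phi> | \<phi> \<in> ?A \<and> \<phi> x = w. 1 - \<phi> x * z) = (1 - w * z) ^ N"
      using cE[of w] w by (simp add: E_def cong: conj_cong)
  qed
  also have "\<dots> = (1 - z ^ f) ^ N"
    using prod_roots_of_unity[OF f0] by (simp add: prod_power_distrib[symmetric])
  finally show "(\<Prod>\<phi>\<in>?A. 1 - \<phi> x * z) = (1 - z ^ f) ^ (quot_order G (carrier G) H div f)"
    using Nf f0 by simp
qed

end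


section \<open>Lattice-invariant classes\<close>

context finite_comm_group
begin

lemma generate_generators:
  assumes "C \<in> cyclic_subgroups G"
  shows "generate G (generators G C) = C"
proof -
  obtain g where g: "g \<in> carrier G" "C = generate G {g}"
    using assms by (auto simp: cyclic_subgroups_def)
  have Csub: "subgroup C G" using assms by (rule cyclic_subgroup_subgroup)
  have "g \<in> C" unfolding g(2) by (rule generate.incl) simp
  then have mem: "g \<in> generators G C" using g by (auto simp: generators_def)
  show ?thesis
  proof
    show "generate G (generators G C) \<subseteq> C"
      by (rule generate_subgroup_incl[OF _ Csub]) (auto simp: generators_def)
    have "generate G {g} \<subseteq> generate G (generators G C)"
      by (rule mono_generate) (use mem in auto)
    then show "C \<subseteq> generate G (generators G C)" using g by simp
  qed
qed

lemma generate_lattice_class: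
  assumes "A \<in> lattice_classes G"
  shows "generate G A \<in> cyclic_subgroups G" "generators G (generate G A) = A"
proof -
  from assms obtain C where C: "C \<in> cyclic_subgroups G" "A = generators G C"
    unfolding lattice_classes_def by blast
  then have "generate G A = C" using generate_generators by blast
  with C show "generate G A \<in> cyclic_subgroups G" "generators G (generate G A) = A" by simp_all
qed

lemma generate_lattice_class_inj:
  assumes "A \<in> lattice_classes G" "B \<in> lattice_classes G" "generate G A = generate G B"
  shows "A = B"
  using generate_lattice_class(2)[OF assms(1)] generate_lattice_class(2)[OF assms(2)]
  unfolding assms(3) by (rule trans[OF sym])

lemma finite_lattice_classes: "finite (lattice_classes G)"
  using finite_cyclic_subgroups by (simp add: lattice_classes_def)

lemma lattice_class_subset:
  assumes "A \<in> lattice_classes G"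
  shows "A \<subseteq> carrier G"
proof -
  have "generate G A \<subseteq> carrier G"
    using generate_lattice_class(1)[OF assms] cyclic_subgroup_subgroup subgroup.subset by blast
  moreover have "generators G (generate G A) \<subseteq> generate G A" by (auto simp: generators_def)
  ultimately show ?thesis unfolding generate_lattice_class(2)[OF assms] by blast
qed

text \<open>Together with \<open>lattice_class_unique\<close> this says that the classes partition
  the group, so a prime coprime to \<open>q\<close> belongs to exactly one class.\<close>

lemma generators_in_lattice_classes:
  assumes "g \<in> carrier G"
  shows "generators G (generate G {g}) \<in> lattice_classes G" "g \<in> generators G (generate G {g})"
proof -
  show "generators G (generate G {g}) \<in> lattice_classes G"
    using assms by (auto simp: lattice_classes_def cyclic_subgroups_def)
  have "g \<in> generate G {g}" by (rule generate.incl) simp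
  then show "g \<in> generators G (generate G {g})" by (simp add: generators_def)
qed

lemma mem_lattice_class:
  assumes "A \<in> lattice_classes G" "g \<in> A"
  shows "generate G {g} = generate G A"
proof -
  have "g \<in> generators G (generate G A)" using assms generate_lattice_class(2) by simp
  then show ?thesis by (simp add: generators_def)
qed

lemma lattice_class_unique:
  assumes "A \<in> lattice_classes G" "B \<in> lattice_classes G" "g \<in> A" "g \<in> B"
  shows "A = B"
  using generate_lattice_class_inj[OF assms(1,2)]
    mem_lattice_class[OF assms(1,3)] mem_lattice_class[OF assms(2,4)] by simp

lemma lattice_classes_nonempty: "lattice_classes G \<noteq> {}"
  using generators_in_lattice_classes(1)[OF one_closed] by blast

text \<open>Pure regrouping, separated from the analysis by leaving \<open>z\<close> arbitrary. The
  index of \<open>K\<close> cancels against the denominator in \<open>M1_inv\<close>, and collecting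
  the subgroups \<open>K\<close> of \<open>C\<close> by the value \<open>d\<close> of the quotient
  order produces the entries of \<open>N_mat\<close>. \<open>D\<close> is any finite set containing
  all values that occur.\<close>

lemma mat_vec_M1_inv:
  fixes \<Gamma> :: "'a set \<Rightarrow> real"
  assumes A: "A \<in> lattice_classes G" and D: "finite D"
    and inD: "\<And>K B. subgroup K G \<Longrightarrow> B \<in> lattice_classes G \<Longrightarrow>
      quot_order G (K <#> generate G B) K \<in> D"
    and \<Gamma>: "\<And>K. K \<in> cyclic_subgroups G \<Longrightarrow> \<Gamma> K = (\<Sum>B\<in>lattice_classes G.
      real (quot_order G (carrier G) K) / real (quot_order G (K <#> generate G B) K)
        * z B (quot_order G (K <#> generate G B) K))"
  shows "mat_vec (cyclic_subgroups G) (M1_inv G) \<Gamma> A =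
    (\<Sum>d\<in>D. \<Sum>B\<in>lattice_classes G. N_mat G d (generate G A) (generate G B) / real d * z B d)"
proof -
  define C where "C = generate G A"
  have C: "C \<in> cyclic_subgroups G" unfolding C_def using A by (rule generate_lattice_class)
  define L where "L = lattice_classes G"
  define S where "S = {K. subgroup K G \<and> K \<subseteq> C}"
  define f where "f K B = quot_order G (K <#> generate G B) K" for K B
  define m where "m K = real_of_int (moebius (quot_order G C K))" for K
  have finS: "finite S" unfolding S_def by (rule finite_subgroups)
  have S: "S = {K \<in> cyclic_subgroups G. K \<subseteq> C}"
    unfolding S_def using subgroup_of_cyclic_iff[OF C] by blast
  have "mat_vec (cyclic_subgroups G) (M1_inv G) \<Gamma> A
      = (\<Sum>K\<in>cyclic_subgroups G. if K \<subseteq> C then m K / real (quot_order G (carrier G) K) * \<Gamma> K else 0)"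
    unfolding mat_vec_def M1_inv_def C_def m_def by (intro sum.cong refl) simp
  also have "\<dots> = (\<Sum>K\<in>S. m K / real (quot_order G (carrier G) K) * \<Gamma> K)"
    unfolding S by (rule sum.inter_filter[OF finite_cyclic_subgroups, symmetric])
  also have "\<dots> = (\<Sum>K\<in>S. \<Sum>B\<in>L. m K / real (f K B) * z B (f K B))"
  proof (rule sum.cong[OF refl])
    fix K assume K: "K \<in> S"
    then have "quot_order G (carrier G) K * card K = card (carrier G)"
      unfolding S_def using quot_order_mult_card[OF subgroup_self] subgroup.subset by blast
    then have "quot_order G (carrier G) K \<noteq> 0"
      using card_subgroup_pos[OF subgroup_self] by (metis mult_is_0 less_numeral_extra(3))
    moreover have "\<Gamma> K = (\<Sum>B\<in>L. real (quot_order G (carrier G) K) / real (f K B) * z B (f K B))"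
      unfolding L_def f_def by (rule \<Gamma>) (use K S in blast)
    ultimately show "m K / real (quot_order G (carrier G) K) * \<Gamma> K = (\<Sum>B\<in>L. m K / real (f K B) * z B (f K B))"
      by (simp add: sum_distrib_left)
  qed
  also have "\<dots> = (\<Sum>B\<in>L. \<Sum>K\<in>S. m K / real (f K B) * z B (f K B))" by (rule sum.swap)
  also have "\<dots> = (\<Sum>B\<in>L. \<Sum>d\<in>D. N_mat G d C (generate G B) / real d * z B d)"
  proof (rule sum.cong[OF refl])
    fix B assume B: "B \<in> L"
    have "(\<Sum>K\<in>S. m K / real (f K B) * z B (f K B))
        = (\<Sum>d\<in>D. \<Sum>K | K \<in> S \<and> f K B = d. m K / real (f K B) * z B (f K B))"
      by (rule sum.group[symmetric]) (use finS D inD B in \<open>auto simp: S_def f_def L_def\<close>)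
    also have "\<dots> = (\<Sum>d\<in>D. N_mat G d C (generate G B) / real d * z B d)"
    proof (rule sum.cong[OF refl])
      fix d
      have "(\<Sum>K | K \<in> S \<and> f K B = d. m K / real (f K B) * z B (f K B))
          = (\<Sum>K | K \<in> S \<and> f K B = d. m K) / real d * z B d"
        by (simp add: sum_divide_distrib sum_distrib_right)
      also have "(\<Sum>K | K \<in> S \<and> f K B = d. m K) = N_mat G d C (generate G B)"
        unfolding N_mat_def m_def f_def S_def by (simp add: conj_assoc)
      finally show "(\<Sum>K | K \<in> S \<and> f K B = d. m K / real (f K B) * z B (f K B))
        = N_mat G d C (generate G B) / real d * z B d" .
    qed
    finally show "(\<Sum>K\<in>S. m K / real (f K B) * z B (f K B))
      = (\<Sum>d\<in>D. N_mat G d C (generate G B) / real d * z B d)" .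
  qed
  also have "\<dots> = (\<Sum>d\<in>D. \<Sum>B\<in>L. N_mat G d C (generate G B) / real d * z B d)" by (rule sum.swap)
  finally show ?thesis by (simp add: C_def L_def)
qed

lemma quot_order_dvd_ord:
  assumes "subgroup K G" "g \<in> carrier G"
  shows "quot_order G (K <#> generate G {g}) K dvd ord g"
  using quot_order_set_mult[OF assms(1) cyclic_subgroup_subgroup[of "generate G {g}"]]
    generate_pow_card[OF assms(2)] assms(2)
  by (metis (mono_tags, lifting) cyclic_subgroups_def dvd_triv_left mem_Collect_eq)

end

section \<open>The unit group modulo \<open>q\<close> and its exponent\<close>

lemma unit_group_properties:
  assumes "q > 1"
  shows "finite_comm_group (unit_group q)"
    and "carrier (unit_group q) = {x. 0 < x \<and> x < int q \<and> coprime x (int q)}"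
    and "\<one>\<^bsub>unit_group q\<^esub> = 1"
    and "x \<in> carrier (unit_group q) \<Longrightarrow> x [^]\<^bsub>unit_group q\<^esub> (n::nat) = x ^ n mod int q"
proof -
  interpret residues "int q" "residue_ring (int q)" using assms by unfold_locales auto
  have c: "comm_group (unit_group q)" unfolding unit_group_def by (rule units_comm_group)
  show car: "carrier (unit_group q) = {x. 0 < x \<and> x < int q \<and> coprime x (int q)}"
    unfolding unit_group_def units_of_carrier by (rule res_units_eq)
  have "carrier (unit_group q) \<subseteq> {0<..<int q}" unfolding car by auto
  then have "finite (carrier (unit_group q))" using finite_subset by blast
  with c show "finite_comm_group (unit_group q)"
    by (intro finite_comm_group.intro) (auto simp: finite_comm_group_axioms_def)
  show "\<one>\<^bsub>unit_group q\<^esub> = 1" unfolding unit_group_def units_of_one res_one_eq ..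
  assume x: "x \<in> carrier (unit_group q)"
  then have xU: "x \<in> Units (residue_ring (int q))" unfolding unit_group_def units_of_carrier .
  have "x mod int q = x" using x unfolding car by simp
  then show "x [^]\<^bsub>unit_group q\<^esub> n = x ^ n mod int q"
    using pow_cong[of x n] units_of_pow[OF xU, of n] by (simp add: unit_group_def)
qed

lemma ord_unit_group:
  assumes "q > 1" "x \<in> carrier (unit_group q)"
  shows "group.ord (unit_group q) x = Pocklington.ord q (nat x)"
proof -
  interpret finite_comm_group "unit_group q" using unit_group_properties(1)[OF assms(1)] .
  have x: "0 < x" using assms(2) unit_group_properties(2)[OF assms(1)] by simp
  show ?thesis
  proof (subst ord_unique[OF assms(2)], intro allI)
    fix n
    have "x [^]\<^bsub>unit_group q\<^esub> n = \<one>\<^bsub>unit_group q\<^esub> \<longleftrightarrow> [x ^ n = 1] (mod int q)"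
      unfolding unit_group_properties(4)[OF assms] unit_group_properties(3)[OF assms(1)]
      using assms(1) by (simp add: cong_def)
    also have "\<dots> \<longleftrightarrow> [int (nat x ^ n) = int 1] (mod int q)" using x by simp
    also have "\<dots> \<longleftrightarrow> [nat x ^ n = 1] (mod q)" by (rule cong_int_iff)
    also have "\<dots> \<longleftrightarrow> Pocklington.ord q (nat x) dvd n" by (rule ord_divides)
    finally show "x [^]\<^bsub>unit_group q\<^esub> n = \<one>\<^bsub>unit_group q\<^esub> \<longleftrightarrow> Pocklington.ord q (nat x) dvd n" .
  qed
qed

text \<open>\<open>group_exponent\<close> is a maximum of orders. Its identification with the
  Carmichael function yields that every order divides it, which is what restricts \<open>d\<close>
  to divisors of the exponent.\<close>

lemma group_exponent_unit_group:
  assumes "q > 1"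
  shows "group_exponent (unit_group q) = Carmichael q"
proof -
  have tot: "nat ` carrier (unit_group q) = totatives q"
  proof
    show "nat ` carrier (unit_group q) \<subseteq> totatives q"
    proof
      fix k assume "k \<in> nat ` carrier (unit_group q)"
      then obtain x where x: "k = nat x" "0 < x" "x < int q" "coprime x (int q)"
        unfolding unit_group_properties(2)[OF assms] by blast
      then have "x = int k" by simp
      then show "k \<in> totatives q" using x(2-4) by (simp add: totatives_def)
    qed
    show "totatives q \<subseteq> nat ` carrier (unit_group q)"
    proof
      fix k assume k: "k \<in> totatives q"
      then have "k \<noteq> q" using assms by (auto simp: totatives_def)
      then have "int k \<in> carrier (unit_group q)" unfolding unit_group_properties(2)[OF assms]
        using k by (auto simp: totatives_def)
      then show "k \<in> nat ` carrier (unit_group q)" by (metis image_eqI nat_int)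
    qed
  qed
  have "group.ord (unit_group q) ` carrier (unit_group q) = (\<lambda>x. ord q (nat x)) ` carrier (unit_group q)"
    using ord_unit_group[OF assms] by (intro image_cong refl) auto
  also have "\<dots> = ord q ` totatives q" unfolding tot[symmetric] image_image ..
  finally show ?thesis unfolding group_exponent_def Carmichael_altdef using assms by simp
qed

lemma ord_dvd_group_exponent:
  assumes "q > 1" "x \<in> carrier (unit_group q)"
  shows "group.ord (unit_group q) x dvd group_exponent (unit_group q)"
proof -
  have "0 < x" "coprime x (int q)" using assms(2) unfolding unit_group_properties(2)[OF assms(1)] by auto
  then obtain k where "x = int k" "coprime (int k) (int q)" by (metis zero_less_imp_eq_int)
  then have "coprime q (nat x)" by (simp add: coprime_commute)
  then show ?thesis
    unfolding ord_unit_group[OF assms] group_exponent_unit_group[OF assms(1)]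
    using assms(1) by (intro ord_dvd_Carmichael) auto
qed

lemma group_exponent_pos: "q > 1 \<Longrightarrow> group_exponent (unit_group q) > 0"
  by (simp add: group_exponent_unit_group)


section \<open>Logarithms of partial Euler products\<close>

text \<open>The quantity \<open>Z A n\<close> of the overview. Natural exponents suffice, because
  every argument that occurs is an integer multiple of an integer \<open>j\<close>. The sum
  converges for \<open>n \<ge> 2\<close>.\<close>

definition class_log_zeta :: "nat \<Rightarrow> real \<Rightarrow> int set \<Rightarrow> nat \<Rightarrow> real" where
  "class_log_zeta q P A n =
     (\<Sum>p. if prime p \<and> P \<le> real p \<and> int p mod int q \<in> A then - ln (1 - (1 / real p) ^ n) else 0)"

lemma neg_ln_one_minus_le:
  fixes x :: real
  assumes "0 \<le> x" "x < 1"
  shows "- ln (1 - x) \<le> x / (1 - x)"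
proof -
  have "- ln (1 - x) = ln (inverse (1 - x))" using assms by (simp add: ln_inverse)
  also have "\<dots> \<le> inverse (1 - x) - 1" using assms by (intro ln_le_minus_one) simp
  also have "\<dots> = x / (1 - x)" using assms by (simp add: field_simps)
  finally show ?thesis .
qed

lemma neg_ln_one_minus_bounds:
  fixes x :: real
  assumes "0 \<le> x" "x \<le> 1 / 2"
  shows "0 \<le> - ln (1 - x)" "- ln (1 - x) \<le> 2 * x"
proof -
  show "0 \<le> - ln (1 - x)" using assms by simp
  have "- ln (1 - x) \<le> x / (1 - x)" using assms by (intro neg_ln_one_minus_le) auto
  also have "\<dots> \<le> x / (1 / 2)" using assms by (intro divide_left_mono) auto
  finally show "- ln (1 - x) \<le> 2 * x" by simp
qed

lemma prime_inverse_power_bounds: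
  assumes "prime p" "n \<ge> 2"
  shows "0 < (1 / real p) ^ n" "(1 / real p) ^ n \<le> inverse (real p ^ 2)" "(1 / real p) ^ n \<le> 1 / 4"
proof -
  have p: "real p \<ge> 2" using prime_ge_2_nat[OF assms(1)] by simp
  then show "0 < (1 / real p) ^ n" by simp
  have "(1 / real p) ^ n \<le> (1 / real p) ^ 2" using p assms(2) by (intro power_decreasing) auto
  then show 1: "(1 / real p) ^ n \<le> inverse (real p ^ 2)" by (simp add: power_divide inverse_eq_divide)
  have "(2::real) ^ 2 \<le> real p ^ 2" using p by (intro power_mono) auto
  then have "inverse (real p ^ 2) \<le> inverse (2 ^ 2)" by (rule le_imp_inverse_le) simp
  with 1 show "(1 / real p) ^ n \<le> 1 / 4" by simp
qed

lemma neg_ln_prime_bounds: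
  assumes "prime p" "n \<ge> 2"
  shows "0 \<le> - ln (1 - (1 / real p) ^ n)" "- ln (1 - (1 / real p) ^ n) \<le> 2 * inverse (real p ^ 2)"
proof -
  have 1: "0 \<le> (1 / real p) ^ n" "(1 / real p) ^ n \<le> 1 / 2"
    using prime_inverse_power_bounds[OF assms] by linarith+
  show "0 \<le> - ln (1 - (1 / real p) ^ n)" using neg_ln_one_minus_bounds(1)[OF 1] .
  show "- ln (1 - (1 / real p) ^ n) \<le> 2 * inverse (real p ^ 2)"
    using neg_ln_one_minus_bounds(2)[OF 1] prime_inverse_power_bounds(2)[OF assms] by linarith
qed

lemma summable_neg_ln_primes:
  assumes "n \<ge> 2" and R: "\<And>p. R p \<Longrightarrow> prime p"
  shows "summable (\<lambda>p. if R p then - ln (1 - (1 / real p) ^ n) else 0)"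
proof (rule summable_comparison_test'[where g = "\<lambda>p. 2 * inverse (real p ^ 2)" and N = 0])
  show "summable (\<lambda>p. 2 * inverse (real p ^ 2))"
    by (intro summable_mult inverse_power_summable) simp
  show "norm (if R p then - ln (1 - (1 / real p) ^ n) else 0) \<le> 2 * inverse (real p ^ 2)" for p
    using neg_ln_prime_bounds[OF R assms(1), of p] by (cases "R p") auto
qed

text \<open>Writes the Euler factors as inverses of \<open>1 + z p\<close> with a natural exponent,
  the form to which the summability criterion for infinite products applies.\<close>

lemma L_partial_eq_prodinf:
  assumes "t * j > 0"
  shows "L_partial q P (real t * real j) \<psi> =
    (\<Prod>p. inverse (1 + (if prime p \<and> P \<le> real p
       then - \<psi> (int p mod int q) * of_real ((1 / real p) ^ (t * j)) else 0)))"
  unfolding L_partial_def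
proof (rule prodinf_cong)
  fix p
  have "real p powr (- (real t * real j)) = (1 / real p) ^ (t * j)" if "prime p"
  proof -
    have "real p > 0" using prime_gt_0_nat[OF that] by simp
    then have "real p powr (- real (t * j)) = inverse (real p ^ (t * j))"
      by (simp only: powr_minus powr_realpow)
    then show ?thesis by (simp add: power_divide inverse_eq_divide)
  qed
  then show "(if prime p \<and> P \<le> real p
         then inverse (1 - \<psi> (int p mod int q) * complex_of_real (real p powr - (real t * real j))) else 1) =
        inverse (1 + (if prime p \<and> P \<le> real p
       then - \<psi> (int p mod int q) * of_real ((1 / real p) ^ (t * j)) else 0))"
    by simp
qed

lemma convergent_prod_L_partial:
  fixes c :: "nat \<Rightarrow> complex" and P :: real
  assumes "n \<ge> 2" and c: "\<And>p. norm (c p) \<le> 1"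
  defines "z \<equiv> \<lambda>p. if prime p \<and> P \<le> real p then - c p * of_real ((1 / real p) ^ n) else 0"
  shows "convergent_prod (\<lambda>p. 1 + z p)"
proof (rule summable_imp_convergent_prod_complex)
  \<comment> \<open>The first bound gives absolute summability, the second keeps every factor away
    from 0.\<close>
  have z: "norm (z p) \<le> inverse (real p ^ 2) \<and> norm (z p) \<le> 1 / 4" for p
  proof (cases "prime p \<and> P \<le> real p")
    case True
    then have "norm (z p) = norm (c p) * (1 / real p) ^ n" by (simp add: z_def norm_mult norm_power norm_divide)
    also have "\<dots> \<le> 1 * (1 / real p) ^ n" using c by (intro mult_right_mono) auto
    finally show ?thesis using prime_inverse_power_bounds[of p n] True assms(1) by linarith
  qed (auto simp: z_def)
  show "summable (\<lambda>k. cmod (z k))"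
    by (rule summable_comparison_test'[where g = "\<lambda>p. inverse (real p ^ 2)" and N = 0])
       (use z inverse_power_summable[of 2] in auto)
  show "z k \<noteq> - 1" for k
  proof
    assume "z k = - 1"
    then have "norm (z k) = 1" by simp
    then show False using z[of k] by simp
  qed
qed

text \<open>The product over characters is finite and each infinite product converges, so they may
  be interchanged. The Euler factors at \<open>p\<close> then combine by
  \<open>annihilator_product\<close>, where the order involved depends only on the class of
  \<open>p\<close>; sorting primes by class gives the sum over \<open>B\<close>.\<close>

lemma Gamma_vec_eq:
  assumes q: "q > 1" and j: "j \<ge> 2" and t: "t \<ge> 1" and K: "subgroup K (unit_group q)"
  defines "G \<equiv> unit_group q"
  shows "Gamma_vec q P (real j) t K = (\<Sum>B\<in>lattice_classes G.
      real (quot_order G (carrier G) K) / real (quot_order G (K <#>\<^bsub>G\<^esub> generate G B) K)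
        * class_log_zeta q P B (quot_order G (K <#>\<^bsub>G\<^esub> generate G B) K * (t * j)))"
proof -
  interpret finite_comm_group G unfolding G_def using q by (rule unit_group_properties)
  note K' = K[folded G_def]
  define L where "L = lattice_classes G"
  define f where "f B = quot_order G (K <#>\<^bsub>G\<^esub> generate G B) K" for B
  define idx where "idx = quot_order G (carrier G) K"
  define n where "n = t * j"
  have n: "n \<ge> 2" using j t unfolding n_def by (metis One_nat_def Suc_leI dual_order.trans mult_le_mono1 mult_1 not_less_eq_eq)
  define a where "a p = int p mod int q" for p :: nat
  define Q where "Q p \<longleftrightarrow> prime p \<and> P \<le> real p" for p
  define z where "z \<phi> p = (if Q p then - \<phi> (a p) * complex_of_real ((1 / real p) ^ n) else 0)"
    for \<phi> :: "int \<Rightarrow> complex" and p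
  \<comment> \<open>The logarithm of all Euler factors at \<open>p\<close> together. At most the
    class containing \<open>a p\<close> contributes, and none does if \<open>p\<close> divides
    \<open>q\<close>.\<close>
  define \<gamma> where "\<gamma> p = (\<Sum>B\<in>L. real idx / real (f B) *
      (if Q p \<and> a p \<in> B then - ln (1 - (1 / real p) ^ (f B * n)) else 0))" for p
  have f0: "f B > 0" if B: "B \<in> L" for B
  proof -
    have "generate G B \<in> cyclic_subgroups G" using B unfolding L_def by (rule generate_lattice_class)
    then obtain g where g: "g \<in> carrier G" "generate G B = generate G {g}"
      unfolding cyclic_subgroups_def by blast
    show ?thesis unfolding f_def g(2) by (rule adjoin_properties(5)[OF K' g(1)])
  qed
  have nf: "f B * n \<ge> 2" if "B \<in> L" for B
    using f0[OF that] n by (metis One_nat_def Suc_leI dual_order.trans mult_le_mono1 mult_1)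
  have finA: "finite (annihilator G K)" using finite_characters by (simp add: annihilator_def)
  have c: "norm (\<phi> (a p)) \<le> 1" if "\<phi> \<in> annihilator G K" for \<phi> p
  proof (cases "a p \<in> carrier G")
    case True
    then show ?thesis using norm_character that by (simp add: annihilator_def)
  next
    case False
    then show ?thesis using that by (simp add: annihilator_def characters_iff)
  qed
  have conv: "convergent_prod (\<lambda>p. inverse (1 + z \<phi> p))" if "\<phi> \<in> annihilator G K" for \<phi>
    unfolding z_def Q_def
    by (intro convergent_prod_inverse convergent_prod_L_partial n c that)
  have fac: "(\<Prod>\<phi>\<in>annihilator G K. inverse (1 + z \<phi> p)) = complex_of_real (exp (\<gamma> p))" for p
  proof (cases "Q p \<and> a p \<in> carrier G")
    case False
    have "z \<phi> p = 0" if "\<phi> \<in> annihilator G K" for \<phi>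
      using that False by (auto simp: z_def annihilator_def characters_iff)
    moreover have "\<gamma> p = 0" unfolding \<gamma>_def
    proof (rule sum.neutral, rule ballI)
      fix B assume "B \<in> L"
      then have "\<not> (Q p \<and> a p \<in> B)" using False lattice_class_subset unfolding L_def by blast
      then show "real idx / real (f B) *
        (if Q p \<and> a p \<in> B then - ln (1 - (1 / real p) ^ (f B * n)) else 0) = 0" by auto
    qed
    ultimately show ?thesis by simp
  next
    case True
    define y where "y = (1 / real p) ^ n"
    have y: "0 < y" "y \<le> 1 / 4" unfolding y_def using prime_inverse_power_bounds[of p n] True n
      by (auto simp: Q_def)
    \<comment> \<open>The class of \<open>p\<close>: it generates the same subgroup as
      \<open>a p\<close>, so \<open>f B0\<close> is the order of \<open>a p\<close> modulo
      \<open>K\<close>.\<close>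
    define B0 where "B0 = generators G (generate G {a p})"
    have B0: "B0 \<in> L" "a p \<in> B0" unfolding B0_def L_def using generators_in_lattice_classes True by auto
    have gB0: "generate G B0 = generate G {a p}"
      using mem_lattice_class B0 unfolding L_def by metis
    define m where "m = idx div f B0"
    have fd: "f B0 dvd idx" unfolding f_def gB0 idx_def
      using annihilator_product(3)[OF K'] True by blast
    then have m: "real m = real idx / real (f B0)" unfolding m_def by (rule real_of_nat_div)
    have "(\<Prod>\<phi>\<in>annihilator G K. inverse (1 + z \<phi> p)) = inverse (\<Prod>\<phi>\<in>annihilator G K. 1 - \<phi> (a p) * of_real y)"
      using True by (simp add: z_def y_def prod_inversef[symmetric] comp_def)
    also have "\<dots> = inverse ((1 - of_real y ^ f B0) ^ m)"
      using annihilator_product(1)[OF K', of "a p" "of_real y"] True unfolding m_def f_def gB0 idx_def by simp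
    also have "\<dots> = of_real (inverse ((1 - y ^ f B0) ^ m))" by simp
    also have "inverse ((1 - y ^ f B0) ^ m) = exp (\<gamma> p)"
    proof -
      have "y ^ f B0 < 1" using y f0[OF B0(1)] by (intro power_less_one_iff[THEN iffD2]) auto
      then have pos: "1 - y ^ f B0 > 0" by simp
      have "\<gamma> p = (\<Sum>B\<in>L. if B = B0 then real idx / real (f B0) * (- ln (1 - y ^ f B0)) else 0)"
        unfolding \<gamma>_def
      proof (rule sum.cong[OF refl])
        fix B assume B: "B \<in> L"
        have "a p \<in> B \<longleftrightarrow> B = B0"
          using lattice_class_unique B B0 unfolding L_def by blast
        then show "real idx / real (f B) * (if Q p \<and> a p \<in> B then - ln (1 - (1 / real p) ^ (f B * n)) else 0)
          = (if B = B0 then real idx / real (f B0) * (- ln (1 - y ^ f B0)) else 0)"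
          using True by (simp add: y_def power_mult[symmetric] mult.commute)
      qed
      also have "\<dots> = real m * (- ln (1 - y ^ f B0))"
        using B0(1) finite_lattice_classes by (simp add: m L_def)
      also have "\<dots> = - ln ((1 - y ^ f B0) ^ m)" using pos by (simp add: ln_realpow)
      finally show ?thesis using pos by (simp add: exp_minus)
    qed
    finally show ?thesis .
  qed
  have summ: "summable (\<lambda>p. if Q p \<and> a p \<in> B then - ln (1 - (1 / real p) ^ (f B * n)) else 0)"
    if "B \<in> L" for B
    by (rule summable_neg_ln_primes[OF nf[OF that]]) (simp add: Q_def)
  have sum\<gamma>: "summable \<gamma>" unfolding \<gamma>_def
    by (intro summable_sum summable_mult summ)
  have "(\<Prod>\<phi>\<in>annihilator G K. L_partial q P (real t * real j) \<phi>)
      = (\<Prod>\<phi>\<in>annihilator G K. \<Prod>p. inverse (1 + z \<phi> p))"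
  proof -
    have "t * j > 0" using n unfolding n_def by linarith
    show ?thesis unfolding L_partial_eq_prodinf[OF \<open>t * j > 0\<close>] z_def Q_def a_def n_def ..
  qed
  also have "\<dots> = (\<Prod>p. \<Prod>\<phi>\<in>annihilator G K. inverse (1 + z \<phi> p))"
    by (rule prodinf_prod[symmetric]) (rule conv)
  also have "\<dots> = (\<Prod>p. complex_of_real (exp (\<gamma> p)))" by (simp only: fac)
  also have "\<dots> = complex_of_real (exp (suminf \<gamma>))"
  proof (rule has_prod_unique[symmetric])
    have "(\<lambda>p. exp (\<gamma> p)) has_prod exp (suminf \<gamma>)"
      using sums_imp_has_prod_exp[OF summable_sums[OF sum\<gamma>]] by (simp add: has_prod_def)
    then show "(\<lambda>p. complex_of_real (exp (\<gamma> p))) has_prod complex_of_real (exp (suminf \<gamma>))"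
      by (simp only: has_prod_of_real_iff)
  qed
  finally have "Gamma_vec q P (real j) t K = suminf \<gamma>"
    unfolding Gamma_vec_def G_def by simp
  also have "\<dots> = (\<Sum>B\<in>L. real idx / real (f B) * class_log_zeta q P B (f B * n))"
  proof -
    have "suminf \<gamma> = (\<Sum>B\<in>L. \<Sum>p. real idx / real (f B) *
      (if Q p \<and> a p \<in> B then - ln (1 - (1 / real p) ^ (f B * n)) else 0))"
      unfolding \<gamma>_def by (rule suminf_sum) (intro summable_mult summ)
    also have "\<dots> = (\<Sum>B\<in>L. real idx / real (f B) * class_log_zeta q P B (f B * n))"
    proof (rule sum.cong[OF refl])
      fix B assume "B \<in> L"
      then have clz: "class_log_zeta q P B (f B * n)
          = (\<Sum>p. if Q p \<and> a p \<in> B then - ln (1 - (1 / real p) ^ (f B * n)) else 0)"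
        unfolding class_log_zeta_def by (simp add: Q_def a_def conj_assoc)
      show "(\<Sum>p. real idx / real (f B) * (if Q p \<and> a p \<in> B then - ln (1 - (1 / real p) ^ (f B * n)) else 0))
        = real idx / real (f B) * class_log_zeta q P B (f B * n)"
        unfolding clz by (rule suminf_mult[OF summ[OF \<open>B \<in> L\<close>]])
    qed
    finally show ?thesis .
  qed
  finally show ?thesis unfolding f_def idx_def L_def n_def .
qed

text \<open>Only orders of elements modulo a subgroup occur as \<open>d\<close>, hence only divisors
  of the exponent; the summand \<open>d = 1\<close> is evaluated by \<open>N_mat_1\<close>.\<close>

lemma M1_inv_Gamma_vec:
  assumes q: "q > 1" and j: "j \<ge> 2" and t: "t \<ge> 1" and A: "A \<in> lattice_classes (unit_group q)"
  shows "mat_vec (cyclic_subgroups (unit_group q)) (M1_inv (unit_group q)) (Gamma_vec q P (real j) t) A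
    = class_log_zeta q P A (t * j)
      + (\<Sum>d | d dvd group_exponent (unit_group q) \<and> d \<noteq> 1.
           N_action q d (\<lambda>B. class_log_zeta q P B (d * (t * j))) A)"
proof -
  define G where "G = unit_group q"
  interpret finite_comm_group G unfolding G_def using q by (rule unit_group_properties)
  define e where "e = group_exponent G"
  have e0: "e > 0" unfolding e_def G_def using q by (rule group_exponent_pos)
  note A' = A[folded G_def]
  have "mat_vec (cyclic_subgroups G) (M1_inv G) (Gamma_vec q P (real j) t) A =
    (\<Sum>d\<in>{d. d dvd e}. \<Sum>B\<in>lattice_classes G.
       N_mat G d (generate G A) (generate G B) / real d * class_log_zeta q P B (d * (t * j)))"
  proof (rule mat_vec_M1_inv[OF A'])
    show "finite {d. d dvd e}" using e0 by simp
    fix K B assume K: "subgroup K G" and B: "B \<in> lattice_classes G"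
    obtain g where g: "g \<in> carrier G" "generate G B = generate G {g}"
      using generate_lattice_class(1)[OF B] unfolding cyclic_subgroups_def by blast
    have "quot_order G (K <#>\<^bsub>G\<^esub> generate G {g}) K dvd group.ord G g"
      by (rule quot_order_dvd_ord[OF K g(1)])
    also have "group.ord G g dvd e"
      using ord_dvd_group_exponent[OF q] g(1) unfolding G_def e_def by blast
    finally show "quot_order G (K <#>\<^bsub>G\<^esub> generate G B) K \<in> {d. d dvd e}" unfolding g(2) by simp
  next
    fix K assume "K \<in> cyclic_subgroups G"
    then have "subgroup K (unit_group q)" using cyclic_subgroup_subgroup unfolding G_def by blast
    from Gamma_vec_eq[OF q j t this]
    show "Gamma_vec q P (real j) t K =
         (\<Sum>B\<in>lattice_classes G.
            real (quot_order G (carrier G) K) / real (quot_order G (K <#>\<^bsub>G\<^esub> generate G B) K) *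
            class_log_zeta q P B (quot_order G (K <#>\<^bsub>G\<^esub> generate G B) K * (t * j)))"
      unfolding G_def .
  qed
  also have "{d. d dvd e} = insert 1 {d. d dvd e \<and> d \<noteq> 1}" by auto
  also have "(\<Sum>d\<in>\<dots>. \<Sum>B\<in>lattice_classes G.
       N_mat G d (generate G A) (generate G B) / real d * class_log_zeta q P B (d * (t * j)))
    = (\<Sum>B\<in>lattice_classes G. N_mat G 1 (generate G A) (generate G B) / real 1 * class_log_zeta q P B (1 * (t * j)))
      + (\<Sum>d | d dvd e \<and> d \<noteq> 1. \<Sum>B\<in>lattice_classes G.
       N_mat G d (generate G A) (generate G B) / real d * class_log_zeta q P B (d * (t * j)))"
    by (rule sum.insert) (use e0 in auto)
  also have "(\<Sum>B\<in>lattice_classes G. N_mat G 1 (generate G A) (generate G B) / real 1 * class_log_zeta q P B (1 * (t * j)))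
    = (\<Sum>B\<in>lattice_classes G. if B = A then class_log_zeta q P A (t * j) else 0)"
  proof (rule sum.cong[OF refl])
    fix B assume B: "B \<in> lattice_classes G"
    have "generate G A = generate G B \<longleftrightarrow> B = A" using generate_lattice_class_inj[OF A' B] by auto
    then show "N_mat G 1 (generate G A) (generate G B) / real 1 * class_log_zeta q P B (1 * (t * j))
      = (if B = A then class_log_zeta q P A (t * j) else 0)"
      using N_mat_1[OF generate_lattice_class(1)[OF A'] cyclic_subgroup_subgroup[OF generate_lattice_class(1)[OF B]]]
      by simp
  qed
  also have "\<dots> = class_log_zeta q P A (t * j)" using A' finite_lattice_classes by simp
  finally show ?thesis unfolding N_action_def mat_vec_def G_def e_def .
qed


section \<open>Iterating the recursion\<close>

text \<open>\<open>(1 / P) ^ n * (1 + P / (n - 1))\<close> is the value at \<open>P\<close> plus the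
  integral from \<open>P\<close> on of the function \<open>x\<close> to the power \<open>-n\<close>,
  a bound for the sum over all integers at least \<open>P\<close>. The factor
  \<open>101 / 100\<close> pays for replacing \<open>- ln (1 - x)\<close> by \<open>x\<close> when
  \<open>x \<le> 1 / 256\<close>, that is, for \<open>P \<ge> 4\<close> and
  \<open>n \<ge> 4\<close>.\<close>

definition power_tail_bound :: "real \<Rightarrow> nat \<Rightarrow> real" where
  "power_tail_bound P n = 101 / 100 * ((1 / P) ^ n * (1 + P / (real n - 1)))"

text \<open>The right-hand side is the integral of \<open>x\<close> to the power
  \<open>-(m + 1)\<close> from \<open>k - 1\<close> to \<open>k\<close>; the comparison is drawn
  from Bernoulli's inequality instead of an integration.\<close>

lemma inverse_power_telescope:
  assumes "k \<ge> 2" "m \<ge> 1"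
  shows "(1 / real k) ^ Suc m \<le> ((1 / (real k - 1)) ^ m - (1 / real k) ^ m) / real m"
proof -
  have k: "real k - 1 > 0" "real k > 0" using assms(1) by auto
  have "1 + real m * (1 / real k) \<le> (1 + 1 / real k) ^ m"
    by (rule Bernoulli_inequality, rule order_trans[of _ 0]) auto
  also have "\<dots> \<le> (real k / (real k - 1)) ^ m"
    using k by (intro power_mono) (simp_all add: field_simps)
  finally have "(1 / real k) ^ m * (1 + real m * (1 / real k)) \<le> (1 / real k) ^ m * (real k / (real k - 1)) ^ m"
    using k by (intro mult_left_mono) auto
  also have "\<dots> = (1 / (real k - 1)) ^ m" using k by (simp add: power_mult_distrib[symmetric])
  finally have "real m * (1 / real k) ^ Suc m \<le> (1 / (real k - 1)) ^ m - (1 / real k) ^ m"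
    by (simp add: algebra_simps)
  then show ?thesis using assms(2) by (simp add: field_simps)
qed

lemma sum_inverse_powers_le:
  assumes N: "N \<ge> 1" and m: "m \<ge> 1" and M: "M \<ge> Suc N"
  shows "(\<Sum>k=N..<M. (1 / real k) ^ Suc m)
    \<le> (1 / real N) ^ Suc m + ((1 / real N) ^ m - (1 / (real M - 1)) ^ m) / real m"
  using M
proof (induction M rule: dec_induct)
  case base
  then show ?case by simp
next
  case (step k)
  have "(\<Sum>i=N..<Suc k. (1 / real i) ^ Suc m) = (\<Sum>i=N..<k. (1 / real i) ^ Suc m) + (1 / real k) ^ Suc m"
    using step.hyps by simp
  also have "\<dots> \<le> (1 / real N) ^ Suc m + ((1 / real N) ^ m - (1 / (real k - 1)) ^ m) / real m
      + ((1 / (real k - 1)) ^ m - (1 / real k) ^ m) / real m"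
    by (intro add_mono step.IH inverse_power_telescope) (use step.hyps N m in auto)
  also have "\<dots> = (1 / real N) ^ Suc m + ((1 / real N) ^ m - (1 / (real (Suc k) - 1)) ^ m) / real m"
    by (simp add: add_divide_distrib diff_divide_distrib)
  finally show ?case .
qed

lemma sum_inverse_powers_ge_le:
  assumes P: "P \<ge> 1" and n: "n \<ge> 2"
  shows "(\<Sum>k<M. if P \<le> real k then (1 / real k) ^ n else 0) \<le> (1 / P) ^ n * (1 + P / (real n - 1))"
proof -
  define N where "N = nat \<lceil>P\<rceil>"
  have N: "P \<le> real k \<longleftrightarrow> N \<le> k" for k unfolding N_def by linarith
  have NP: "real N \<ge> P" using N by blast
  have N1: "N \<ge> 1" using NP P by linarith
  obtain m where m: "n = Suc m" "m \<ge> 1" using n by (cases n) auto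
  \<comment> \<open>\<open>M'\<close> exceeds \<open>N\<close>, so that the range below is not
    empty; for small \<open>M\<close> this only enlarges the sum.\<close>
  define M' where "M' = max M (Suc N)"
  have "(\<Sum>k<M. if P \<le> real k then (1 / real k) ^ n else 0) = (\<Sum>k\<in>{k \<in> {..<M}. P \<le> real k}. (1 / real k) ^ n)"
    by (rule sum.inter_filter[symmetric]) simp
  also have "\<dots> \<le> (\<Sum>k=N..<M'. (1 / real k) ^ n)"
    by (rule sum_mono2) (auto simp: N M'_def)
  also have "\<dots> \<le> (1 / real N) ^ n + ((1 / real N) ^ m - (1 / (real M' - 1)) ^ m) / real m"
    unfolding m(1) by (rule sum_inverse_powers_le) (use N1 m in \<open>auto simp: M'_def\<close>)
  also have "\<dots> \<le> (1 / real N) ^ n + (1 / real N) ^ m / real m"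
    by (intro add_left_mono divide_right_mono) (use N1 in \<open>auto simp: M'_def\<close>)
  also have "\<dots> \<le> (1 / P) ^ n + (1 / P) ^ m / real m"
    by (intro add_mono divide_right_mono power_mono) (use NP P in \<open>auto intro: divide_left_mono simp: field_simps\<close>)
  also have "\<dots> = (1 / P) ^ n * (1 + P / (real n - 1))"
    using P m by (simp add: field_simps)
  finally show ?thesis .
qed

section \<open>Norm estimates for iterated applications of \<open>N_action\<close>\<close>

lemma N_action_le:
  assumes q: "q > 1" and A: "A \<in> lattice_classes (unit_group q)" and d: "d > 0"
  shows "\<bar>N_action q d u A\<bar> \<le> (\<Sum>B\<in>lattice_classes (unit_group q). \<bar>u B\<bar>) / real d"
proof -
  interpret finite_comm_group "unit_group q" using q by (rule unit_group_properties)
  let ?N = "\<lambda>B. N_mat (unit_group q) d (generate (unit_group q) A) (generate (unit_group q) B)"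
  have "\<bar>N_action q d u A\<bar> \<le> (\<Sum>B\<in>lattice_classes (unit_group q). \<bar>?N B / real d * u B\<bar>)"
    unfolding N_action_def mat_vec_def by (rule sum_abs)
  also have "\<dots> \<le> (\<Sum>B\<in>lattice_classes (unit_group q). \<bar>u B\<bar> / real d)"
  proof (rule sum_mono)
    fix B assume B: "B \<in> lattice_classes (unit_group q)"
    have "\<bar>?N B\<bar> \<le> 1"
      by (rule abs_N_mat_le_1[OF generate_lattice_class(1)[OF A]
          cyclic_subgroup_subgroup[OF generate_lattice_class(1)[OF B]] d])
    then have "\<bar>?N B\<bar> * (\<bar>u B\<bar> / real d) \<le> 1 * (\<bar>u B\<bar> / real d)" by (rule mult_right_mono) simp
    then show "\<bar>?N B / real d * u B\<bar> \<le> \<bar>u B\<bar> / real d" by (simp add: abs_mult)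
  qed
  also have "\<dots> = (\<Sum>B\<in>lattice_classes (unit_group q). \<bar>u B\<bar>) / real d"
    by (simp add: sum_divide_distrib)
  finally show ?thesis .
qed

text \<open>In the l1 norm each factor costs \<open>card L / d\<close>: every coordinate of the
  image is at most the old norm divided by \<open>d\<close>, and there are \<open>card L\<close>
  coordinates.\<close>

lemma sum_foldr_N_action_le:
  assumes q: "q > 1" and ds: "\<forall>d\<in>set ds. d > 0"
  defines "L \<equiv> lattice_classes (unit_group q)"
  shows "(\<Sum>A\<in>L. \<bar>foldr (N_action q) ds u A\<bar>) \<le> real (card L) ^ length ds / real (prod_list ds) * (\<Sum>B\<in>L. \<bar>u B\<bar>)"
  using ds
proof (induction ds)
  case Nil
  then show ?case by simp
next
  case (Cons d ds)
  have d: "d > 0" "\<forall>d\<in>set ds. d > 0" using Cons.prems by auto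
  let ?v = "foldr (N_action q) ds u"
  have "(\<Sum>A\<in>L. \<bar>N_action q d ?v A\<bar>) \<le> (\<Sum>A\<in>L. (\<Sum>B\<in>L. \<bar>?v B\<bar>) / real d)"
    unfolding L_def by (intro sum_mono N_action_le q d)
  also have "\<dots> = real (card L) / real d * (\<Sum>B\<in>L. \<bar>?v B\<bar>)" by simp
  also have "\<dots> \<le> real (card L) / real d * (real (card L) ^ length ds / real (prod_list ds) * (\<Sum>B\<in>L. \<bar>u B\<bar>))"
    by (intro mult_left_mono Cons.IH d) simp
  finally show ?case by (simp add: mult_ac)
qed

text \<open>The outermost operator is read at \<open>A\<close> alone and not summed over the
  classes, hence one power of \<open>card L\<close> fewer than in
  \<open>sum_foldr_N_action_le\<close>.\<close>

lemma foldr_N_action_le: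
  assumes q: "q > 1" and ds: "\<forall>d\<in>set ds. d > 0" "ds \<noteq> []"
    and A: "A \<in> lattice_classes (unit_group q)"
  defines "L \<equiv> lattice_classes (unit_group q)"
  shows "\<bar>foldr (N_action q) ds u A\<bar> \<le> real (card L) ^ (length ds - 1) / real (prod_list ds) * (\<Sum>B\<in>L. \<bar>u B\<bar>)"
proof -
  obtain d es where e: "ds = d # es" using ds(2) by (cases ds) auto
  have d: "d > 0" "\<forall>d\<in>set es. d > 0" using ds e by auto
  have "\<bar>foldr (N_action q) ds u A\<bar> \<le> (\<Sum>B\<in>L. \<bar>foldr (N_action q) es u B\<bar>) / real d"
    unfolding L_def e by (simp add: N_action_le[OF q A d(1)])
  also have "\<dots> \<le> (real (card L) ^ length es / real (prod_list es) * (\<Sum>B\<in>L. \<bar>u B\<bar>)) / real d"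
    unfolding L_def by (intro divide_right_mono sum_foldr_N_action_le q d) simp
  also have "\<dots> = real (card L) ^ (length ds - 1) / real (prod_list ds) * (\<Sum>B\<in>L. \<bar>u B\<bar>)"
    by (simp add: e)
  finally show ?thesis .
qed

lemma N_action_add_sum:
  "N_action q d (\<lambda>B. u B + (\<Sum>i\<in>I. v i B)) = (\<lambda>A. N_action q d u A + (\<Sum>i\<in>I. N_action q d (v i) A))"
proof
  fix A
  show "N_action q d (\<lambda>B. u B + (\<Sum>i\<in>I. v i B)) A = N_action q d u A + (\<Sum>i\<in>I. N_action q d (v i) A)"
    unfolding N_action_def mat_vec_def
    by (simp add: distrib_left sum.distrib sum_distrib_left) (rule sum.swap)
qed

lemma foldr_N_action_add_sum:
  "foldr (N_action q) ds (\<lambda>B. u B + (\<Sum>i\<in>I. v i B))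
     = (\<lambda>A. foldr (N_action q) ds u A + (\<Sum>i\<in>I. foldr (N_action q) ds (v i) A))"
  by (induction ds) (simp_all add: N_action_add_sum)

text \<open>The recursion for \<open>M1_inv\<close> applied to \<open>Gamma_vec\<close> is known at
  lattice classes only; \<open>N_action\<close> reads its vector nowhere else, so it may be inserted
  under \<open>foldr\<close>.\<close>

lemma foldr_N_action_cong:
  assumes "\<And>B. B \<in> lattice_classes (unit_group q) \<Longrightarrow> u B = v B" "A \<in> lattice_classes (unit_group q)"
  shows "foldr (N_action q) ds u A = foldr (N_action q) ds v A"
  using assms(2)
proof (induction ds arbitrary: A)
  case Nil
  then show ?case using assms(1) by simp
next
  case (Cons d ds)
  then show ?case unfolding foldr.simps comp_def
    by (subst (1 2) N_action_def) (simp add: mat_vec_def cong: sum.cong)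
qed

section \<open>Telescoping over the divisor tuples\<close>

lemma telescope_alternating:
  fixes S :: "nat \<Rightarrow> 'a :: comm_ring_1"
  shows "(\<Sum>v<r. (- 1) ^ v * (S v + S (Suc v))) = S 0 - (- 1) ^ r * S r"
  by (induction r) (simp_all add: algebra_simps)

lemma divisor_tuples_properties:
  assumes q: "q > 1"
  defines "D \<equiv> {d. d dvd group_exponent (unit_group q) \<and> d \<noteq> 1}"
  shows "finite D" "card D \<le> num_divisors (group_exponent (unit_group q))" "d \<in> D \<Longrightarrow> d \<ge> 2"
    "finite (divisor_tuples q r v)" "card (divisor_tuples q r v) \<le> num_divisors (group_exponent (unit_group q)) ^ v"
    "ds \<in> divisor_tuples q r v \<Longrightarrow> \<forall>d\<in>set ds. d \<ge> 2"
proof -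
  let ?e = "group_exponent (unit_group q)"
  have e0: "?e > 0" using q by (rule group_exponent_pos)
  have fin: "finite {d. d dvd ?e}" using e0 by simp
  then show finD: "finite D" unfolding D_def by (rule rev_finite_subset) auto
  show cD: "card D \<le> num_divisors ?e" unfolding num_divisors_def D_def
    by (rule card_mono[OF fin]) auto
  have ge2: "d \<ge> 2" if "d dvd ?e" "d \<noteq> 1" for d
    using that e0 by (cases "d = 0") auto
  then show "d \<in> D \<Longrightarrow> d \<ge> 2" unfolding D_def by blast
  have sub: "divisor_tuples q r v \<subseteq> {ds. set ds \<subseteq> D \<and> length ds = v}"
    unfolding divisor_tuples_def D_def by auto
  show "finite (divisor_tuples q r v)"
    by (rule finite_subset[OF sub finite_lists_length_eq[OF finD]])
  have "card (divisor_tuples q r v) \<le> card {ds. set ds \<subseteq> D \<and> length ds = v}"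
    by (rule card_mono[OF finite_lists_length_eq[OF finD] sub])
  also have "\<dots> = card D ^ v" by (rule card_lists_length_eq[OF finD])
  also have "\<dots> \<le> num_divisors ?e ^ v" using cD by (rule power_mono) simp
  finally show "card (divisor_tuples q r v) \<le> num_divisors ?e ^ v" .
  show "ds \<in> divisor_tuples q r v \<Longrightarrow> \<forall>d\<in>set ds. d \<ge> 2"
    unfolding divisor_tuples_def using ge2 by blast
qed

lemma prod_list_ge_2_power:
  assumes "\<forall>d\<in>set ds. d \<ge> (2::nat)"
  shows "prod_list ds \<ge> 2 ^ length ds"
  using assms by (induction ds) (auto intro: mult_le_mono)

lemma prod_list_le_2_power:
  assumes "\<forall>d\<in>set ds. d \<ge> (2::nat)" "prod_list ds \<le> 2 ^ length ds"
  shows "ds = replicate (length ds) 2"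
  using assms
proof (induction ds)
  case Nil
  then show ?case by simp
next
  case (Cons d ds)
  have d: "d \<ge> 2" "\<forall>d\<in>set ds. d \<ge> 2" using Cons.prems by auto
  have ge: "prod_list ds \<ge> 2 ^ length ds" using d(2) by (rule prod_list_ge_2_power)
  have le: "d * prod_list ds \<le> 2 * 2 ^ length ds" using Cons.prems by simp
  have "2 * prod_list ds \<le> d * prod_list ds" using d(1) by simp
  then have le1: "prod_list ds \<le> 2 ^ length ds" using le by linarith
  have "d * 2 ^ length ds \<le> d * prod_list ds" using ge by simp
  then have "d * 2 ^ length ds \<le> 2 * 2 ^ length ds" using le by linarith
  then have "d = 2" using d(1) by simp
  then show ?case using Cons.IH[OF d(2) le1] by simp
qed

text \<open>Entries are at least 2, so a product of \<open>r\<close> of them that does not exceed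
  \<open>2 ^ r\<close> leaves no choice. Only an inclusion holds, since 2 need not divide the
  exponent.\<close>

lemma divisor_tuples_full:
  assumes "q > 1"
  shows "divisor_tuples q r r \<subseteq> {replicate r 2}"
proof
  fix ds assume ds: "ds \<in> divisor_tuples q r r"
  then have "\<forall>d\<in>set ds. d \<ge> 2" using divisor_tuples_properties(6)[OF assms] by blast
  moreover have "length ds = r" "prod_list ds \<le> 2 ^ r" using ds by (auto simp: divisor_tuples_def)
  ultimately show "ds \<in> {replicate r 2}" using prod_list_le_2_power[of ds] by simp
qed

text \<open>The new divisor stands last because the recursion unfolds the innermost vector of the
  matrix product. Conversely, dropping it from an admissible tuple does not increase the
  product.\<close>

lemma divisor_tuples_Suc:
  assumes q: "q > 1"
  shows "bij_betw (\<lambda>(ds, d). ds @ [d])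
    (SIGMA ds : divisor_tuples q r v.
       {d. (d dvd group_exponent (unit_group q) \<and> d \<noteq> 1) \<and> prod_list ds * d \<le> 2 ^ r})
    (divisor_tuples q r (Suc v))"
proof -
  let ?e = "group_exponent (unit_group q)"
  have "es \<in> (\<lambda>(ds, d). ds @ [d]) ` (SIGMA ds : divisor_tuples q r v.
       {d. (d dvd ?e \<and> d \<noteq> 1) \<and> prod_list ds * d \<le> 2 ^ r})"
    if es: "es \<in> divisor_tuples q r (Suc v)" for es
  proof -
    have len: "length es = Suc v" using es by (simp add: divisor_tuples_def)
    then obtain ds d where e: "es = ds @ [d]" by (metis append_butlast_last_id length_0_conv nat.distinct(1))
    have d: "d dvd ?e" "d \<noteq> 1" "prod_list ds * d \<le> 2 ^ r" using es e by (auto simp: divisor_tuples_def)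
    have "d \<ge> 1" using d(1) group_exponent_pos[OF q] by (cases "d = 0") auto
    then have "prod_list ds \<le> prod_list ds * d" by simp
    then have "prod_list ds \<le> 2 ^ r" using d(3) by linarith
    then have "ds \<in> divisor_tuples q r v" using es e len by (auto simp: divisor_tuples_def)
    then show ?thesis using d e by (intro image_eqI[of _ _ "(ds, d)"]) auto
  qed
  then show ?thesis by (auto simp: bij_betw_def inj_on_def divisor_tuples_def)
qed

text \<open>Exponents start at 1, whence \<open>1 / 15\<close> instead of \<open>16 / 15\<close>.
  The ratio is a bound for \<open>(1 / P) ^ j\<close> with \<open>P \<ge> 4\<close> and
  \<open>j \<ge> 2\<close>.\<close>

lemma sum_geometric_16_le:
  assumes "finite I"
  shows "(\<Sum>i\<in>I. (1 / 16 :: real) ^ Suc i) \<le> 1 / 15"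
proof -
  have s: "(\<lambda>i. (1 / 16 :: real) ^ i) sums (1 / (1 - 1 / 16))" by (rule geometric_sums) simp
  have "(\<Sum>i\<in>I. (1 / 16 :: real) ^ i) \<le> (\<Sum>i. (1 / 16 :: real) ^ i)"
    using s assms by (intro sum_le_suminf) (auto simp: sums_iff)
  also have "\<dots> = 16 / 15" using s by (simp add: sums_iff)
  finally have "(1 / 16) * (\<Sum>i\<in>I. (1 / 16 :: real) ^ i) \<le> 1 / 15" by simp
  then show ?thesis by (simp add: sum_distrib_left)
qed

lemma class_log_zeta_nonneg:
  assumes "n \<ge> 2"
  shows "class_log_zeta q P A n \<ge> 0"
  unfolding class_log_zeta_def
proof (rule suminf_nonneg)
  show "summable (\<lambda>p. if prime p \<and> P \<le> real p \<and> int p mod int q \<in> A then - ln (1 - (1 / real p) ^ n) else 0)"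
    by (rule summable_neg_ln_primes[OF assms]) blast
  show "0 \<le> (if prime p \<and> P \<le> real p \<and> int p mod int q \<in> A then - ln (1 - (1 / real p) ^ n) else 0)" for p
    using neg_ln_prime_bounds(1)[of p n] assms by auto
qed

text \<open>Each prime lies in at most one class, so the sum over classes is dominated by a single
  sum over all integers from \<open>P\<close> on.\<close>

lemma sum_class_log_zeta_le:
  assumes q: "q > 1" and P: "P \<ge> 4" and n: "n \<ge> 4"
  shows "(\<Sum>B\<in>lattice_classes (unit_group q). class_log_zeta q P B n) \<le> power_tail_bound P n"
proof -
  interpret finite_comm_group "unit_group q" using q by (rule unit_group_properties)
  let ?L = "lattice_classes (unit_group q)"
  let ?l = "\<lambda>p::nat. - ln (1 - (1 / real p) ^ n)"
  let ?t = "\<lambda>B p. if prime p \<and> P \<le> real p \<and> int p mod int q \<in> B then ?l p else 0"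
  have n2: "n \<ge> 2" using n by simp
  have summ: "summable (?t B)" for B by (rule summable_neg_ln_primes[OF n2]) blast
  have tm: "(\<Sum>B\<in>?L. ?t B p) \<le> (if P \<le> real p then 101 / 100 * (1 / real p) ^ n else 0)" for p
  proof (cases "prime p \<and> P \<le> real p")
    case False
    then have "(\<Sum>B\<in>?L. ?t B p) = 0" by (intro sum.neutral) auto
    then show ?thesis by simp
  next
    case True
    let ?x = "(1 / real p) ^ n"
    have "1 / real p \<le> 1 / 4" using True P by (intro divide_left_mono) auto
    then have "?x \<le> (1 / 4) ^ n" by (intro power_mono) auto
    also have "\<dots> \<le> (1 / 4) ^ 4" using n by (intro power_decreasing) auto
    also have "(1 / 4 :: real) ^ 4 = 1 / 256" by (simp add: power_divide)
    finally have x: "?x \<le> 1 / 256" .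
    have x0: "?x \<ge> 0" by simp
    have l0: "?l p \<ge> 0" using neg_ln_prime_bounds(1)[of p n] True n2 by blast
    have "?l p \<le> ?x / (1 - ?x)" using x x0 by (intro neg_ln_one_minus_le) auto
    also have "\<dots> \<le> 101 / 100 * ?x"
    proof -
      have "?x * (101 / 100 * (1 - ?x) - 1) \<ge> 0" using x x0 by (intro mult_nonneg_nonneg) auto
      then have "?x \<le> 101 / 100 * ?x * (1 - ?x)" by (simp add: algebra_simps)
      then show ?thesis using x by (simp add: divide_le_eq)
    qed
    finally have l: "?l p \<le> 101 / 100 * ?x" .
    have "(\<Sum>B\<in>?L. ?t B p) \<le> ?l p"
    proof (cases "\<exists>B0\<in>?L. int p mod int q \<in> B0")
      case False
      then have "(\<Sum>B\<in>?L. ?t B p) = 0" by (intro sum.neutral) auto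
      then show ?thesis using l0 by simp
    next
      case True
      then obtain B0 where B0: "B0 \<in> ?L" "int p mod int q \<in> B0" by blast
      have "(\<Sum>B\<in>?L. ?t B p) \<le> (\<Sum>B\<in>?L. if B = B0 then ?l p else 0)"
        by (rule sum_mono) (use l0 lattice_class_unique[OF _ B0(1) _ B0(2)] in auto)
      then show ?thesis using B0 finite_lattice_classes by simp
    qed
    then show ?thesis using l True by simp
  qed
  have "(\<Sum>B\<in>?L. class_log_zeta q P B n) = (\<Sum>p. \<Sum>B\<in>?L. ?t B p)"
    unfolding class_log_zeta_def by (rule suminf_sum[symmetric]) (rule summ)
  also have "\<dots> \<le> power_tail_bound P n"
  proof (rule suminf_le_const)
    show "summable (\<lambda>p. \<Sum>B\<in>?L. ?t B p)" by (intro summable_sum summ)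
    fix M
    have "(\<Sum>p<M. \<Sum>B\<in>?L. ?t B p) \<le> (\<Sum>p<M. if P \<le> real p then 101 / 100 * (1 / real p) ^ n else 0)"
      by (rule sum_mono) (rule tm)
    also have "\<dots> = 101 / 100 * (\<Sum>p<M. if P \<le> real p then (1 / real p) ^ n else 0)"
      by (subst sum_distrib_left) (intro sum.cong refl, simp)
    also have "\<dots> \<le> 101 / 100 * ((1 / P) ^ n * (1 + P / (real n - 1)))"
      by (intro mult_left_mono sum_inverse_powers_ge_le) (use P n in auto)
    finally show "(\<Sum>p<M. \<Sum>B\<in>?L. ?t B p) \<le> power_tail_bound P n" unfolding power_tail_bound_def .
  qed
  finally show ?thesis .
qed

lemma power_tail_bound_mono:
  assumes P: "P \<ge> 1" and n: "n \<ge> 2"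
  shows "power_tail_bound P (n + k) \<le> power_tail_bound P n * (1 / P) ^ k"
proof -
  have "1 + P / (real (n + k) - 1) \<le> 1 + P / (real n - 1)"
    using P n by (intro add_left_mono divide_left_mono) auto
  then have "(1 / P) ^ (n + k) * (1 + P / (real (n + k) - 1)) \<le> (1 / P) ^ (n + k) * (1 + P / (real n - 1))"
    using P by (intro mult_left_mono) auto
  then have "101 / 100 * ((1 / P) ^ (n + k) * (1 + P / (real (n + k) - 1)))
      \<le> 101 / 100 * ((1 / P) ^ (n + k) * (1 + P / (real n - 1)))" by (rule mult_left_mono) simp
  also have "\<dots> = 101 / 100 * ((1 / P) ^ n * (1 + P / (real n - 1))) * (1 / P) ^ k"
    unfolding power_add by (simp only: mult_ac)
  finally show ?thesis unfolding power_tail_bound_def .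
qed

lemma power_tail_bound_nonneg: "P \<ge> 1 \<Longrightarrow> n \<ge> 2 \<Longrightarrow> power_tail_bound P n \<ge> 0"
  unfolding power_tail_bound_def by (intro mult_nonneg_nonneg add_nonneg_nonneg) auto

text \<open>What telescoping leaves is \<open>S r\<close> and the \<open>T v\<close>. In all their
  terms the divisors have product at least \<open>2 ^ r\<close>, which yields both the power of
  \<open>1 / 2\<close> and the argument \<open>2 ^ r * j\<close>. The constant comes from
  \<open>(r / 15 + 1) / 2 \<le> 3 / 10 * r\<close>.\<close>

lemma log_zeta_approx_error:
  assumes q: "q > 1" and A: "A \<in> lattice_classes (unit_group q)" and P: "P \<ge> 4" and j: "j \<ge> 2" and r: "r \<ge> 2"
  defines "g \<equiv> card (lattice_classes (unit_group q))"
    and "\<tau> \<equiv> num_divisors (group_exponent (unit_group q))"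
  shows "\<bar>log_zeta_approx q P (real j) r A - class_log_zeta q P A j\<bar>
    \<le> (real (g * \<tau>) / 2) ^ (r - 1) * (3 / 10 * real r) * power_tail_bound P (2 ^ r * j)"
proof -
  interpret finite_comm_group "unit_group q" using q by (rule unit_group_properties)
  define L where "L = lattice_classes (unit_group q)"
  define e where "e = group_exponent (unit_group q)"
  define D where "D = {d. d dvd e \<and> d \<noteq> 1}"
  define Z where "Z n B = class_log_zeta q P B n" for n B
  \<comment> \<open>\<open>V\<close> is the contribution of one tuple, \<open>S v\<close> collects
    the admissible tuples of length \<open>v\<close>, and \<open>T v\<close> those extensions by one
    divisor whose product has just passed \<open>2 ^ r\<close>.\<close>
  define V where "V ds = foldr (N_action q) ds (Z (prod_list ds * j)) A" for ds
  define DT where "DT = divisor_tuples q r"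
  define S where "S v = (\<Sum>ds\<in>DT v. V ds)" for v
  define T where "T v = (\<Sum>ds\<in>DT v. \<Sum>d\<in>{d \<in> D. \<not> prod_list ds * d \<le> 2 ^ r}. V (ds @ [d]))" for v
  define W where "W = power_tail_bound P (2 ^ r * j)"
  have finD: "finite D" using divisor_tuples_properties(1)[OF q] unfolding D_def e_def .
  have D2: "d \<ge> 2" if "d \<in> D" for d using that divisor_tuples_properties(3)[OF q] unfolding D_def e_def by blast
  have finDT: "finite (DT v)" for v unfolding DT_def using divisor_tuples_properties(4)[OF q] .
  have cDT: "card (DT v) \<le> \<tau> ^ v" for v unfolding DT_def \<tau>_def using divisor_tuples_properties(5)[OF q] .
  have DT2: "\<forall>d\<in>set ds. d \<ge> 2" if "ds \<in> DT v" for ds v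
    using that divisor_tuples_properties(6)[OF q] unfolding DT_def by blast
  have DTpos: "\<forall>d\<in>set ds. d > 0" if "ds \<in> DT v" for ds v
    using DT2[OF that] by auto
  have DTprod: "prod_list ds \<ge> 1" if "ds \<in> DT v" for ds v
    using prod_list_ge_2_power[OF DT2[OF that]] by (meson one_le_numeral one_le_power order_trans)
  have r2: "(2::nat) ^ r \<ge> 4" using power_increasing[of 2 r "2::nat"] r by simp
  have r2j: "2 ^ r * j \<ge> 2" by (rule order_trans[OF _ mult_le_mono[OF r2 j]]) simp
  have W0: "W \<ge> 0" unfolding W_def using P by (intro power_tail_bound_nonneg r2j) simp
  have g1: "g \<ge> 1" unfolding g_def using finite_lattice_classes lattice_classes_nonempty
    by (simp add: Suc_leI card_gt_0_iff)
  have tau1: "\<tau> \<ge> 1"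
  proof -
    have "finite {d. d dvd e}" unfolding e_def using group_exponent_pos[OF q] by simp
    moreover have "1 \<in> {d. d dvd e}" by simp
    ultimately have "card {d. d dvd e} > 0" using card_gt_0_iff by blast
    then show ?thesis unfolding \<tau>_def num_divisors_def e_def by simp
  qed
  have gt1: "real g * real \<tau> \<ge> 1" using g1 tau1 by (metis mult_le_mono mult_1 of_nat_1 of_nat_le_iff of_nat_mult)

  \<comment> \<open>The recursion at \<open>t = prod_list ds\<close> splits the innermost vector;
    its second part appends one divisor to the tuple.\<close>
  have rec: "foldr (N_action q) ds
      (mat_vec (cyclic_subgroups (unit_group q)) (M1_inv (unit_group q)) (Gamma_vec q P (real j) (prod_list ds))) A
    = V ds + (\<Sum>d\<in>D. V (ds @ [d]))" if ds: "ds \<in> DT v" for ds v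
  proof -
    let ?t = "prod_list ds"
    have "foldr (N_action q) ds
      (mat_vec (cyclic_subgroups (unit_group q)) (M1_inv (unit_group q)) (Gamma_vec q P (real j) ?t)) A
      = foldr (N_action q) ds (\<lambda>B. Z (?t * j) B + (\<Sum>d\<in>D. N_action q d (Z (d * (?t * j))) B)) A"
      by (rule foldr_N_action_cong[OF _ A])
         (simp add: M1_inv_Gamma_vec[OF q j DTprod[OF ds]] Z_def[abs_def] D_def e_def)
    also have "\<dots> = V ds + (\<Sum>d\<in>D. foldr (N_action q) ds (N_action q d (Z (d * (?t * j)))) A)"
      unfolding foldr_N_action_add_sum V_def ..
    also have "(\<Sum>d\<in>D. foldr (N_action q) ds (N_action q d (Z (d * (?t * j)))) A) = (\<Sum>d\<in>D. V (ds @ [d]))"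
      unfolding V_def by (intro sum.cong refl) (simp add: mult_ac)
    finally show ?thesis .
  qed
  \<comment> \<open>Appending \<open>d\<close> either gives an admissible tuple of length
    \<open>v + 1\<close>, counted by \<open>S (Suc v)\<close>, or leaves the range and is counted by
    \<open>T v\<close>.\<close>
  have split: "(\<Sum>ds\<in>DT v. V ds + (\<Sum>d\<in>D. V (ds @ [d]))) = (S v + S (Suc v)) + T v" for v
  proof -
    have "S (Suc v) = (\<Sum>(ds, d)\<in>(SIGMA ds : DT v. {d \<in> D. prod_list ds * d \<le> 2 ^ r}). V (ds @ [d]))"
      unfolding S_def DT_def
      using sum.reindex_bij_betw[OF divisor_tuples_Suc[OF q, of r v], of V, symmetric]
      by (simp add: case_prod_unfold D_def e_def)
    also have "\<dots> = (\<Sum>ds\<in>DT v. \<Sum>d\<in>{d \<in> D. prod_list ds * d \<le> 2 ^ r}. V (ds @ [d]))"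
      by (rule sum.Sigma[symmetric]) (use finDT finD in auto)
    finally have S': "S (Suc v) + T v = (\<Sum>ds\<in>DT v. (\<Sum>d\<in>{d \<in> D. prod_list ds * d \<le> 2 ^ r}. V (ds @ [d]))
        + (\<Sum>d\<in>{d \<in> D. \<not> prod_list ds * d \<le> 2 ^ r}. V (ds @ [d])))"
      unfolding T_def by (simp add: sum.distrib)
    have "(\<Sum>d\<in>{d \<in> D. prod_list ds * d \<le> 2 ^ r}. V (ds @ [d]))
        + (\<Sum>d\<in>{d \<in> D. \<not> prod_list ds * d \<le> 2 ^ r}. V (ds @ [d])) = (\<Sum>d\<in>D. V (ds @ [d]))" for ds
    proof -
      have "D = {d \<in> D. prod_list ds * d \<le> 2 ^ r} \<union> {d \<in> D. \<not> prod_list ds * d \<le> 2 ^ r}" by blast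
      then show ?thesis using finD by (subst sum.union_disjoint[symmetric]) auto
    qed
    then have "S (Suc v) + T v = (\<Sum>ds\<in>DT v. \<Sum>d\<in>D. V (ds @ [d]))" unfolding S' by simp
    then show ?thesis by (simp add: sum.distrib S_def)
  qed
  have "log_zeta_approx q P (real j) r A = (\<Sum>v<r. (- 1) ^ v * (\<Sum>ds\<in>DT v. V ds + (\<Sum>d\<in>D. V (ds @ [d]))))"
    unfolding log_zeta_approx_def DT_def[symmetric] by (intro sum.cong refl arg_cong2[where f = "(*)"]) (rule rec)
  also have "\<dots> = (\<Sum>v<r. (- 1) ^ v * (S v + S (Suc v))) + (\<Sum>v<r. (- 1) ^ v * T v)"
    unfolding split by (simp only: distrib_left sum.distrib)
  also have "(\<Sum>v<r. (- 1) ^ v * (S v + S (Suc v))) = S 0 - (- 1) ^ r * S r" by (rule telescope_alternating)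
  also have "S 0 = Z j A"
  proof -
    have "DT 0 = {[]}" unfolding DT_def divisor_tuples_def by auto
    then show ?thesis unfolding S_def V_def by simp
  qed
  finally have "log_zeta_approx q P (real j) r A - Z j A = (\<Sum>v<r. (- 1) ^ v * T v) - (- 1) ^ r * S r" by simp
  then have err: "\<bar>log_zeta_approx q P (real j) r A - Z j A\<bar> \<le> (\<Sum>v<r. \<bar>T v\<bar>) + \<bar>S r\<bar>"
  proof -
    have "\<bar>(\<Sum>v<r. (- 1) ^ v * T v) - (- 1) ^ r * S r\<bar> \<le> \<bar>\<Sum>v<r. (- 1) ^ v * T v\<bar> + \<bar>(- 1) ^ r * S r\<bar>"
      by (rule abs_triangle_ineq4)
    also have "\<bar>\<Sum>v<r. (- 1) ^ v * T v\<bar> \<le> (\<Sum>v<r. \<bar>(- 1) ^ v * T v\<bar>)" by (rule sum_abs)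
    finally have "\<bar>(\<Sum>v<r. (- 1) ^ v * T v) - (- 1) ^ r * S r\<bar> \<le> (\<Sum>v<r. \<bar>(- 1) ^ v * T v\<bar>) + \<bar>(- 1) ^ r * S r\<bar>"
      by simp
    then show ?thesis using \<open>log_zeta_approx q P (real j) r A - Z j A = _\<close> by (simp add: abs_mult power_abs)
  qed

  have normZ: "(\<Sum>B\<in>L. \<bar>Z n B\<bar>) \<le> power_tail_bound P n" if "n \<ge> 4" for n
    using sum_class_log_zeta_le[OF q P that] class_log_zeta_nonneg[of n] that unfolding Z_def L_def by simp
  have Vbound: "\<bar>V ds\<bar> \<le> real g ^ (length ds - 1) / 2 ^ r * power_tail_bound P (prod_list ds * j)"
    if ds: "\<forall>d\<in>set ds. d > 0" "ds \<noteq> []" "prod_list ds \<ge> 2 ^ r" for ds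
  proof -
    have n4: "prod_list ds * j \<ge> 4" using r2 ds(3) j by (metis mult_le_mono le_trans mult_1_right one_le_numeral)
    have "\<bar>V ds\<bar> \<le> real g ^ (length ds - 1) / real (prod_list ds) * (\<Sum>B\<in>L. \<bar>Z (prod_list ds * j) B\<bar>)"
      unfolding V_def L_def g_def by (rule foldr_N_action_le[OF q ds(1,2) A])
    also have "\<dots> \<le> real g ^ (length ds - 1) / 2 ^ r * power_tail_bound P (prod_list ds * j)"
    proof (rule mult_mono)
      have "real (2 ^ r) \<le> real (prod_list ds)" using ds(3) by (rule of_nat_mono)
      then show "real g ^ (length ds - 1) / real (prod_list ds) \<le> real g ^ (length ds - 1) / 2 ^ r"
        by (intro frac_le) simp_all
    qed (use normZ[OF n4] in \<open>auto intro!: sum_nonneg\<close>)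
    finally show ?thesis .
  qed
  have gmono: "real g ^ a * real \<tau> ^ b \<le> (real g * real \<tau>) ^ (r - 1)" if "a \<le> r - 1" "b \<le> r - 1" for a b
  proof -
    have "real g ^ a \<le> real g ^ (r - 1)" "real \<tau> ^ b \<le> real \<tau> ^ (r - 1)"
      using that g1 tau1 by (auto intro!: power_increasing)
    then show ?thesis unfolding power_mult_distrib by (intro mult_mono) auto
  qed
  define X where "X = (real g * real \<tau>) ^ (r - 1) / 2 ^ r"
  have X0: "X \<ge> 0" unfolding X_def by simp
  have Sr: "\<bar>S r\<bar> \<le> X * W"
  proof (cases "DT r = {}")
    case True
    then show ?thesis using X0 W0 by (simp add: S_def)
  next
    case False
    then have DTr: "DT r = {replicate r 2}" using divisor_tuples_full[OF q, of r] unfolding DT_def by blast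
    have prod: "prod_list (replicate r (2::nat)) = 2 ^ r" by simp
    have "\<bar>S r\<bar> = \<bar>V (replicate r 2)\<bar>" unfolding S_def DTr by simp
    also have "\<dots> \<le> real g ^ (r - 1) / 2 ^ r * W"
      using Vbound[of "replicate r 2"] r unfolding prod W_def by auto
    also have "\<dots> \<le> X * W" unfolding X_def
      using gmono[of "r - 1" 0] W0 by (intro mult_right_mono divide_right_mono) auto
    finally show ?thesis .
  qed
  have P16: "(1 / P) ^ j \<le> 1 / 16"
  proof -
    have "(1 / P) ^ j \<le> (1 / 4) ^ j" using P by (intro power_mono divide_left_mono) auto
    also have "\<dots> \<le> (1 / 4) ^ 2" using j by (intro power_decreasing) auto
    finally show ?thesis by (simp add: power2_eq_square)
  qed
  have Tv: "\<bar>T v\<bar> \<le> X * W / 15" if v: "v < r" for v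
  proof -
    have inner: "(\<Sum>d\<in>{d \<in> D. \<not> prod_list ds * d \<le> 2 ^ r}. \<bar>V (ds @ [d])\<bar>) \<le> real g ^ v / 2 ^ r * (W / 15)"
      if ds: "ds \<in> DT v" for ds
    proof -
      let ?D = "{d \<in> D. \<not> prod_list ds * d \<le> 2 ^ r}"
      \<comment> \<open>\<open>Suc (h d)\<close> is the excess of the product over
        \<open>2 ^ r\<close>. Each unit of excess gains a factor \<open>(1 / P) ^ j\<close>, and
        \<open>h\<close> is injective, so the geometric bound \<open>1 / 15\<close> replaces a count
        of the divisors \<open>d\<close>.\<close>
      define h where "h d = prod_list ds * d - 2 ^ r - 1" for d
      have hd: "prod_list ds * d = 2 ^ r + Suc (h d)" if "d \<in> ?D" for d
      proof -
        have "b < a \<Longrightarrow> a = b + Suc (a - b - 1)" for a b :: nat by arith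
        moreover have "2 ^ r < prod_list ds * d" using that by simp
        ultimately show ?thesis unfolding h_def by blast
      qed
      have len: "length ds = v" using ds by (simp add: DT_def divisor_tuples_def)
      have "\<bar>V (ds @ [d])\<bar> \<le> real g ^ v / 2 ^ r * (W * (1 / 16) ^ Suc (h d))" if d: "d \<in> ?D" for d
      proof -
        have pl: "prod_list (ds @ [d]) = 2 ^ r + Suc (h d)" using hd[OF d] by simp
        have "\<bar>V (ds @ [d])\<bar> \<le> real g ^ v / 2 ^ r * power_tail_bound P (prod_list (ds @ [d]) * j)"
          using Vbound[of "ds @ [d]"] DTpos[OF ds] d D2[of d] pl len by auto
        also have "\<dots> \<le> real g ^ v / 2 ^ r * (W * (1 / 16) ^ Suc (h d))"
        proof (rule mult_left_mono)
          have "prod_list (ds @ [d]) * j = 2 ^ r * j + j * Suc (h d)" unfolding pl by (simp add: algebra_simps)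
          moreover have "power_tail_bound P (2 ^ r * j + j * Suc (h d)) \<le> W * (1 / P) ^ (j * Suc (h d))"
            unfolding W_def by (rule power_tail_bound_mono[OF _ r2j]) (use P in simp)
          ultimately have "power_tail_bound P (prod_list (ds @ [d]) * j) \<le> W * (1 / P) ^ (j * Suc (h d))"
            by (simp only:)
          also have "\<dots> \<le> W * (1 / 16) ^ Suc (h d)"
            unfolding power_mult using P16 P W0 by (intro mult_left_mono power_mono) auto
          finally show "power_tail_bound P (prod_list (ds @ [d]) * j) \<le> W * (1 / 16) ^ Suc (h d)" .
        qed simp
        finally show ?thesis .
      qed
      then have "(\<Sum>d\<in>?D. \<bar>V (ds @ [d])\<bar>) \<le> (\<Sum>d\<in>?D. real g ^ v / 2 ^ r * (W * (1 / 16) ^ Suc (h d)))"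
        by (rule sum_mono)
      also have "\<dots> = real g ^ v / 2 ^ r * (W * (\<Sum>d\<in>?D. (1 / 16) ^ Suc (h d)))"
        by (simp only: sum_distrib_left)
      also have "(\<Sum>d\<in>?D. (1 / 16 :: real) ^ Suc (h d)) = (\<Sum>i\<in>h ` ?D. (1 / 16) ^ Suc i)"
      proof (rule sum.reindex[symmetric, unfolded comp_def])
        show "inj_on h ?D"
        proof (rule inj_onI)
          fix x y assume "x \<in> ?D" "y \<in> ?D" "h x = h y"
          then have "prod_list ds * x = prod_list ds * y" using hd by metis
          then show "x = y" using DTprod[OF ds] by simp
        qed
      qed
      also have "real g ^ v / 2 ^ r * (W * (\<Sum>i\<in>h ` ?D. (1 / 16) ^ Suc i)) \<le> real g ^ v / 2 ^ r * (W * (1 / 15))"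
        using W0 finD by (intro mult_left_mono sum_geometric_16_le) auto
      finally show ?thesis by simp
    qed
    have "\<bar>T v\<bar> \<le> (\<Sum>ds\<in>DT v. \<bar>\<Sum>d\<in>{d \<in> D. \<not> prod_list ds * d \<le> 2 ^ r}. V (ds @ [d])\<bar>)"
      unfolding T_def by (rule sum_abs)
    also have "\<dots> \<le> (\<Sum>ds\<in>DT v. real g ^ v / 2 ^ r * (W / 15))"
      by (rule sum_mono) (rule order_trans[OF sum_abs inner])
    also have "\<dots> = real (card (DT v)) * (real g ^ v / 2 ^ r * (W / 15))" by simp
    also have "\<dots> \<le> real \<tau> ^ v * (real g ^ v / 2 ^ r * (W / 15))"
    proof (rule mult_right_mono)
      have "real (card (DT v)) \<le> real (\<tau> ^ v)" using cDT[of v] by (rule of_nat_mono)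
      then show "real (card (DT v)) \<le> real \<tau> ^ v" by simp
    qed (use W0 in simp)
    also have "\<dots> = real g ^ v * real \<tau> ^ v / 2 ^ r * (W / 15)" by simp
    also have "\<dots> \<le> X * (W / 15)" unfolding X_def
      using gmono[of v v] W0 v by (intro mult_right_mono divide_right_mono) auto
    finally show ?thesis by simp
  qed
  have "\<bar>log_zeta_approx q P (real j) r A - Z j A\<bar> \<le> (\<Sum>v<r. X * W / 15) + X * W"
    using err Sr sum_mono[of "{..<r}" "\<lambda>v. \<bar>T v\<bar>" "\<lambda>v. X * W / 15"] Tv by fastforce
  also have "\<dots> = X * W * (real r / 15 + 1)" by (simp add: algebra_simps)
  \<comment> \<open>\<open>r / 15 + 1 \<le> 6 / 10 * r\<close> holds because
    \<open>r \<ge> 2\<close>. The constant is halved below, as \<open>X\<close> carries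
    \<open>2 ^ r = 2 * 2 ^ (r - 1)\<close> in its denominator.\<close>
  also have "\<dots> \<le> X * W * (6 / 10 * real r)"
    using X0 W0 r by (intro mult_left_mono) auto
  also have "\<dots> = (real (g * \<tau>) / 2) ^ (r - 1) * (3 / 10 * real r) * W"
  proof -
    have "X = (real (g * \<tau>) / 2) ^ (r - 1) / 2"
      unfolding X_def using r by (cases r) (auto simp: power_divide)
    then show ?thesis by simp
  qed
  finally show ?thesis unfolding Z_def W_def .
qed


section \<open>Polynomials and the coefficients \<open>b_coeff\<close>\<close>

lemma poly_map_poly_complex_of_real:
  "poly (map_poly complex_of_real F) (of_real x) = of_real (poly F x)"
  by (induction F) (auto simp: map_poly_pCons)

lemma prod_mset_mult_image:
  "prod_mset (image_mset (\<lambda>x. f x * g x) M) = prod_mset (image_mset f M) * (prod_mset (image_mset g M) :: 'a :: comm_monoid_mult)"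
  by (induction M) (simp_all add: mult_ac)

lemma poly_prod_mset: "poly (prod_mset (image_mset f M)) z = (\<Prod>x\<in>#M. poly (f x) z)"
  for f :: "'b \<Rightarrow> 'a :: comm_ring_1 poly"
  by (induction M) simp_all

text \<open>Dividing the factorisation into linear factors by its value 1 at 0 removes the leading
  coefficient and turns roots into inverse roots.\<close>

lemma poly_eq_prod_inverse_roots:
  assumes "poly F 0 = 1"
  shows "poly (map_poly complex_of_real F) z = (\<Prod>\<alpha>\<in>#inverse_roots F. 1 - \<alpha> * z)"
proof -
  define p where "p = map_poly complex_of_real F"
  have p0: "poly p 0 = 1" unfolding p_def using poly_map_poly_complex_of_real[of F 0] assms by simp
  then have pnz: "p \<noteq> 0" by auto
  have ev: "poly p y = lead_coeff p * (\<Prod>x\<in>#proots p. y - x)" for y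
  proof -
    have "poly p y = poly (Polynomial.smult (lead_coeff p) (\<Prod>x\<in>#proots p. [:-x, 1:])) y"
      by (simp only: complex_poly_decompose_multiset)
    also have "\<dots> = lead_coeff p * (\<Prod>x\<in>#proots p. y - x)" by (simp add: poly_prod_mset)
    finally show ?thesis .
  qed
  have nz: "x \<noteq> 0" if "x \<in># proots p" for x using that p0 pnz by auto
  have "(\<Prod>x\<in>#proots p. z - x) = (\<Prod>x\<in>#proots p. (- x) * (1 - inverse x * z))"
    by (intro arg_cong[of _ _ prod_mset] image_mset_cong) (use nz in \<open>simp add: field_simps\<close>)
  also have "\<dots> = (\<Prod>x\<in>#proots p. 0 - x) * (\<Prod>x\<in>#proots p. 1 - inverse x * z)"
    unfolding prod_mset_mult_image by simp
  finally have e: "(\<Prod>x\<in>#proots p. z - x) = (\<Prod>x\<in>#proots p. 0 - x) * (\<Prod>x\<in>#proots p. 1 - inverse x * z)" .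
  have "poly p z = poly p 0 * (\<Prod>x\<in>#proots p. 1 - inverse x * z)"
    unfolding ev[of z] ev[of 0] e by (simp only: mult.assoc)
  then show ?thesis unfolding p0 inverse_roots_def p_def[symmetric] by (simp add: image_mset.compositionality comp_def)
qed

lemma size_inverse_roots: "size (inverse_roots F) = degree F"
  by (simp add: inverse_roots_def size_proots_complex degree_map_poly)

text \<open>Comparison of the coefficients of \<open>X\<close> in the product of the factors
  \<open>1 - \<alpha> * X\<close>. Through it the congruence of \<open>F\<close> and
  \<open>H\<close> modulo the square of \<open>X\<close> becomes
  \<open>b_coeff_1_eq\<close>.\<close>

lemma power_sum_1:
  assumes "poly F 0 = 1"
  shows "power_sum F 1 = - of_real (poly.coeff F 1)"
proof -
  have *: "poly.coeff (\<Prod>\<alpha>\<in>#M. [:1, - \<alpha>:]) 0 = 1 \<and> poly.coeff (\<Prod>\<alpha>\<in>#M. [:1, - \<alpha>:]) 1 = - (\<Sum>\<alpha>\<in>#M. \<alpha>)"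
    for M :: "complex multiset"
    by (induction M) (auto simp: coeff_pCons)
  have "poly (map_poly complex_of_real F) = poly (\<Prod>\<alpha>\<in>#inverse_roots F. [:1, - \<alpha>:])"
    unfolding fun_eq_iff poly_eq_prod_inverse_roots[OF assms] by (simp add: poly_prod_mset mult.commute)
  then have "map_poly complex_of_real F = (\<Prod>\<alpha>\<in>#inverse_roots F. [:1, - \<alpha>:])"
    by (simp only: poly_eq_poly_eq_iff)
  then have "of_real (poly.coeff F 1) = poly.coeff (\<Prod>\<alpha>\<in>#inverse_roots F. [:1, - \<alpha>:]) 1"
    by (metis coeff_map_poly of_real_0)
  then show ?thesis using *[of "inverse_roots F"] by (simp add: power_sum_def)
qed

lemma norm_power_sum_le:
  assumes "\<forall>\<alpha>\<in>#inverse_roots F. norm \<alpha> \<le> \<beta>" "\<beta> \<ge> 0"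
  shows "norm (power_sum F k) \<le> real (degree F) * \<beta> ^ k"
proof -
  have "norm (\<Sum>\<alpha>\<in>#M. \<alpha> ^ k) \<le> real (size M) * \<beta> ^ k" if "\<forall>\<alpha>\<in>#M. norm \<alpha> \<le> \<beta>" for M :: "complex multiset"
    using that
  proof (induction M)
    case (add x M)
    have "norm (\<Sum>\<alpha>\<in>#add_mset x M. \<alpha> ^ k) \<le> norm (x ^ k) + norm (\<Sum>\<alpha>\<in>#M. \<alpha> ^ k)"
      by (simp add: norm_triangle_ineq)
    also have "\<dots> \<le> \<beta> ^ k + real (size M) * \<beta> ^ k"
      using add by (intro add_mono) (auto simp: norm_power intro: power_mono)
    finally show ?case by (simp add: algebra_simps)
  qed simp
  from this[OF assms(1)] show ?thesis unfolding power_sum_def size_inverse_roots .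
qed

lemma b_coeff_eq:
  "b_coeff F k = (\<Sum>d | d dvd k. of_int (moebius (k div d)) * Re (power_sum F d)) / real k"
proof -
  have "1 / of_nat k * (\<Sum>d | d dvd k. of_int (moebius (k div d)) * power_sum F d)
    = (\<Sum>d | d dvd k. of_int (moebius (k div d)) * power_sum F d) / of_real (real k)" by simp
  then show ?thesis unfolding b_coeff_def
    by (simp only: Re_divide_of_real Re_sum) simp
qed

text \<open>Moebius inversion of the definition of \<open>b_coeff\<close>; it makes the coefficients
  match in \<open>ln_poly_has_sum\<close>.\<close>

lemma sum_divisors_b_coeff:
  assumes "n > 0"
  shows "(\<Sum>j | j dvd n. real j * b_coeff F j) = Re (power_sum F n)"
proof -
  have "(\<Sum>j | j dvd n. real j * b_coeff F j)
      = (\<Sum>j | j dvd n. \<Sum>d | d dvd j. of_int (moebius (j div d)) * Re (power_sum F d))"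
    by (rule sum.cong[OF refl]) (use assms in \<open>auto simp: b_coeff_eq\<close>)
  also have "\<dots> = Re (power_sum F n)" by (rule moebius_inversion[OF assms])
  finally show ?thesis .
qed

lemma b_coeff_1: "b_coeff F 1 = Re (power_sum F 1)"
  using sum_divisors_b_coeff[of 1 F] by simp

lemma sum_powers_le:
  fixes \<beta> :: real
  assumes "\<beta> \<ge> 2"
  shows "(\<Sum>d\<le>k. \<beta> ^ d) \<le> 2 * \<beta> ^ k"
proof (induction k)
  case (Suc k)
  have "(\<Sum>d\<le>Suc k. \<beta> ^ d) \<le> 2 * \<beta> ^ k + \<beta> ^ Suc k" using Suc by simp
  also have "2 * \<beta> ^ k \<le> \<beta> * \<beta> ^ k" using assms by (intro mult_right_mono) auto
  finally show ?case by simp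
qed simp

text \<open>The divisors of \<open>k\<close> are replaced by all \<open>d \<le> k\<close>. As
  \<open>\<beta> \<ge> 2\<close>, the powers up to \<open>\<beta> ^ k\<close> add up to at most
  \<open>2 * \<beta> ^ k\<close>, the source of the factor 2.\<close>

lemma abs_b_coeff_le:
  assumes "\<forall>\<alpha>\<in>#inverse_roots F. norm \<alpha> \<le> \<beta>" and \<beta>: "\<beta> \<ge> 2" and k: "k \<ge> 1"
  shows "\<bar>b_coeff F k\<bar> \<le> 2 * real (degree F) * \<beta> ^ k / real k"
proof -
  have "\<bar>\<Sum>d | d dvd k. of_int (moebius (k div d)) * Re (power_sum F d)\<bar>
      \<le> (\<Sum>d | d dvd k. \<bar>of_int (moebius (k div d)) * Re (power_sum F d)\<bar>)" by (rule sum_abs)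
  also have "\<dots> \<le> (\<Sum>d | d dvd k. real (degree F) * \<beta> ^ d)"
  proof (rule sum_mono)
    fix d
    have "\<bar>Re (power_sum F d)\<bar> \<le> norm (power_sum F d)" by (rule abs_Re_le_cmod)
    also have "\<dots> \<le> real (degree F) * \<beta> ^ d" using assms by (intro norm_power_sum_le) auto
    finally have 1: "\<bar>Re (power_sum F d)\<bar> \<le> real (degree F) * \<beta> ^ d" .
    have 2: "\<bar>real_of_int (moebius (k div d))\<bar> \<le> 1"
      using abs_moebius_le_1[of "k div d"] by linarith
    have "\<bar>real_of_int (moebius (k div d))\<bar> * \<bar>Re (power_sum F d)\<bar> \<le> 1 * (real (degree F) * \<beta> ^ d)"
      by (rule mult_mono[OF 2 1]) auto
    then show "\<bar>of_int (moebius (k div d)) * Re (power_sum F d)\<bar> \<le> real (degree F) * \<beta> ^ d"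
      by (simp add: abs_mult)
  qed
  also have "\<dots> = real (degree F) * (\<Sum>d | d dvd k. \<beta> ^ d)" by (simp add: sum_distrib_left)
  also have "\<dots> \<le> real (degree F) * (2 * \<beta> ^ k)"
  proof (rule mult_left_mono)
    have "(\<Sum>d | d dvd k. \<beta> ^ d) \<le> (\<Sum>d\<le>k. \<beta> ^ d)"
      using k \<beta> by (intro sum_mono2) (auto dest: dvd_imp_le)
    then show "(\<Sum>d | d dvd k. \<beta> ^ d) \<le> 2 * \<beta> ^ k" using sum_powers_le[OF \<beta>, of k] by linarith
  qed simp
  finally have "\<bar>\<Sum>d | d dvd k. of_int (moebius (k div d)) * Re (power_sum F d)\<bar> / real k
      \<le> real (degree F) * (2 * \<beta> ^ k) / real k" by (rule divide_right_mono) simp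
  then show ?thesis unfolding b_coeff_eq by (simp add: abs_divide mult_ac)
qed

section \<open>Expansions of the logarithm of a polynomial\<close>

lemma poly_pos_of_inverse_roots:
  assumes F0: "poly F 0 = 1" and roots: "\<forall>\<alpha>\<in>#inverse_roots F. norm \<alpha> \<le> \<beta>"
    and x: "0 \<le> x" "\<beta> * x < 1"
  shows "poly F x > 0"
proof (rule ccontr)
  assume neg: "\<not> poly F x > 0"
  \<comment> \<open>A zero at \<open>y\<close> makes \<open>1 / y\<close> an inverse root, which
    exceeds \<open>\<beta>\<close> because \<open>\<beta> * x < 1\<close>. With \<open>F\<close>
    equal to 1 at 0, a sign change is then excluded by the intermediate value theorem.\<close>
  have nz: "poly F y \<noteq> 0" if y: "0 \<le> y" "y \<le> x" for y
  proof
    assume "poly F y = 0"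
    then have "(\<Prod>\<alpha>\<in>#inverse_roots F. 1 - \<alpha> * of_real y) = 0"
      using poly_eq_prod_inverse_roots[OF F0, of "of_real y"] poly_map_poly_complex_of_real[of F y] by simp
    then obtain \<alpha> where \<alpha>: "\<alpha> \<in># inverse_roots F" "1 - \<alpha> * of_real y = 0" by (auto simp: prod_mset_zero_iff)
    then have "norm (\<alpha> * of_real y) = 1" by simp
    then have "norm \<alpha> * y = 1" using y by (simp add: norm_mult)
    moreover have "norm \<alpha> * y \<le> norm \<alpha> * x" using y by (intro mult_left_mono) auto
    moreover have "norm \<alpha> * x \<le> \<beta> * x" using roots \<alpha> x by (intro mult_right_mono) auto
    ultimately show False using x by linarith
  qed
  have "poly F x \<noteq> 0" using nz[of x] x by simp
  then have "poly F x < 0" using neg by linarith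
  moreover from this have "x \<noteq> 0" using F0 by auto
  ultimately obtain y where "0 < y" "y < x" "poly F y = 0"
    using poly_IVT_neg[of 0 x F] F0 x by auto
  then show False using nz[of y] by simp
qed

text \<open>The series of \<open>Ln (1 - \<alpha> * x)\<close> are added over the inverse roots. The
  sum of these logarithms might differ from the real logarithm by a multiple of
  \<open>2 * pi * i\<close>, so only real parts are compared. The term \<open>n = 0\<close> is 0,
  since division by 0 gives 0.\<close>

lemma ln_poly_sums:
  assumes F0: "poly F 0 = 1" and roots: "\<forall>\<alpha>\<in>#inverse_roots F. norm \<alpha> \<le> \<beta>"
    and x: "0 \<le> x" "\<beta> * x < 1"
  shows "(\<lambda>n. Re (power_sum F n) * x ^ n / real n) sums (- ln (poly F x))"
proof -
  have *: "(\<lambda>n. (\<Sum>\<alpha>\<in>#M. \<alpha> ^ n) * of_real x ^ n / of_nat n) sums (- (\<Sum>\<alpha>\<in>#M. Ln (1 - \<alpha> * of_real x)))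
     \<and> (\<Prod>\<alpha>\<in>#M. 1 - \<alpha> * of_real x) = exp (\<Sum>\<alpha>\<in>#M. Ln (1 - \<alpha> * of_real x))"
    if "\<forall>\<alpha>\<in>#M. norm \<alpha> \<le> \<beta>" for M :: "complex multiset"
    using that
  proof (induction M)
    case empty
    then show ?case by simp
  next
    case (add a M)
    have "norm (a * of_real x) \<le> \<beta> * x" using add.prems x by (auto simp: norm_mult intro: mult_right_mono)
    then have a1: "norm (a * of_real x) < 1" using x by linarith
    have "(\<lambda>n. - ((- (- (a * of_real x))) ^ n) / of_nat n) sums Ln (1 + - (a * of_real x))"
      using a1 by (intro Ln_series') simp
    from sums_minus[OF this] have s: "(\<lambda>n. a ^ n * of_real x ^ n / of_nat n) sums (- Ln (1 - a * of_real x))"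
      by (simp add: power_mult_distrib)
    have IH: "(\<lambda>n. (\<Sum>\<alpha>\<in>#M. \<alpha> ^ n) * of_real x ^ n / of_nat n) sums (- (\<Sum>\<alpha>\<in>#M. Ln (1 - \<alpha> * of_real x)))"
      "(\<Prod>\<alpha>\<in>#M. 1 - \<alpha> * of_real x) = exp (\<Sum>\<alpha>\<in>#M. Ln (1 - \<alpha> * of_real x))"
      using add by auto
    have "1 - a * of_real x \<noteq> 0" using a1 by (metis norm_one eq_iff_diff_eq_0 less_irrefl)
    then have "(\<Prod>\<alpha>\<in>#add_mset a M. 1 - \<alpha> * of_real x) = exp (\<Sum>\<alpha>\<in>#add_mset a M. Ln (1 - \<alpha> * of_real x))"
      by (simp add: IH(2) exp_add)
    moreover have "(\<lambda>n. (\<Sum>\<alpha>\<in>#add_mset a M. \<alpha> ^ n) * of_real x ^ n / of_nat n)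
        sums (- (\<Sum>\<alpha>\<in>#add_mset a M. Ln (1 - \<alpha> * of_real x)))"
      using sums_add[OF s IH(1)] by (simp add: algebra_simps add_divide_distrib)
    ultimately show ?case by blast
  qed
  let ?S = "\<Sum>\<alpha>\<in>#inverse_roots F. Ln (1 - \<alpha> * of_real x)"
  have "(\<lambda>n. Re (power_sum F n * of_real x ^ n / of_nat n)) sums Re (- ?S)"
    using *[OF roots] unfolding power_sum_def by (intro sums_Re) blast
  moreover have "Re (power_sum F n * of_real x ^ n / of_nat n) = Re (power_sum F n) * x ^ n / real n" for n
  proof -
    have "power_sum F n * of_real x ^ n / of_nat n = power_sum F n * of_real (x ^ n / real n)" by simp
    then show ?thesis by (simp only: times_complex.sel Re_complex_of_real Im_complex_of_real) simp
  qed
  moreover have "Re ?S = ln (poly F x)"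
  proof -
    have pos: "poly F x > 0" by (rule poly_pos_of_inverse_roots[OF assms])
    have "of_real (poly F x) = exp ?S"
      using poly_eq_prod_inverse_roots[OF F0, of "of_real x"] poly_map_poly_complex_of_real[of F x] *[OF roots] by simp
    then have "norm (complex_of_real (poly F x)) = exp (Re ?S)" by (simp only: norm_exp_eq_Re)
    then have "poly F x = exp (Re ?S)" using pos by simp
    then show ?thesis by (metis ln_exp)
  qed
  ultimately show ?thesis by simp
qed

lemma sums_imp_has_sum_atLeast_1:
  fixes f :: "nat \<Rightarrow> real"
  assumes "f sums s" "f 0 = 0" "\<And>n. f n \<ge> 0"
  shows "(f has_sum s) {1..}"
proof -
  have "(f has_sum s) UNIV" using assms(1,3) by (rule sums_nonneg_imp_has_sum)
  also have "?this \<longleftrightarrow> (f has_sum s) {1..}"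
    using assms(2) by (intro has_sum_cong_neutral) (auto simp: not_le)
  finally show ?thesis .
qed

lemma has_sum_neg_ln_one_minus:
  fixes y :: real
  assumes "0 \<le> y" "y < 1"
  shows "((\<lambda>k. y ^ k / real k) has_sum (- ln (1 - y))) {1..}"
proof (rule sums_imp_has_sum_atLeast_1)
  have "(\<lambda>n. - ((- (- y)) ^ n) / real n) sums ln (1 + - y)"
    using assms by (intro ln_series') simp
  from sums_minus[OF this] show "(\<lambda>k. y ^ k / real k) sums (- ln (1 - y))" by simp
qed (use assms in auto)

lemma has_sum_geometric_atLeast:
  fixes y :: real
  assumes "0 \<le> y" "y < 1"
  shows "((\<lambda>k. y ^ k) has_sum (y ^ m / (1 - y))) {m..}"
proof -
  have "(\<lambda>k. y ^ m * y ^ k) sums (y ^ m * (1 / (1 - y)))"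
    using assms by (intro sums_mult geometric_sums) simp
  then have "((\<lambda>k. y ^ m * y ^ k) has_sum (y ^ m / (1 - y))) UNIV"
    using assms by (intro sums_nonneg_imp_has_sum) simp_all
  then have "((\<lambda>k. (\<lambda>i. y ^ i) (m + k)) has_sum (y ^ m / (1 - y))) UNIV" by (simp add: power_add)
  moreover have "bij_betw (\<lambda>k. m + k) UNIV {m..}"
    by (rule bij_betwI[where g = "\<lambda>i. i - m"]) auto
  ultimately show ?thesis using has_sum_reindex_bij_betw by blast
qed

text \<open>The double series below get their absolute summability from majorants of this product
  form.\<close>

lemma has_sum_product_real:
  fixes u :: "'a \<Rightarrow> real" and v :: "'b \<Rightarrow> real"
  assumes u: "u summable_on I" and v: "(v has_sum V) K"
    and nonneg: "\<And>i. i \<in> I \<Longrightarrow> u i \<ge> 0" "\<And>k. k \<in> K \<Longrightarrow> v k \<ge> 0"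
  shows "(\<lambda>(i, k). u i * v k) summable_on I \<times> K"
proof (rule summable_on_SigmaI[where g = "\<lambda>i. u i * V"])
  show "((\<lambda>y. case (x, y) of (i, k) \<Rightarrow> u i * v k) has_sum u x * V) K" for x
    using has_sum_cmult_right[OF v, of "u x"] by simp
  show "(\<lambda>i. u i * V) summable_on I" using u by (rule summable_on_cmult_left)
qed (use nonneg in auto)

text \<open>Expanding \<open>- ln (1 - x ^ j)\<close> gives a double series with terms
  \<open>b_coeff F j * (x ^ (j * k) / k)\<close>. Along \<open>j * k = n\<close> the coefficient is
  \<open>1 / n\<close> times the sum of \<open>j * b_coeff F j\<close> over the divisors
  \<open>j\<close> of \<open>n\<close>, hence \<open>Re (power_sum F n) / n\<close>, as in
  \<open>ln_poly_sums\<close>.\<close>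

lemma ln_poly_has_sum:
  assumes F0: "poly F 0 = 1" and roots: "\<forall>\<alpha>\<in>#inverse_roots F. norm \<alpha> \<le> \<beta>"
    and \<beta>: "\<beta> \<ge> 2" and x: "0 \<le> x" "\<beta> * x \<le> 1 / 2"
  shows "((\<lambda>j. b_coeff F j * - ln (1 - x ^ j)) has_sum (- ln (poly F x))) {1..}"
proof -
  define f where "f = (\<lambda>(j::nat, k::nat). b_coeff F j * (x ^ (j * k) / real k))"
  have "2 * x \<le> \<beta> * x" using \<beta> x by (intro mult_right_mono) auto
  then have x4: "x \<le> 1 / 4" using x by linarith
  have xj: "x ^ j \<le> 1 / 4" if "j \<ge> 1" for j
  proof -
    have "x ^ j \<le> x ^ 1" using that x x4 by (intro power_decreasing) auto
    then show ?thesis using x4 by simp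
  qed
  have bx: "0 \<le> \<beta> * x" using \<beta> x by simp
  have summ: "f summable_on {1..} \<times> {1..}"
  proof (rule abs_summable_summable)
    have "(\<lambda>j. 2 * real (degree F) * (\<beta> * x) ^ j) summable_on {1..}"
      by (intro summable_on_cmult_right has_sum_imp_summable[OF has_sum_geometric_atLeast]) (use bx x in auto)
    moreover have "((\<lambda>k. x ^ (k - 1)) has_sum (1 / (1 - x))) {1..}"
    proof -
      have "((\<lambda>k. x ^ k) has_sum (1 / (1 - x))) {0..}"
        using has_sum_geometric_atLeast[of x 0] x x4 by simp
      moreover have "bij_betw (\<lambda>k. k - 1) {1..} {0::nat..}"
        by (rule bij_betwI[where g = Suc]) auto
      ultimately show ?thesis using has_sum_reindex_bij_betw[of "\<lambda>k. k - 1" "{1..}" "{0..}" "\<lambda>k. x ^ k"] by blast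
    qed
    ultimately have "(\<lambda>(j, k). 2 * real (degree F) * (\<beta> * x) ^ j * x ^ (k - 1)) summable_on {1..} \<times> {1..}"
      using bx x by (intro has_sum_product_real) auto
    then show "(\<lambda>p. norm (f p)) summable_on {1..} \<times> {1..}"
    proof (rule summable_on_comparison_test)
      fix p :: "nat \<times> nat" assume "p \<in> {1..} \<times> {1..}"
      then obtain j k where p: "p = (j, k)" "j \<ge> 1" "k \<ge> 1" by auto
      have "\<bar>b_coeff F j\<bar> \<le> 2 * real (degree F) * \<beta> ^ j"
      proof -
        have "\<bar>b_coeff F j\<bar> \<le> 2 * real (degree F) * \<beta> ^ j / real j" using roots \<beta> p by (intro abs_b_coeff_le)
        also have "\<dots> \<le> 2 * real (degree F) * \<beta> ^ j / 1" using p \<beta> by (intro divide_left_mono) auto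
        finally show ?thesis by simp
      qed
      moreover have "x ^ (j * k) / real k \<le> x ^ j * x ^ (k - 1)"
      proof -
        have "x ^ (j * k) / real k \<le> x ^ (j * k) / 1" using p x by (intro divide_left_mono) auto
        also have "\<dots> \<le> x ^ (j + (k - 1))"
        proof -
          \<comment> \<open>The difference is \<open>(j - 1) * (k - 1)\<close>. This separates the
            variables in the majorant.\<close>
          have "j + (k - 1) \<le> j * k" using p(2,3) by (cases j; cases k) auto
          then show ?thesis using x x4 by (simp add: power_decreasing)
        qed
        finally show ?thesis by (simp add: power_add)
      qed
      ultimately have "\<bar>b_coeff F j\<bar> * (x ^ (j * k) / real k) \<le> (2 * real (degree F) * \<beta> ^ j) * (x ^ j * x ^ (k - 1))"
        using x \<beta> by (intro mult_mono) auto
      then show "norm (f p) \<le> (case p of (j, k) \<Rightarrow> 2 * real (degree F) * (\<beta> * x) ^ j * x ^ (k - 1))"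
        using x by (simp add: p f_def abs_mult power_mult_distrib mult_ac)
    qed simp
  qed
  then obtain S where S: "(f has_sum S) ({1..} \<times> {1..})" by (auto simp: summable_on_def)
  have 1: "((\<lambda>j. b_coeff F j * - ln (1 - x ^ j)) has_sum S) {1..}"
  proof (rule has_sum_SigmaD[OF S])
    fix j :: nat assume j: "j \<in> {1..}"
    have "((\<lambda>k. (x ^ j) ^ k / real k) has_sum (- ln (1 - x ^ j))) {1..}"
      using x xj[of j] j by (intro has_sum_neg_ln_one_minus) auto
    from has_sum_cmult_right[OF this, of "b_coeff F j"]
    show "((\<lambda>k. f (j, k)) has_sum b_coeff F j * - ln (1 - x ^ j)) {1..}"
      by (simp add: f_def power_mult)
  qed
  \<comment> \<open>Pairs \<open>(j, k)\<close> are sorted by their product \<open>n\<close>;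
    \<open>k\<close> is recovered as \<open>n div j\<close>.\<close>
  have bij: "bij_betw (\<lambda>(n :: nat, j :: nat). (j, n div j)) (SIGMA n : {1..}. {j. j dvd n}) ({1..} \<times> {1..})"
  proof (rule bij_betwI[where g = "\<lambda>(j, k). (j * k, j)"])
    show "(\<lambda>(n :: nat, j :: nat). (j, n div j)) \<in> (SIGMA n:{1..}. {j. j dvd n}) \<rightarrow> {1..} \<times> {1..}"
    proof
      fix p :: "nat \<times> nat" assume "p \<in> (SIGMA n:{1..}. {j. j dvd n})"
      then obtain j k where p: "p = (j * k, j)" "j * k \<ge> 1" by (auto elim!: dvdE)
      then have "j > 0" "k > 0" by (auto intro!: Nat.gr0I)
      then show "(case p of (n, j) \<Rightarrow> (j, n div j)) \<in> {1..} \<times> {1..}" using p by simp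
    qed
  qed (auto simp: Suc_le_eq dvd_pos_nat)
  have "((\<lambda>p. f ((\<lambda>(n, j). (j, n div j)) p)) has_sum S) (SIGMA n : {1..}. {j. j dvd n})"
    unfolding has_sum_reindex_bij_betw[OF bij] by (rule S)
  then have 2: "((\<lambda>n. Re (power_sum F n) * x ^ n / real n) has_sum S) {1..}"
  proof (rule has_sum_SigmaD)
    fix n :: nat assume n: "n \<in> {1..}"
    then have fin: "finite {j. j dvd n}" by simp
    have "Re (power_sum F n) * x ^ n / real n = (\<Sum>j | j dvd n. real j * b_coeff F j) * (x ^ n / real n)"
      using sum_divisors_b_coeff[of n F] n by simp
    also have "\<dots> = (\<Sum>j | j dvd n. f (j, n div j))"
      unfolding sum_distrib_right
    proof (rule sum.cong[OF refl])
      fix j assume "j \<in> {j. j dvd n}"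
      then obtain k where k: "n = j * k" by (auto elim: dvdE)
      then have "j > 0" "k > 0" using n by (auto intro!: Nat.gr0I)
      then show "real j * b_coeff F j * (x ^ n / real n) = f (j, n div j)"
        by (simp add: f_def k)
    qed
    finally show "((\<lambda>j. f ((\<lambda>(n, j). (j, n div j)) (n, j))) has_sum Re (power_sum F n) * x ^ n / real n) {j. j dvd n}"
      using fin by (intro has_sum_finiteI) auto
  qed
  have "((\<lambda>n. Re (power_sum F n) * x ^ n / real n) has_sum S) {1..}
      \<longleftrightarrow> ((\<lambda>n. Re (power_sum F n) * x ^ n / real n) has_sum S) UNIV"
    by (intro has_sum_cong_neutral) (auto simp: not_le)
  with 2 have "(\<lambda>n. Re (power_sum F n) * x ^ n / real n) sums S" by (intro has_sum_imp_sums) simp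
  moreover have "(\<lambda>n. Re (power_sum F n) * x ^ n / real n) sums (- ln (poly F x))"
    using x by (intro ln_poly_sums[OF F0 roots]) auto
  ultimately have "S = - ln (poly F x)" by (rule sums_unique2)
  then show ?thesis using 1 by simp
qed


section \<open>The Euler product of a rational function\<close>

lemma class_log_zeta_has_sum:
  assumes "n \<ge> 2"
  shows "((\<lambda>p. - ln (1 - (1 / real p) ^ n)) has_sum class_log_zeta q P A n)
    {p. prime p \<and> P \<le> real p \<and> int p mod int q \<in> A}" (is "(?l has_sum _) ?S")
proof -
  let ?g = "\<lambda>p. if prime p \<and> P \<le> real p \<and> int p mod int q \<in> A then ?l p else 0"
  have "summable ?g" by (rule summable_neg_ln_primes[OF assms]) blast
  then have "?g sums class_log_zeta q P A n" unfolding class_log_zeta_def by (rule summable_sums)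
  then have "(?g has_sum class_log_zeta q P A n) UNIV"
    by (rule sums_nonneg_imp_has_sum) (use neg_ln_prime_bounds(1) assms in auto)
  also have "?this \<longleftrightarrow> (?l has_sum class_log_zeta q P A n) ?S"
    by (intro has_sum_cong_neutral) auto
  finally show ?thesis .
qed

lemma class_log_zeta_le:
  assumes "q > 1" "A \<in> lattice_classes (unit_group q)" "P \<ge> 4" "n \<ge> 4"
  shows "class_log_zeta q P A n \<le> power_tail_bound P n"
proof -
  interpret finite_comm_group "unit_group q" using assms(1) by (rule unit_group_properties)
  have "class_log_zeta q P A n \<le> (\<Sum>B\<in>lattice_classes (unit_group q). class_log_zeta q P B n)"
    using assms finite_lattice_classes class_log_zeta_nonneg[of n q P]
    by (intro member_le_sum) auto
  also have "\<dots> \<le> power_tail_bound P n" using assms by (intro sum_class_log_zeta_le)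
  finally show ?thesis .
qed

lemma b_coeff_1_eq:
  assumes "poly F 0 = 1" "poly H 0 = 1" "[:0, 1:] ^ 2 dvd F - H"
  shows "b_coeff F 1 = b_coeff H 1"
proof -
  obtain k where "F - H = [:0, 1:] ^ 2 * k" using assms(3) by (elim dvdE)
  then have "poly.coeff (F - H) 1 = 0" by (simp add: power2_eq_square coeff_pCons)
  then show ?thesis unfolding b_coeff_1 power_sum_1[OF assms(1)] power_sum_1[OF assms(2)] by simp
qed

lemma abs_b_coeff_diff_le:
  assumes "\<forall>\<alpha>\<in>#inverse_roots F + inverse_roots H. norm \<alpha> \<le> \<beta>" "\<beta> \<ge> 2" "j \<ge> 1"
  shows "\<bar>b_coeff H j - b_coeff F j\<bar> \<le> 4 * real (max (degree F) (degree H)) * \<beta> ^ j / real j"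
proof -
  define m where "m = real (max (degree F) (degree H))"
  have "\<bar>b_coeff H j - b_coeff F j\<bar> \<le> \<bar>b_coeff H j\<bar> + \<bar>b_coeff F j\<bar>" by (rule abs_triangle_ineq4)
  also have "\<dots> \<le> 2 * real (degree H) * \<beta> ^ j / real j + 2 * real (degree F) * \<beta> ^ j / real j"
    using assms by (intro add_mono abs_b_coeff_le) auto
  also have "\<dots> \<le> 2 * m * \<beta> ^ j / real j + 2 * m * \<beta> ^ j / real j"
    unfolding m_def using assms by (intro add_mono divide_right_mono mult_right_mono mult_left_mono) auto
  also have "\<dots> = 4 * m * \<beta> ^ j / real j" by simp
  finally show ?thesis unfolding m_def .
qed

text \<open>The double family over \<open>j \<ge> 2\<close> and the primes of the class is
  absolutely summable. Summing over \<open>p\<close> first gives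
  \<open>c j * class_log_zeta q P A j\<close>, summing over \<open>j\<close> first gives the
  logarithm of the factor at \<open>p\<close>; hence the common \<open>S\<close> of both
  conclusions.\<close>

lemma log_euler_product_sums:
  fixes F H :: "real poly" and \<beta> P :: real
  assumes F0: "poly F 0 = 1" and H0: "poly H 0 = 1" and FH: "[:0, 1:] ^ 2 dvd F - H"
    and \<beta>: "\<beta> \<ge> 2" and roots: "\<forall>\<alpha>\<in>#inverse_roots F + inverse_roots H. norm \<alpha> \<le> \<beta>"
    and P: "P \<ge> 2 * \<beta>"
  defines "c \<equiv> \<lambda>j. b_coeff H j - b_coeff F j"
  obtains S where
    "(\<lambda>p. if prime p \<and> P \<le> real p \<and> int p mod int q \<in> A
         then poly F (1 / real p) / poly H (1 / real p) else 1) has_prod exp S"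
    "(\<lambda>j. if j \<ge> 2 then c j * class_log_zeta q P A j else 0) sums S"
proof -
  define m where "m = real (max (degree F) (degree H))"
  define R where "R = {p. prime p \<and> P \<le> real p \<and> int p mod int q \<in> A}"
  define f where "f = (\<lambda>(j, p). c j * - ln (1 - (1 / real p) ^ j))"
  have rootsF: "\<forall>\<alpha>\<in>#inverse_roots F. norm \<alpha> \<le> \<beta>" and rootsH: "\<forall>\<alpha>\<in>#inverse_roots H. norm \<alpha> \<le> \<beta>"
    using roots by auto
  \<comment> \<open>For \<open>j = 1\<close> the sum over primes need not converge; this vanishing
    lets the family start at 2.\<close>
  have c1: "c 1 = 0" unfolding c_def using b_coeff_1_eq[OF F0 H0 FH] by simp
  have m0: "m \<ge> 0" unfolding m_def by simp
  have bp: "0 \<le> 1 / real p" "\<beta> * (1 / real p) \<le> 1 / 2" if "p \<in> R" for p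
  proof -
    have "2 * \<beta> \<le> real p" "real p > 0" using that P \<beta> unfolding R_def by auto
    then show "0 \<le> 1 / real p" "\<beta> * (1 / real p) \<le> 1 / 2" by (simp_all add: field_simps)
  qed
  have "f summable_on {2..} \<times> R"
  proof (rule abs_summable_summable)
    \<comment> \<open>Of the \<open>j\<close> factors \<open>\<beta> / p \<le> 1 / 2\<close> two are
      kept for convergence over \<open>p\<close>, the others become \<open>4 * (1 / 2) ^ j\<close>.
      The remaining \<open>4 * m\<close> combines \<open>2 * m\<close> from the bound on
      \<open>c j\<close> with 2 from the logarithm.\<close>
    have "(\<lambda>j. 16 * m * \<beta>\<^sup>2 * (1 / 2) ^ j) summable_on {2..}"
      by (intro summable_on_cmult_right has_sum_imp_summable[OF has_sum_geometric_atLeast]) auto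
    moreover have "(\<lambda>p. inverse (real p ^ 2)) summable_on R"
    proof (rule summable_on_subset)
      show "(\<lambda>p. inverse (real p ^ 2)) summable_on UNIV"
        by (intro summable_nonneg_imp_summable_on inverse_power_summable) auto
    qed simp
    then obtain V where "((\<lambda>p. inverse (real p ^ 2)) has_sum V) R" by (auto simp: summable_on_def)
    ultimately have "(\<lambda>(j, p). 16 * m * \<beta>\<^sup>2 * (1 / 2) ^ j * inverse (real p ^ 2)) summable_on {2..} \<times> R"
      using m0 by (intro has_sum_product_real) auto
    then show "(\<lambda>i. norm (f i)) summable_on {2..} \<times> R"
    proof (rule summable_on_comparison_test)
      fix i :: "nat \<times> nat" assume "i \<in> {2..} \<times> R"
      then obtain j p where i: "i = (j, p)" "j \<ge> 2" "p \<in> R" by auto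
      let ?x = "1 / real p"
      have pp: "prime p" using i(3) by (simp add: R_def)
      have cj: "\<bar>c j\<bar> \<le> 2 * m * \<beta> ^ j"
      proof -
        have "\<bar>c j\<bar> \<le> 4 * m * \<beta> ^ j / real j"
          unfolding c_def m_def using roots \<beta> i(2) by (intro abs_b_coeff_diff_le) auto
        also have "\<dots> \<le> 4 * m * \<beta> ^ j / 2" using i(2) m0 \<beta> by (intro divide_left_mono) auto
        finally show ?thesis by simp
      qed
      have x: "0 \<le> ?x ^ j" "?x ^ j \<le> 1 / 2" using prime_inverse_power_bounds[OF pp i(2)] by auto
      have l: "\<bar>- ln (1 - ?x ^ j)\<bar> \<le> 2 * ?x ^ j" using neg_ln_one_minus_bounds[OF x] by simp
      have "\<bar>c j\<bar> * \<bar>- ln (1 - ?x ^ j)\<bar> \<le> (2 * m * \<beta> ^ j) * (2 * ?x ^ j)"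
        by (rule mult_mono[OF cj l]) (use m0 \<beta> in auto)
      also have "\<dots> = 4 * m * (\<beta> * ?x) ^ j" unfolding power_mult_distrib by simp
      also have "\<dots> \<le> 4 * m * ((\<beta> * ?x)\<^sup>2 * (4 * (1 / 2) ^ j))"
      proof (rule mult_left_mono)
        obtain k where k: "j = 2 + k" using i(2) le_iff_add by blast
        have "(\<beta> * ?x) ^ k \<le> (1 / 2) ^ k" using bp[OF i(3)] \<beta> by (intro power_mono) auto
        then have "(\<beta> * ?x)\<^sup>2 * (\<beta> * ?x) ^ k \<le> (\<beta> * ?x)\<^sup>2 * (1 / 2) ^ k" by (intro mult_left_mono) auto
        moreover have "(4 * (1 / 2) ^ j :: real) = (1 / 2) ^ k" unfolding k power_add by (simp add: power2_eq_square)
        ultimately show "(\<beta> * ?x) ^ j \<le> (\<beta> * ?x)\<^sup>2 * (4 * (1 / 2) ^ j)" by (simp only: k power_add)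
      qed (use m0 in simp)
      also have "\<dots> = 16 * m * \<beta>\<^sup>2 * (1 / 2) ^ j * inverse (real p ^ 2)"
        unfolding power_mult_distrib by (simp add: power_divide inverse_eq_divide mult_ac)
      finally show "norm (f i) \<le> (case i of (j, p) \<Rightarrow> 16 * m * \<beta>\<^sup>2 * (1 / 2) ^ j * inverse (real p ^ 2))"
        unfolding i(1) f_def by (simp add: abs_mult)
    qed simp
  qed
  then obtain S where S: "(f has_sum S) ({2..} \<times> R)" by (auto simp: summable_on_def)
  have "((\<lambda>j. c j * class_log_zeta q P A j) has_sum S) {2..}"
  proof (rule has_sum_SigmaD[OF S])
    fix j :: nat assume "j \<in> {2..}"
    then have "((\<lambda>p. - ln (1 - (1 / real p) ^ j)) has_sum class_log_zeta q P A j) R"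
      unfolding R_def by (intro class_log_zeta_has_sum) simp
    from has_sum_cmult_right[OF this, of "c j"]
    show "((\<lambda>p. f (j, p)) has_sum c j * class_log_zeta q P A j) R" by (simp add: f_def)
  qed
  also have "?this \<longleftrightarrow> ((\<lambda>j. if j \<ge> 2 then c j * class_log_zeta q P A j else 0) has_sum S) UNIV"
    by (intro has_sum_cong_neutral) auto
  finally have sumsj: "(\<lambda>j. if j \<ge> 2 then c j * class_log_zeta q P A j else 0) sums S" by (rule has_sum_imp_sums)
  define L where "L p = ln (poly F (1 / real p)) - ln (poly H (1 / real p))" for p :: nat
  have "((\<lambda>(p, j). f (j, p)) has_sum S) (R \<times> {2..})" using S by (subst (asm) has_sum_swap)
  then have "(L has_sum S) R"
  proof (rule has_sum_SigmaD)
    fix p assume p: "p \<in> R"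
    have bF: "((\<lambda>j. b_coeff F j * - ln (1 - (1 / real p) ^ j)) has_sum (- ln (poly F (1 / real p)))) {1..}"
      by (rule ln_poly_has_sum[OF F0 rootsF \<beta> bp[OF p]])
    have bH: "((\<lambda>j. b_coeff H j * - ln (1 - (1 / real p) ^ j)) has_sum (- ln (poly H (1 / real p)))) {1..}"
      by (rule ln_poly_has_sum[OF H0 rootsH \<beta> bp[OF p]])
    have "((\<lambda>j. b_coeff H j * - ln (1 - (1 / real p) ^ j) + - (b_coeff F j * - ln (1 - (1 / real p) ^ j)))
        has_sum (- ln (poly H (1 / real p)) + - (- ln (poly F (1 / real p))))) {1..}"
      by (rule has_sum_add[OF bH]) (use bF in \<open>simp only: has_sum_uminus minus_minus\<close>)
    then have "((\<lambda>j. f (j, p)) has_sum L p) {1..}"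
      by (simp add: f_def c_def L_def algebra_simps)
    also have "?this \<longleftrightarrow> ((\<lambda>j. f (j, p)) has_sum L p) {2..}"
    proof (rule has_sum_cong_neutral)
      fix j :: nat assume "j \<in> {1..} - {2..}"
      then have "j = 1" by auto
      then show "f (j, p) = 0" using c1 by (simp add: f_def)
    qed auto
    finally show "((\<lambda>j. case (p, j) of (p, j) \<Rightarrow> f (j, p)) has_sum L p) {2..}" by simp
  qed
  also have "?this \<longleftrightarrow> ((\<lambda>p. if p \<in> R then L p else 0) has_sum S) UNIV"
    by (intro has_sum_cong_neutral) auto
  finally have "(\<lambda>p. if p \<in> R then L p else 0) sums S" by (rule has_sum_imp_sums)
  from sums_imp_has_prod_exp[OF this]
  have "(\<lambda>p. exp (if p \<in> R then L p else 0)) has_prod exp S" by (simp add: has_prod_def)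
  moreover have "exp (if p \<in> R then L p else 0) = (if prime p \<and> P \<le> real p \<and> int p mod int q \<in> A
         then poly F (1 / real p) / poly H (1 / real p) else 1)" for p
  proof (cases "p \<in> R")
    case True
    have "\<beta> * (1 / real p) < 1" using bp(2)[OF True] by linarith
    then have "poly F (1 / real p) > 0" "poly H (1 / real p) > 0"
      using poly_pos_of_inverse_roots[OF F0 rootsF bp(1)[OF True]]
        poly_pos_of_inverse_roots[OF H0 rootsH bp(1)[OF True]] by auto
    then have "exp (L p) = poly F (1 / real p) / poly H (1 / real p)" by (simp add: L_def exp_diff)
    then show ?thesis using True by (simp add: R_def)
  next
    case False
    then show ?thesis by (auto simp: R_def)
  qed
  ultimately show ?thesis using that sumsj by simp
qed

section \<open>The two error terms and the conclusion\<close>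

lemma tail_error:
  fixes \<beta> P m :: real and c :: "nat \<Rightarrow> real"
  assumes q: "q > 1" and A: "A \<in> lattice_classes (unit_group q)"
    and \<beta>: "\<beta> \<ge> 2" and P: "P \<ge> 2 * \<beta>" and J: "J \<ge> 3" and m0: "m \<ge> 0"
    and c: "\<And>j. j \<ge> 1 \<Longrightarrow> \<bar>c j\<bar> \<le> 4 * m * \<beta> ^ j / real j"
    and h: "(\<lambda>j. if j \<ge> 2 then c j * class_log_zeta q P A j else 0) sums S"
  shows "\<bar>S - (\<Sum>j=2..J. c j * class_log_zeta q P A j)\<bar> \<le> m * (4 * \<beta> ^ (J + 1) / (real J * P ^ J))"
proof -
  define Z where "Z = class_log_zeta q P A"
  define h where "h j = (if j \<ge> 2 then c j * Z j else 0)" for j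
  have P4: "P \<ge> 4" using P \<beta> by simp
  define W where "W = power_tail_bound P (J + 1)"
  have W0: "W \<ge> 0" unfolding W_def using P4 J by (intro power_tail_bound_nonneg) auto
  \<comment> \<open>A bound for the term \<open>j = J + 1\<close>. The later ones decrease by the
    ratio \<open>\<beta> / P \<le> 1 / 2\<close>, so the whole tail is at most
    \<open>2 * K\<close>.\<close>
  define K where "K = 4 * m * \<beta> ^ (J + 1) / real (J + 1) * W"
  have tm: "norm (h (i + (J + 1))) \<le> K * (1 / 2) ^ i" for i
  proof -
    define j where "j = J + 1 + i"
    have j: "j \<ge> 4" using J by (simp add: j_def)
    have "\<bar>c j\<bar> \<le> 4 * m * \<beta> ^ j / real j" using j by (intro c) simp
    also have "\<dots> \<le> 4 * m * \<beta> ^ j / real (J + 1)" using m0 \<beta> by (intro divide_left_mono) (auto simp: j_def)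
    finally have cj: "\<bar>c j\<bar> \<le> 4 * m * \<beta> ^ j / real (J + 1)" .
    have "0 \<le> Z j" unfolding Z_def using j by (intro class_log_zeta_nonneg) simp
    moreover have "Z j \<le> power_tail_bound P j" unfolding Z_def by (rule class_log_zeta_le[OF q A P4 j])
    moreover have "power_tail_bound P j \<le> W * (1 / P) ^ i"
      unfolding W_def j_def using P4 J by (intro power_tail_bound_mono) auto
    ultimately have Zj: "\<bar>Z j\<bar> \<le> W * (1 / P) ^ i" by simp
    have "\<bar>c j\<bar> * \<bar>Z j\<bar> \<le> (4 * m * \<beta> ^ j / real (J + 1)) * (W * (1 / P) ^ i)"
      by (rule mult_mono[OF cj Zj]) (use m0 \<beta> in auto)
    also have "\<dots> = K * (\<beta> ^ i * (1 / P) ^ i)" unfolding K_def j_def power_add by simp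
    also have "\<dots> = K * (\<beta> / P) ^ i" by (simp add: power_mult_distrib[symmetric])
    also have "\<dots> \<le> K * (1 / 2) ^ i"
    proof (rule mult_left_mono)
      have "\<beta> / P \<le> 1 / 2" using P \<beta> by (simp add: field_simps)
      then show "(\<beta> / P) ^ i \<le> (1 / 2) ^ i" using P4 \<beta> by (intro power_mono) auto
      show "0 \<le> K" unfolding K_def using m0 \<beta> W0 by simp
    qed
    finally show ?thesis using j by (simp add: h_def j_def abs_mult add_ac)
  qed
  have geo: "(\<lambda>i. K * (1 / 2) ^ i) sums (K * 2)"
    using sums_mult[OF geometric_sums[of "1 / 2 :: real"], of K] by simp
  have "h sums S" using h unfolding h_def[abs_def] Z_def .
  then have "(\<lambda>i. h (i + (J + 1))) sums (S - (\<Sum>i<J + 1. h i))" by (rule sums_split_initial_segment)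
  then have "S - (\<Sum>i<J + 1. h i) = (\<Sum>i. h (i + (J + 1)))" by (simp add: sums_iff)
  also have "norm \<dots> \<le> (\<Sum>i. K * (1 / 2) ^ i)"
    by (rule norm_suminf_le[OF tm]) (use geo in \<open>simp add: sums_iff\<close>)
  also have "\<dots> = 2 * K" using geo by (simp add: sums_iff)
  finally have tail: "\<bar>S - (\<Sum>i<J + 1. h i)\<bar> \<le> 2 * K" by simp
  have "(\<Sum>i<J + 1. h i) = (\<Sum>j=2..J. c j * Z j)"
  proof -
    have "(\<Sum>i<J + 1. h i) = (\<Sum>j\<in>{2..J}. h j)"
      by (rule sum.mono_neutral_right) (auto simp: h_def)
    then show ?thesis by (simp add: h_def)
  qed
  moreover have "2 * K \<le> m * (4 * \<beta> ^ (J + 1) / (real J * P ^ J))"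
  proof -
    have Jr: "real J \<ge> 3" using J by simp
    \<comment> \<open>The claim on \<open>2 * K\<close> reduces to this after cancellation,
      \<open>101 / 50\<close> being twice the factor in \<open>power_tail_bound\<close>. Expanding
      \<open>(P - 4) * (J - 51 / 50) \<ge> 0\<close> leaves enough room once
      \<open>J \<ge> 3\<close>.\<close>
    have "101 / 50 * (real J + P) \<le> P * (real J + 1)"
    proof -
      have "(P - 4) * (real J + 1 - 101 / 50) \<ge> 0" using P4 Jr by (intro mult_nonneg_nonneg) auto
      moreover have "(P - 4) * (real J + 1 - 101 / 50) = P * real J - 51 / 50 * P - 4 * real J + 102 / 25"
        by (simp add: field_simps)
      moreover have "P * (real J + 1) = P * real J + P" by (simp add: distrib_left)
      moreover have "101 / 50 * (b + a) \<le> c + a" if "0 \<le> c - 51 / 50 * a - 4 * b + 102 / 25" "3 \<le> b" for a b c :: real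
        using that by (simp add: field_simps)
      ultimately show ?thesis using Jr by metis
    qed
    then have "101 / 50 * (real J + P) / (real J * (P * (real J + 1))) \<le> P * (real J + 1) / (real J * (P * (real J + 1)))"
      using P4 by (intro divide_right_mono) auto
    moreover have "P * (real J + 1) / (real J * (P * (real J + 1))) = 1 / real J"
      using P4 Jr by (intro nonzero_divide_mult_cancel_right) (simp add: add_nonneg_eq_0_iff)
    moreover have "101 / 50 * (1 + P / real J) / (real (J + 1) * P) = 101 / 50 * (real J + P) / (real J * (P * (real J + 1)))"
    proof -
      have "1 + P / real J = (real J + P) / real J" using Jr by (simp add: add_divide_distrib)
      then show ?thesis by (simp add: add.commute mult_ac)
    qed
    ultimately have key: "101 / 50 * (1 + P / real J) / (real (J + 1) * P) \<le> 1 / real J" by simp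
    have "2 * (a / b * (101 / 100 * (u * (1 / P) * v))) = a * u * (101 / 50 * v / (b * P))" for a b u v :: real
      by (simp add: mult_ac)
    moreover have W': "W = 101 / 100 * ((1 / P) ^ J * (1 / P) * (1 + P / real J))"
      by (simp add: W_def power_tail_bound_def)
    ultimately have "2 * K = 4 * m * \<beta> ^ (J + 1) * (1 / P) ^ J * (101 / 50 * (1 + P / real J) / (real (J + 1) * P))"
      unfolding K_def W' by blast
    also have "\<dots> \<le> 4 * m * \<beta> ^ (J + 1) * (1 / P) ^ J * (1 / real J)"
      by (rule mult_left_mono[OF key]) (use m0 \<beta> P4 in auto)
    also have "\<dots> = m * (4 * \<beta> ^ (J + 1) / (real J * P ^ J))" by (simp add: power_divide mult_ac)
    finally show ?thesis .
  qed
  ultimately show ?thesis using tail by (simp add: Z_def)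
qed

text \<open>With \<open>y = \<beta> * (1 / P) ^ (2 ^ r)\<close> the error at \<open>j\<close> is at
  most a fixed multiple of \<open>y ^ j\<close>. The geometric series from \<open>j = 2\<close> on
  then yields \<open>y\<^sup>2\<close>, the quotient of \<open>\<beta>\<^sup>2\<close> by
  \<open>P ^ (2 ^ (r + 1))\<close>.\<close>

lemma approximation_error:
  fixes \<beta> P m :: real and c :: "nat \<Rightarrow> real"
  assumes q: "q > 1" and A: "A \<in> lattice_classes (unit_group q)"
    and \<beta>: "\<beta> \<ge> 2" and P: "P \<ge> 2 * \<beta>" and r: "r \<ge> 2" and m0: "m \<ge> 0"
    and c: "\<And>j. j \<ge> 1 \<Longrightarrow> \<bar>c j\<bar> \<le> 4 * m * \<beta> ^ j / real j"
  defines "g \<equiv> card (lattice_classes (unit_group q))"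
    and "\<tau> \<equiv> num_divisors (group_exponent (unit_group q))"
  shows "\<bar>\<Sum>j=2..J. c j * (class_log_zeta q P A j - log_zeta_approx q P (real j) r A)\<bar>
    \<le> m * ((real (g * \<tau>) / 2) ^ (r - 1) * (real r * \<beta>\<^sup>2 / P ^ (2 ^ (r + 1))) * (1 + P / 2 ^ r))"
proof -
  have P4: "P \<ge> 4" using P \<beta> by simp
  define X where "X = (real (g * \<tau>) / 2) ^ (r - 1)"
  define y where "y = \<beta> * (1 / P) ^ (2 ^ r)"
  define Q where "Q = 1 + P / 2 ^ r"
  have X0: "X \<ge> 0" and Q0: "Q \<ge> 0" unfolding X_def Q_def using P4 by auto
  have r2: "(2::nat) ^ r \<ge> 4" using power_increasing[of 2 r "2::nat"] r by simp
  have y: "0 \<le> y" "y \<le> 1 / 4"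
  proof -
    show "0 \<le> y" unfolding y_def using \<beta> P4 by simp
    have "(1 / P) ^ (2 ^ r) \<le> (1 / P) ^ 2" using r2 P4 by (intro power_decreasing) auto
    then have "y \<le> \<beta> * (1 / P) ^ 2" unfolding y_def using \<beta> by (intro mult_left_mono) auto
    also have "\<dots> = (\<beta> / P) * (1 / P)" by (simp add: power2_eq_square)
    also have "\<dots> \<le> (1 / 2) * (1 / 4)"
      using P P4 \<beta> by (intro mult_mono) (auto simp: field_simps)
    finally show "y \<le> 1 / 4" by simp
  qed
  \<comment> \<open>\<open>303 / 500\<close> is the product of 2 from the bound on
    \<open>c j\<close>, \<open>3 / 10\<close> from \<open>log_zeta_approx_error\<close> and
    \<open>101 / 100\<close> from \<open>power_tail_bound\<close>.\<close>
  have tm: "\<bar>c j * (class_log_zeta q P A j - log_zeta_approx q P (real j) r A)\<bar>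
      \<le> m * X * real r * Q * (303 / 500) * y ^ j" if j: "j \<ge> 2" for j
  proof -
    have cj: "\<bar>c j\<bar> \<le> 2 * m * \<beta> ^ j"
    proof -
      have "\<bar>c j\<bar> \<le> 4 * m * \<beta> ^ j / real j" using j by (intro c) simp
      also have "\<dots> \<le> 4 * m * \<beta> ^ j / 2" using j m0 \<beta> by (intro divide_left_mono) auto
      finally show ?thesis by simp
    qed
    have "power_tail_bound P (2 ^ r * j) \<le> 101 / 100 * ((1 / P) ^ (2 ^ r * j) * Q)"
    proof -
      \<comment> \<open>As \<open>j \<ge> 2\<close>, the denominator \<open>2 ^ r * j - 1\<close> is
        at least \<open>2 ^ r\<close>, so \<open>Q\<close> serves for all \<open>j\<close> at
        once.\<close>
      have "(2::nat) ^ r * 2 \<le> 2 ^ r * j" using j by simp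
      then have "(2::nat) ^ r + 1 \<le> 2 ^ r * j" using r2 by linarith
      then have "real (2 ^ r + 1) \<le> real (2 ^ r * j)" by (rule of_nat_mono)
      then have "(2::real) ^ r \<le> real (2 ^ r * j) - 1" by simp
      then have "1 + P / (real (2 ^ r * j) - 1) \<le> Q" unfolding Q_def
        using P4 by (intro add_left_mono frac_le) auto
      then show ?thesis unfolding power_tail_bound_def using P4 by (intro mult_left_mono) auto
    qed
    then have "X * (3 / 10 * real r) * power_tail_bound P (2 ^ r * j)
        \<le> X * (3 / 10 * real r) * (101 / 100 * ((1 / P) ^ (2 ^ r * j) * Q))"
      using X0 by (intro mult_left_mono) auto
    moreover have "\<bar>class_log_zeta q P A j - log_zeta_approx q P (real j) r A\<bar>
        \<le> X * (3 / 10 * real r) * power_tail_bound P (2 ^ r * j)"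
      using log_zeta_approx_error[OF q A P4 j r] unfolding X_def g_def \<tau>_def by (simp only: abs_minus_commute)
    ultimately have E: "\<bar>class_log_zeta q P A j - log_zeta_approx q P (real j) r A\<bar>
        \<le> X * (3 / 10 * real r) * (101 / 100 * ((1 / P) ^ (2 ^ r * j) * Q))" by (rule order_trans[rotated])
    have "\<bar>c j\<bar> * \<bar>class_log_zeta q P A j - log_zeta_approx q P (real j) r A\<bar>
      \<le> (2 * m * \<beta> ^ j) * (X * (3 / 10 * real r) * (101 / 100 * ((1 / P) ^ (2 ^ r * j) * Q)))"
      by (rule mult_mono[OF cj E]) (use m0 \<beta> in auto)
    also have "\<dots> = m * X * real r * Q * (303 / 500) * y ^ j"
      unfolding y_def power_mult_distrib power_mult by simp
    finally show ?thesis by (simp add: abs_mult)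
  qed
  have "\<bar>\<Sum>j=2..J. c j * (class_log_zeta q P A j - log_zeta_approx q P (real j) r A)\<bar>
     \<le> (\<Sum>j=2..J. m * X * real r * Q * (303 / 500) * y ^ j)"
    by (rule order_trans[OF sum_abs sum_mono]) (use tm in auto)
  also have "\<dots> = m * X * real r * Q * (303 / 500) * (\<Sum>j=2..J. y ^ j)" by (simp add: sum_distrib_left)
  also have "\<dots> \<le> m * X * real r * Q * (303 / 500) * (y\<^sup>2 * (4 / 3))"
  proof (rule mult_left_mono)
    have hs: "((\<lambda>k. y ^ k) has_sum (y ^ 2 / (1 - y))) {2..}" using y by (intro has_sum_geometric_atLeast) auto
    have "(\<Sum>j=2..J. y ^ j) \<le> y ^ 2 / (1 - y)"
      by (rule finite_sum_le_has_sum[OF hs]) (use y in auto)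
    also have "\<dots> \<le> y ^ 2 / (3 / 4)" using y by (intro divide_left_mono) auto
    finally show "(\<Sum>j=2..J. y ^ j) \<le> y\<^sup>2 * (4 / 3)" by simp
  qed (use m0 X0 Q0 in simp)
  \<comment> \<open>The numerical factor is \<open>303 / 500 * (4 / 3) = 101 / 125\<close>, below
    1.\<close>
  also have "\<dots> \<le> m * X * real r * Q * y\<^sup>2"
  proof -
    have "0 \<le> m * X * real r * Q * y\<^sup>2" using m0 X0 Q0 by simp
    then show ?thesis by (simp add: field_simps)
  qed
  also have "y\<^sup>2 = \<beta>\<^sup>2 / P ^ (2 ^ (r + 1))"
    unfolding y_def power_mult_distrib by (simp add: power_mult[symmetric] power_divide mult.commute)
  finally show ?thesis unfolding X_def Q_def by (simp add: mult_ac)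
qed

theorem theorem1p4:
  fixes q J r :: nat and A :: "int set" and F H :: "real poly" and \<beta> P :: real
  assumes "q > 1"
    and "A \<in> lattice_classes (unit_group q)"
    and "coprime F H"
    and "poly F 0 = 1" and "poly H 0 = 1"
    and "[:0, 1:] ^ 2 dvd F - H"
    and "\<beta> \<ge> 2"
    and "\<forall>\<alpha>\<in>#inverse_roots F + inverse_roots H. norm \<alpha> \<le> \<beta>"
    and "P \<ge> 2 * \<beta>"
    and "J \<ge> 3" and "r \<ge> 2"
  shows "\<exists>I>0.
    (\<lambda>p. if prime p \<and> P \<le> real p \<and> int p mod int q \<in> A
         then poly F (1 / real p) / poly H (1 / real p) else 1)
      has_prod
    ((\<Prod>j=2..J. zeta_approx q P (real j) r A powr (b_coeff H j - b_coeff F j)) * I) \<and>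
    \<bar>ln I\<bar> \<le> real (max (degree F) (degree H)) *
      ((real (card (lattice_classes (unit_group q))
              * num_divisors (group_exponent (unit_group q))) / 2) ^ (r - 1)
         * (real r * \<beta>\<^sup>2 / P ^ (2 ^ (r + 1))) * (1 + P / 2 ^ r)
       + 4 * \<beta> ^ (J + 1) / (real J * P ^ J))"
proof -
  define m where "m = real (max (degree F) (degree H))"
  define c where "c j = b_coeff H j - b_coeff F j" for j
  define Z where "Z = class_log_zeta q P A"
  define l where "l j = log_zeta_approx q P (real j) r A" for j
  obtain S where S:
    "(\<lambda>p. if prime p \<and> P \<le> real p \<and> int p mod int q \<in> A
         then poly F (1 / real p) / poly H (1 / real p) else 1) has_prod exp S"
    "(\<lambda>j. if j \<ge> 2 then c j * class_log_zeta q P A j else 0) sums S"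
    using log_euler_product_sums[OF assms(4-9), of q A] unfolding c_def by blast
  define T where "T = (\<Sum>j=2..J. c j * l j)"
  have "zeta_approx q P (real j) r A powr c j = exp (c j * l j)" for j
    by (simp add: zeta_approx_def powr_def l_def)
  then have prod: "(\<Prod>j=2..J. zeta_approx q P (real j) r A powr c j) = exp T"
    by (simp add: T_def exp_sum)
  have c: "\<bar>c j\<bar> \<le> 4 * m * \<beta> ^ j / real j" if "j \<ge> 1" for j
    unfolding c_def m_def using abs_b_coeff_diff_le[OF assms(8,7) that] .
  have m0: "m \<ge> 0" by (simp add: m_def)
  \<comment> \<open>The first part is the error of the approximations for \<open>j \<le> J\<close>,
    the second the truncation of the series; \<open>exp (S - T)\<close> is the witness for
    \<open>I\<close>.\<close>
  have "S - T = (\<Sum>j=2..J. c j * (Z j - l j)) + (S - (\<Sum>j=2..J. c j * Z j))"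
    by (simp add: T_def right_diff_distrib sum_subtractf)
  then have "\<bar>S - T\<bar> \<le> \<bar>\<Sum>j=2..J. c j * (Z j - l j)\<bar> + \<bar>S - (\<Sum>j=2..J. c j * Z j)\<bar>"
    by linarith
  also have "\<dots> \<le> m * ((real (card (lattice_classes (unit_group q))
              * num_divisors (group_exponent (unit_group q))) / 2) ^ (r - 1)
         * (real r * \<beta>\<^sup>2 / P ^ (2 ^ (r + 1))) * (1 + P / 2 ^ r))
       + m * (4 * \<beta> ^ (J + 1) / (real J * P ^ J))"
    unfolding Z_def l_def
    by (intro add_mono approximation_error[OF assms(1,2,7,9,11) m0 c]
        tail_error[OF assms(1,2,7,9,10) m0 c S(2)])
  finally have bound: "\<bar>ln (exp (S - T))\<bar> \<le> m * ((real (card (lattice_classes (unit_group q))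
              * num_divisors (group_exponent (unit_group q))) / 2) ^ (r - 1)
         * (real r * \<beta>\<^sup>2 / P ^ (2 ^ (r + 1))) * (1 + P / 2 ^ r)
       + 4 * \<beta> ^ (J + 1) / (real J * P ^ J))"
    by (simp only: ln_exp distrib_left)
  have "exp S = exp T * exp (S - T)" by (simp add: exp_add[symmetric])
  then have "(\<lambda>p. if prime p \<and> P \<le> real p \<and> int p mod int q \<in> A
         then poly F (1 / real p) / poly H (1 / real p) else 1) has_prod
      ((\<Prod>j=2..J. zeta_approx q P (real j) r A powr (b_coeff H j - b_coeff F j)) * exp (S - T))"
    using S(1) prod unfolding c_def by simp
  then show ?thesis using bound unfolding m_def by (intro exI[of _ "exp (S - T)"]) simp
qed

end
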